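(* There is an algorithm which, given an odd integer $k \ge 1$ and $2k$ integers $x_1,\ldots,x_{2k}$, constructs in time polynomial in the input size a modulus $M$ and residue classes $a_1,\ldots,a_{2k} \pmod{M}$ with $\gcd(a_i,M)=1$, such that, writing $S = x_1+\cdots+x_{2k}$, whenever $N_1,\ldots,N_{2k}$ are any integers with $N_i \equiv a_i \pmod{M}$ for $i=1,\ldots,2k$, the following hold: (i) for every subset $\{i_1,\ldots,i_\ell\} \subseteq \{1,\ldots,2k\}$ with $\ell \le k$, $$\gcd(2N_{i_1}\cdots N_{i_\ell}+1,\ M) = 1 \iff \ell = k \text{ and } x_{i_1}+\cdots+x_{i_\ell} = S/2;$$ (ii) $N_i - 1 \nmid 4N_1\cdots N_{2k}$ for each $i = 1,\ldots,2k$; (iii) $\gcd(2N_1\cdots N_{2k}+1,\ M) > 1$ and $\gcd(4N_1\cdots N_{2k}+1,\ M) > 1$. *)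

theory Defs
  imports Complex_Main "HOL-Library.Log_Nat" "HOL-Computational_Algebra.Polynomial"
    "HOL-Number_Theory.Cong"
begin

text \<open>
  Algorithms are programs of a random access machine in structured form. The memory has one
  integer cell for every integer address; cells with a computed address can be read and written.
  Running time is measured in bit complexity: every access is charged the number of bits of the
  address and of the contents involved, and every arithmetic operation is charged according to the
  number of bits of its operands. Up to polynomial factors this is the time of a Turing machine,
  so that polynomial time has its usual meaning.
\<close>

type_synonym mem = "int \<Rightarrow> int"

text \<open>The number of bits of an integer: the binary digits of the absolute value and the sign.\<close>

definition bits :: "int \<Rightarrow> nat" where
  "bits z = floorlog 2 (nat \<bar>z\<bar>) + 1"

datatype binop = Plus | Minus | Times | Quot | Rem

datatype expr = Const int | Cell expr | Bin binop expr expr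

datatype com =
    Skip
  | Store expr expr
  | Seq com com
  | Cond expr com com
  | While expr com

fun apply_op :: "binop \<Rightarrow> int \<Rightarrow> int \<Rightarrow> int" where
  "apply_op Plus a b = a + b"
| "apply_op Minus a b = a - b"
| "apply_op Times a b = a * b"
| "apply_op Quot a b = a div b"
| "apply_op Rem a b = a mod b"

text \<open>Multiplication and division are charged as in the schoolbook methods.\<close>

fun op_cost :: "binop \<Rightarrow> int \<Rightarrow> int \<Rightarrow> nat" where
  "op_cost Plus a b = bits a + bits b"
| "op_cost Minus a b = bits a + bits b"
| "op_cost Times a b = bits a * bits b"
| "op_cost Quot a b = bits a * bits b"
| "op_cost Rem a b = bits a * bits b"

fun val :: "expr \<Rightarrow> mem \<Rightarrow> int" where
  "val (Const n) s = n"
| "val (Cell e) s = s (val e s)"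
| "val (Bin f e1 e2) s = apply_op f (val e1 s) (val e2 s)"

fun cost :: "expr \<Rightarrow> mem \<Rightarrow> nat" where
  "cost (Const n) s = bits n"
| "cost (Cell e) s = cost e s + bits (val e s) + bits (s (val e s))"
| "cost (Bin f e1 e2) s = cost e1 s + cost e2 s + op_cost f (val e1 s) (val e2 s)"

text \<open>
  \<open>exec c s t s'\<close>: started in memory \<open>s\<close>, program \<open>c\<close> halts in memory \<open>s'\<close> after time \<open>t\<close>.
  \<open>Store e1 e2\<close> writes the value of \<open>e2\<close> to the cell whose address is the value of \<open>e1\<close>;
  tests ask whether the value of an expression is positive.
\<close>

inductive exec :: "com \<Rightarrow> mem \<Rightarrow> nat \<Rightarrow> mem \<Rightarrow> bool" where
  Skip: "exec Skip s 1 s"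
| Store: "exec (Store e1 e2) s
    (cost e1 s + cost e2 s + bits (val e1 s) + bits (val e2 s) + 1)
    (s(val e1 s := val e2 s))"
| Seq: "exec c1 s t1 s1 \<Longrightarrow> exec c2 s1 t2 s2 \<Longrightarrow> exec (Seq c1 c2) s (t1 + t2 + 1) s2"
| CondTrue: "val e s > 0 \<Longrightarrow> exec c1 s t s1 \<Longrightarrow>
    exec (Cond e c1 c2) s (cost e s + t + 1) s1"
| CondFalse: "\<not> val e s > 0 \<Longrightarrow> exec c2 s t s1 \<Longrightarrow>
    exec (Cond e c1 c2) s (cost e s + t + 1) s1"
| WhileFalse: "\<not> val e s > 0 \<Longrightarrow> exec (While e c) s (cost e s + 1) s"
| WhileTrue: "val e s > 0 \<Longrightarrow> exec c s t1 s1 \<Longrightarrow> exec (While e c) s1 t2 s2 \<Longrightarrow>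
    exec (While e c) s (cost e s + t1 + t2 + 1) s2"

lemma exec_deterministic:
  assumes "exec c s t s1" and "exec c s t' s2"
  shows "t = t' \<and> s1 = s2"
  using assms
proof (induction arbitrary: t' s2 rule: exec.induct)
  case (Skip s)
  from Skip.prems show ?case by (cases rule: exec.cases) simp_all
next
  case (Store e1 e2 s)
  from Store.prems show ?case by (cases rule: exec.cases) simp_all
next
  case (Seq c1 s t1 s1 c2 t2 s3)
  from Seq.prems obtain u1 u2 r where "exec c1 s u1 r" "exec c2 r u2 s2" "t' = u1 + u2 + 1"
    by (cases rule: exec.cases) simp_all
  with Seq.IH(1)[of u1 r] Seq.IH(2)[of u2 s2] show ?case by simp
next
  case (CondTrue e s c1 t s1 c2)
  from CondTrue.prems CondTrue.hyps(1) obtain u where "exec c1 s u s2" "t' = cost e s + u + 1"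
    by (cases rule: exec.cases) simp_all
  with CondTrue.IH[of u s2] show ?case by simp
next
  case (CondFalse e s c2 t s1 c1)
  from CondFalse.prems CondFalse.hyps(1) obtain u where "exec c2 s u s2" "t' = cost e s + u + 1"
    by (cases rule: exec.cases) simp_all
  with CondFalse.IH[of u s2] show ?case by simp
next
  case (WhileFalse e s c)
  from WhileFalse.prems WhileFalse.hyps show ?case by (cases rule: exec.cases) simp_all
next
  case (WhileTrue e s c t1 s1 t2 s3)
  from WhileTrue.prems WhileTrue.hyps(1) obtain u1 u2 r
    where "exec c s u1 r" "exec (While e c) r u2 s2" "t' = cost e s + u1 + u2 + 1"
    by (cases rule: exec.cases) simp_all
  with WhileTrue.IH(1)[of u1 r] WhileTrue.IH(2)[of u2 s2] show ?case by simp
qed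

text \<open>
  Input and output are finite sequences of integers, stored in the cells with addresses
  0, 1, 2, and so on. All other cells are 0 at the start and arbitrary at the end.
\<close>

definition init_mem :: "int list \<Rightarrow> mem" where
  "init_mem inp = (\<lambda>a. if 0 \<le> a \<and> a < int (length inp) then inp ! nat a else 0)"

definition input_size :: "int list \<Rightarrow> nat" where
  "input_size inp = sum_list (map bits inp)"

definition outputs_within :: "com \<Rightarrow> int list \<Rightarrow> nat \<Rightarrow> int list \<Rightarrow> bool" where
  "outputs_within c inp T out \<longleftrightarrow>
     (\<exists>t s. exec c (init_mem inp) t s \<and> t \<le> T \<and> (\<forall>i < length out. s (int i) = out ! i))"

end

theory Submission
  imports Defs "HOL-Number_Theory.Number_Theory"
begin

text \<open>
  Take \<open>a i = 11\<close> modulo \<open>15\<close>. Then \<open>a i = - 1\<close> modulo \<open>3\<close> handles all subsets of even size and the first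
  half of (iii), while \<open>a i = 1\<close> modulo \<open>5\<close> gives (ii) and the second half of (iii).

  For the remaining subsets let \<open>r < s\<close> be primes greater than \<open>k + 1\<close> and let
  \<open>m = (2 ^ (r * s) - 1) / ((2 ^ r - 1) * (2 ^ s - 1))\<close>. If \<open>s\<close> does not divide \<open>2 ^ r - 1\<close>, then \<open>2\<close> has
  order \<open>r * s\<close> modulo every prime factor of \<open>m\<close>. Put \<open>a i = - (2 ^ w i)\<close> modulo \<open>m\<close>. For a subset \<open>I\<close> of odd
  size, twice the product of the \<open>a i\<close> plus one is \<open>1 - 2 ^ (W + 1)\<close>, where \<open>W\<close> is the sum of the \<open>w i\<close>, so
  \<open>m\<close> detects \<open>I\<close> if and only if \<open>r * s\<close> divides \<open>W + 1\<close>. Since \<open>k\<close> is invertible modulo \<open>r * s\<close>, the \<open>w i\<close>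
  can be chosen as affine functions of the \<open>x i\<close> such that \<open>m\<close> detects exactly the sets of size \<open>k\<close> whose
  discrepancy \<open>d = 2 * (\<Sum>i\<in>I. x i) - S\<close> lies in a prescribed nonzero residue class modulo \<open>r\<close>, or
  all sets of a prescribed odd size below \<open>k\<close> and no set of size \<open>k\<close>. Every \<open>r\<close> needs fewer than \<open>2 * r\<close>
  such conditions, one for each \<open>s\<close>. A nonzero \<open>d\<close> is not divisible by all primes in a
  range of polynomial size, so all unwanted sets are detected. That polynomial ranges contain
  enough primes follows from \<open>m * (n choose m)\<close> dividing every common multiple of \<open>1, \<dots>, n\<close>.
\<close>

subsection \<open>Many primes\<close>

text \<open>Leibniz's harmonic triangle: \<open>1 / ((m + 1) * (n choose (m + 1)))\<close> is the
  difference of \<open>1 / (m * ((n - 1) choose m))\<close> and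
  \<open>1 / (m * (n choose m))\<close>. Multiplied by \<open>Q\<close>, the last two become
  integers by the induction hypothesis, hence so does the first.\<close>

lemma times_binomial_dvd:
  assumes "\<And>i. 1 \<le> i \<Longrightarrow> i \<le> n \<Longrightarrow> i dvd Q" and "1 \<le> m" and "m \<le> n"
  shows "m * (n choose m) dvd (Q :: nat)"
  using assms(2,3,1)
proof (induction m arbitrary: n rule: nat_induct_at_least)
  case base
  then show ?case by simp
next
  case (Suc m)
  then obtain n' where n': "n = Suc n'" by (cases n) auto
  have "m * (n' choose m) dvd Q" and "m * (n choose m) dvd Q"
    using Suc n' by auto
  then obtain u v where u: "Q = m * (n' choose m) * u" and v: "Q = m * (n choose m) * v"
    by (elim dvdE)
  have 2: "(n - m) * (n choose m) = n * (n' choose m)"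
    using binomial_absorb_comp[of n m] n' by simp
  have 1: "Suc m * (n choose Suc m) = (n - m) * (n choose m)"
    using binomial_absorption[of m n] 2 n' by simp
  define T where "T = Suc m * (n choose Suc m)"
  \<comment> \<open>In terms of the cofactors the triangle identity reads
    \<open>Q = T * (u - v)\<close>; multiplying by \<open>m\<close> and adding \<open>m * Q\<close>
    avoids fractions and subtraction.\<close>
  have "m * (T * u) = n * Q"
    unfolding T_def 1 2 by (subst u) (simp add: algebra_simps)
  moreover have "m * (T * v) = (n - m) * Q"
    unfolding T_def 1 by (subst v) (simp add: algebra_simps)
  moreover have "n * Q = (n - m) * Q + m * Q"
    using Suc.prems by (simp flip: distrib_right)
  ultimately have "m * (T * u) = m * (T * v + Q)"
    by (simp add: distrib_left)
  then have "T * u = T * v + Q"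
    using Suc.hyps by simp
  then have "T dvd T * v + Q"
    by (metis dvd_triv_left)
  then have "T dvd Q"
    by (subst (asm) dvd_add_right_iff) auto
  then show ?case
    by (simp only: T_def)
qed

lemma largest_power_le:
  fixes p n :: nat
  assumes "2 \<le> p" and "0 < n"
  obtains e where "p ^ e \<le> n" and "\<And>j. p ^ j \<le> n \<Longrightarrow> j \<le> e"
proof -
  have bd: "j \<le> n" if "p ^ j \<le> n" for j
    using power_gt_expt[of p j] that assms(1) by linarith
  have "p ^ 0 \<le> n" using assms(2) by simp
  then show ?thesis
    using that[of "GREATEST j. p ^ j \<le> n"]
      GreatestI_nat[of "\<lambda>j. p ^ j \<le> n" 0 n, OF _ bd]
      Greatest_le_nat[of "\<lambda>j. p ^ j \<le> n" _ n, OF _ bd] by blast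
qed

text \<open>The witness is the least common multiple of \<open>1, ..., n\<close>: each prime up to
  \<open>n\<close> enters with its largest power not exceeding \<open>n\<close>, so every factor of
  the product is at most \<open>n\<close>.\<close>

lemma common_multiple_le_power_primes:
  assumes "n > 0"
  obtains Q :: nat where "0 < Q" and "\<And>i. 1 \<le> i \<Longrightarrow> i \<le> n \<Longrightarrow> i dvd Q"
    and "Q \<le> n ^ card {p. prime p \<and> p \<le> n}"
proof -
  define P where "P = {p :: nat. prime p \<and> p \<le> n}"
  have "\<exists>e. p ^ e \<le> n \<and> (\<forall>j. p ^ j \<le> n \<longrightarrow> j \<le> e)" if "p \<in> P" for p
    using largest_power_le[of p n] that assms by (metis P_def mem_Collect_eq prime_ge_2_nat)
  then obtain e where e: "\<And>p. p \<in> P \<Longrightarrow> p ^ e p \<le> n"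
    and e': "\<And>p j. p \<in> P \<Longrightarrow> p ^ j \<le> n \<Longrightarrow> j \<le> e p"
    by metis
  define Q where "Q = (\<Prod>p\<in>P. p ^ e p)"
  have fin: "finite P" by (simp add: P_def)
  have "i dvd Q" if i: "1 \<le> i" "i \<le> n" for i
  proof -
    have "x \<le> n" if "x dvd i" for x
      using dvd_imp_le[OF that] i by linarith
    then have sub: "prime_factors i \<subseteq> P"
      by (auto simp: P_def in_prime_factors_iff)
    have "i = (\<Prod>p\<in>prime_factors i. p ^ multiplicity p i)"
      by (rule prime_factorization_nat) (use i in simp)
    also have "\<dots> dvd (\<Prod>p\<in>prime_factors i. p ^ e p)"
    proof (rule prod_dvd_prod)
      fix p assume p: "p \<in> prime_factors i"
      have "p ^ multiplicity p i \<le> i"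
        by (rule dvd_imp_le[OF multiplicity_dvd]) (use i in simp)
      then have "multiplicity p i \<le> e p"
        using e' p sub i by (meson le_trans subsetD)
      then show "p ^ multiplicity p i dvd p ^ e p"
        by (rule le_imp_power_dvd)
    qed
    also have "\<dots> dvd Q"
      unfolding Q_def by (rule prod_dvd_prod_subset[OF fin sub])
    finally show ?thesis .
  qed
  moreover have "Q \<le> (\<Prod>p\<in>P. n)"
    unfolding Q_def by (rule prod_mono) (simp add: e)
  moreover have "Q > 0"
    unfolding Q_def by (intro prod_pos) (auto simp: P_def prime_gt_0_nat)
  ultimately show ?thesis
    using that[of Q] by (simp add: P_def)
qed

lemma four_square_less_power: "4 * j\<^sup>2 + 1 < (16 :: nat) ^ j" if "j \<ge> 1"
  using that
proof (induction j rule: nat_induct_at_least)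
  case (Suc j)
  have "j * 1 \<le> j * j" using Suc(1) by (intro mult_le_mono) auto
  then have "4 * (Suc j)\<^sup>2 + 1 \<le> 16 * (4 * j\<^sup>2 + 1)"
    unfolding power2_eq_square by (simp; linarith)
  then show ?case using Suc.IH by simp
qed auto

text \<open>A bound of Chebyshev type. For \<open>n = 2 * m + 1\<close> the divisor
  \<open>n * (2 * m choose m)\<close> forces a common multiple of \<open>1, ..., n\<close> to be at
  least \<open>4 ^ m\<close>, while the one constructed above is at most \<open>n\<close> to the
  number of primes up to \<open>n\<close>.\<close>

lemma primes_upto_ge:
  "N \<le> card {p :: nat. prime p \<and> p \<le> 4 * N\<^sup>2 + 1}"
proof (cases "N = 0")
  case False
  define n where "n = 4 * N\<^sup>2 + 1"
  obtain Q where "Q > 0" and dvd: "\<And>i. 1 \<le> i \<Longrightarrow> i \<le> n \<Longrightarrow> i dvd Q"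
    and Q: "Q \<le> n ^ card {p. prime p \<and> p \<le> n}"
    by (rule common_multiple_le_power_primes[of n]) (auto simp: n_def)
  \<comment> \<open>This choice gives \<open>4 ^ m = (16 ^ N) ^ N\<close>. Since
    \<open>n < 16 ^ N\<close>, the exponent of \<open>n\<close> must exceed
    \<open>N\<close>.\<close>
  define m where "m = 2 * N\<^sup>2"
  have n: "n = Suc (2 * m)" by (simp add: n_def m_def)
  have m: "m > 0" using False by (simp add: m_def)
  have "(m + 1) * (n choose (m + 1)) dvd Q"
    by (rule times_binomial_dvd[OF dvd]) (use n in auto)
  moreover have "(m + 1) * (n choose (m + 1)) = n * (2 * m choose m)"
    unfolding Suc_eq_plus1[symmetric] using binomial_absorption[of m n] n by (simp del: binomial_Suc_Suc)
  ultimately have "n * (2 * m choose m) dvd Q" by simp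
  then have "n * (2 * m choose m) \<le> Q"
    using \<open>Q > 0\<close> by (rule dvd_imp_le)
  moreover have "4 ^ m \<le> n * (2 * m choose m)"
  proof -
    have "real (4 ^ m) \<le> real (2 * m * (2 * m choose m))"
      using central_binomial_lower_bound[OF m] m by (simp add: field_simps)
    then have "4 ^ m \<le> 2 * m * (2 * m choose m)"
      by (simp only: of_nat_le_iff)
    also have "\<dots> \<le> n * (2 * m choose m)"
      unfolding n by (rule mult_le_mono1) simp
    finally show ?thesis .
  qed
  ultimately have le: "4 ^ m \<le> n ^ card {p. prime p \<and> p \<le> n}" using Q by linarith
  have "n < 16 ^ N"
    unfolding n_def by (rule four_square_less_power) (use False in simp)
  then have "n ^ N < (16 ^ N) ^ N"
    using False by (intro power_strict_mono) auto
  also have "((16 :: nat) ^ N) ^ N = 4 ^ m"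
  proof -
    have "((16 :: nat) ^ N) ^ N = (4 ^ 2) ^ (N * N)"
      by (simp flip: power_mult)
    also have "\<dots> = 4 ^ m"
      unfolding m_def power2_eq_square[of N] by (rule power_mult[symmetric])
    finally show ?thesis .
  qed
  finally have "n ^ N < n ^ card {p. prime p \<and> p \<le> n}" using le by linarith
  then have "N < card {p. prime p \<and> p \<le> n}"
    by (rule power_less_imp_less_exp[rotated]) (use n m in simp)
  then show ?thesis by (simp add: n_def)
qed auto

lemma two_power_card_prime_factors_le:
  assumes "n > 0"
  shows "2 ^ card (prime_factors n) \<le> (n :: nat)"
proof -
  have "(2 :: nat) ^ card (prime_factors n) = (\<Prod>p\<in>prime_factors n. 2)"
    by simp
  also have "\<dots> \<le> (\<Prod>p\<in>prime_factors n. p ^ multiplicity p n)"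
  proof (rule prod_mono)
    fix p assume p: "p \<in> prime_factors n"
    then have "2 \<le> p ^ 1" by (auto dest: in_prime_factors_imp_prime prime_ge_2_nat)
    also have "\<dots> \<le> p ^ multiplicity p n"
      using p by (intro power_increasing) (auto simp: prime_factors_multiplicity Suc_le_eq prime_gt_0_nat)
    finally show "0 \<le> (2 :: nat) \<and> 2 \<le> p ^ multiplicity p n" by simp
  qed
  also have "\<dots> = n"
    by (rule prime_factorization_nat[OF assms, symmetric])
  finally show ?thesis .
qed

subsection \<open>The factors of powers of two minus one\<close>

text \<open>Euclid's algorithm on the exponents. It stands in for the multiplicative order of 2
  modulo \<open>q\<close> in all later arguments.\<close>

lemma cong_two_power_gcd:
  fixes q :: int
  assumes "[2 ^ a = 1] (mod q)" and "[2 ^ b = 1] (mod q)"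
  shows "[2 ^ gcd a b = 1] (mod q)"
  using assms
proof (induction a b rule: gcd_nat_induct)
  case (step m n)
  have "(2 :: int) ^ m = (2 ^ n) ^ (m div n) * 2 ^ (m mod n)"
    by (simp flip: power_mult power_add)
  moreover have "[(2 ^ n) ^ (m div n) * 2 ^ (m mod n) = 1 ^ (m div n) * 2 ^ (m mod n)] (mod q)"
    by (intro cong_mult cong_pow step.prems cong_refl)
  ultimately have "[2 ^ (m mod n) = 1] (mod q)"
    using step.prems(1) by (metis cong_sym cong_trans mult_1 power_one)
  then show ?case
    using step.IH step.prems by (simp add: gcd_red_nat[of m n])
qed auto

lemma cong_two_power_dvd:
  fixes q :: int
  assumes "[2 ^ a = 1] (mod q)" and "a dvd b"
  shows "[2 ^ b = 1] (mod q)"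
proof -
  from assms(2) obtain d where "b = a * d" by (elim dvdE)
  then show ?thesis using cong_pow[OF assms(1), of d] by (simp add: power_mult)
qed

lemma not_cong_two_power_one: "prime (q :: int) \<Longrightarrow> \<not> [2 ^ 1 = 1] (mod q)"
  by (auto simp: cong_iff_dvd_diff)

text \<open>For distinct primes \<open>r\<close> and \<open>s\<close> this is the value at 2 of the
  cyclotomic polynomial of index \<open>r * s\<close>.\<close>

definition cyclo :: "nat \<Rightarrow> nat \<Rightarrow> int" where
  "cyclo r s = (2 ^ (r * s) - 1) div (2 ^ r - 1) div (2 ^ s - 1)"

text \<open>Cancelling \<open>2 ^ b - 1\<close> turns \<open>c\<close> into a geometric sum of
  \<open>a\<close> powers of \<open>2 ^ b\<close>. Each of them is 1 modulo \<open>q\<close>, so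
  \<open>c\<close> is congruent to \<open>a\<close>.\<close>

lemma dvd_if_cong_two_power:
  fixes q :: int
  assumes "c * (2 ^ b - 1) = 2 ^ (a * b) - 1" and "q dvd c" and "[2 ^ b = 1] (mod q)" and "b > 0"
  shows "q dvd int a"
proof -
  have "c * (2 ^ b - 1) = (2 ^ b) ^ a - 1"
    using assms(1) by (simp add: mult.commute flip: power_mult)
  also have "\<dots> = (\<Sum>i<a. (2 ^ b) ^ i) * (2 ^ b - 1)"
    by (simp add: power_diff_1_eq)
  finally have "c = (\<Sum>i<a. (2 ^ b) ^ i)"
    using assms(4) by simp
  also have "[\<dots> = (\<Sum>i<a. 1 ^ i)] (mod q)"
    by (intro cong_sum cong_pow assms(3))
  finally show ?thesis
    using assms(2) by (simp add: cong_dvd_iff)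
qed

locale prime_pair =
  fixes r s :: nat
  assumes prime_r: "prime r" and prime_s: "prime s" and r_gt: "2 < r" and r_less: "r < s"
begin

lemma coprime_r_s: "coprime r s"
  using prime_r prime_s r_less by (simp add: primes_coprime)

text \<open>Both divisions in \<open>cyclo\<close> are exact: the two divisors divide
  \<open>2 ^ (r * s) - 1\<close> and are coprime, because a common divisor also divides
  \<open>2 ^ gcd r s - 1 = 1\<close>.\<close>

lemma cyclo_mult: "cyclo r s * (2 ^ r - 1) * (2 ^ s - 1) = 2 ^ (r * s) - 1"
proof -
  have "coprime ((2 :: int) ^ r - 1) (2 ^ s - 1)"
  proof (rule coprimeI)
    fix c :: int assume "c dvd 2 ^ r - 1" "c dvd 2 ^ s - 1"
    then have "[2 ^ gcd r s = 1] (mod c)"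
      by (intro cong_two_power_gcd) (simp_all add: cong_iff_dvd_diff)
    then show "is_unit c"
      using coprime_r_s by (simp add: cong_iff_dvd_diff)
  qed
  moreover have "(2 :: int) ^ a - 1 dvd 2 ^ (r * s) - 1" if "a dvd r * s" for a
    using cong_two_power_dvd[OF _ that, of "2 ^ a - 1"] by (simp add: cong_iff_dvd_diff)
  ultimately have "((2 :: int) ^ r - 1) * (2 ^ s - 1) dvd 2 ^ (r * s) - 1"
    by (simp add: divides_mult)
  moreover have "cyclo r s = (2 ^ (r * s) - 1) div ((2 ^ r - 1) * (2 ^ s - 1))"
    unfolding cyclo_def by (rule zdiv_zmult2_eq[symmetric]) simp
  ultimately show ?thesis by (simp add: mult.assoc)
qed

lemma cyclo_dvd: "cyclo r s dvd 2 ^ (r * s) - 1"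
  unfolding cyclo_mult[symmetric] mult.assoc by (rule dvd_triv_left)

text \<open>This provides a prime factor for detecting sets. Otherwise
  \<open>2 ^ (r * s) - 1\<close> would be at most
  \<open>(2 ^ r - 1) * (2 ^ s - 1) < 2 ^ (r + s) - 1\<close>, although
  \<open>r + s \<le> r * s\<close>.\<close>

lemma cyclo_gt_1: "1 < cyclo r s"
proof (rule ccontr)
  define X Y :: int where "X = 2 ^ r" and "Y = 2 ^ s"
  have XY: "2 \<le> X" "2 \<le> Y"
    using r_gt r_less by (auto simp: X_def Y_def self_le_power)
  assume "\<not> 1 < cyclo r s"
  then have "cyclo r s * ((X - 1) * (Y - 1)) \<le> 1 * ((X - 1) * (Y - 1))"
    using XY by (intro mult_right_mono) auto
  then have "(2 :: int) ^ (r * s) - 1 \<le> (X - 1) * (Y - 1)"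
    using cyclo_mult by (simp add: X_def Y_def mult.assoc)
  also have "\<dots> < X * Y - 1"
    using XY by (simp add: algebra_simps)
  also have "X * Y = 2 ^ (r + s)"
    by (simp add: X_def Y_def power_add)
  also have "(2 :: int) ^ (r + s) \<le> 2 ^ (r * s)"
  proof (rule power_increasing)
    have "r + s \<le> 2 * s" using r_less by simp
    also have "\<dots> \<le> r * s" using r_gt by (intro mult_le_mono1) simp
    finally show "r + s \<le> r * s" .
  qed simp
  finally show False by simp
qed

lemma cyclo_le: "cyclo r s \<le> 2 ^ (r * s)"
proof -
  have "cyclo r s \<le> 2 ^ (r * s) - 1"
    by (rule zdvd_imp_le[OF cyclo_dvd]) (use r_gt r_less in simp)
  then show ?thesis by simp
qed

lemma cong_two_power_cyclo:
  assumes "q dvd cyclo r s"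
  shows "[2 ^ (r * s) = 1] (mod q)"
  using dvd_trans[OF assms cyclo_dvd] by (simp add: cong_iff_dvd_diff)

text \<open>Otherwise the geometric sum forces \<open>q = r\<close>, and Fermat gives
  \<open>2 ^ (r - 1) = 1\<close> modulo \<open>q\<close> as well. The prime \<open>s\<close> exceeds
  \<open>r - 1\<close>, so the two exponents are coprime and \<open>q\<close> would divide
  1.\<close>

lemma not_cong_two_power_s:
  assumes "prime q" and "q dvd cyclo r s"
  shows "\<not> [2 ^ s = 1] (mod q)"
proof
  assume s: "[2 ^ s = 1] (mod q)"
  have "q dvd int r"
    by (rule dvd_if_cong_two_power[of "cyclo r s * (2 ^ r - 1)" s r])
      (use cyclo_mult assms s prime_s in \<open>auto dest: prime_gt_0_nat\<close>)
  then have q: "q = int r"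
    using assms(1) prime_r by (simp add: primes_dvd_imp_eq)
  have "[(2 :: nat) ^ (r - 1) = 1] (mod r)"
    by (rule fermat_theorem[OF prime_r]) (use r_gt in \<open>auto dest: dvd_imp_le\<close>)
  then have "[2 ^ (r - 1) = 1] (mod q)"
    unfolding q using cong_int_iff[of "2 ^ (r - 1)" 1 r] by simp
  with s have "[2 ^ gcd s (r - 1) = 1] (mod q)"
    by (intro cong_two_power_gcd)
  moreover have "coprime s (r - 1)"
    by (rule prime_imp_coprime[OF prime_s]) (use r_gt r_less in \<open>auto dest: dvd_imp_le\<close>)
  ultimately show False
    using not_cong_two_power_one[OF assms(1)] by simp
qed

text \<open>The geometric sum now forces \<open>q = s\<close>. Fermat does not help, since
  \<open>r\<close> may divide \<open>s - 1\<close>; the last assumption excludes exactly this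
  case.\<close>

lemma not_cong_two_power_r:
  assumes "prime q" and "q dvd cyclo r s" and "\<not> [2 ^ r = 1] (mod int s)"
  shows "\<not> [2 ^ r = 1] (mod q)"
proof
  assume r: "[2 ^ r = 1] (mod q)"
  have "q dvd int s"
    by (rule dvd_if_cong_two_power[of "cyclo r s * (2 ^ s - 1)" r s])
      (use cyclo_mult assms r r_gt in \<open>auto simp: mult_ac\<close>)
  then have "q = int s"
    using assms(1) prime_s by (simp add: primes_dvd_imp_eq)
  with r assms(3) show False by simp
qed

end

subsection \<open>The invariant of the construction\<close>

text \<open>The common factor is taken to be prime so that detection splits along products of
  moduli.\<close>

definition hits :: "int \<Rightarrow> (nat \<Rightarrow> int) \<Rightarrow> nat set \<Rightarrow> bool" where
  "hits M a I \<longleftrightarrow> (\<exists>q. prime q \<and> q dvd M \<and> q dvd 2 * (\<Prod>i\<in>I. a i) + 1)"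

lemma gcd_eq_1_iff_not_hits:
  assumes "M \<noteq> 0"
  shows "gcd (2 * (\<Prod>i\<in>I. a i) + 1) M = 1 \<longleftrightarrow> \<not> hits M a I"
proof
  assume "gcd (2 * (\<Prod>i\<in>I. a i) + 1) M = 1"
  then show "\<not> hits M a I"
    unfolding hits_def by (metis gcd_greatest not_prime_unit)
next
  let ?g = "gcd (2 * (\<Prod>i\<in>I. a i) + 1) M"
  assume "\<not> hits M a I"
  then have "\<not> (\<exists>q. q dvd ?g \<and> prime q)"
    by (auto simp: hits_def)
  then have "is_unit ?g"
    using prime_divisor_exists[of ?g] assms by auto
  then show "?g = 1" by simp
qed

lemma hits_cong:
  assumes "\<And>i. i \<in> I \<Longrightarrow> [a i = b i] (mod M)"
  shows "hits M a I \<longleftrightarrow> hits M b I"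
proof -
  have "q dvd 2 * (\<Prod>i\<in>I. a i) + 1 \<longleftrightarrow> q dvd 2 * (\<Prod>i\<in>I. b i) + 1" if "q dvd M" for q
    by (rule cong_dvd_iff) (intro cong_add cong_mult cong_prod cong_refl cong_dvd_modulus[OF _ that] assms)
  then show ?thesis by (auto simp: hits_def)
qed

lemma hits_mult: "hits (M * m) a I \<longleftrightarrow> hits M a I \<or> hits m a I"
  by (auto simp: hits_def prime_dvd_mult_iff)

lemma hits_neg_power_iff:
  assumes "\<And>i. i \<in> I \<Longrightarrow> [a i = - (2 ^ w i)] (mod m)" and "odd (card I)"
  shows "hits m a I \<longleftrightarrow> (\<exists>q. prime q \<and> q dvd m \<and> [2 ^ ((\<Sum>i\<in>I. w i) + 1) = 1] (mod q))"
proof -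
  have "(\<Prod>i\<in>I. - (2 ^ w i)) = - (2 ^ (\<Sum>i\<in>I. w i) :: int)"
    using assms(2) by (simp add: prod_uminus power_sum)
  then have "q dvd 2 * (\<Prod>i\<in>I. - (2 ^ w i)) + 1 \<longleftrightarrow> [2 ^ ((\<Sum>i\<in>I. w i) + 1) = 1] (mod q)" for q :: int
    by (simp add: cong_iff_dvd_diff dvd_diff_commute[of q 1])
  with hits_cong[of I a "\<lambda>i. - (2 ^ w i)" m] assms(1) show ?thesis
    by (auto simp: hits_def)
qed

locale partition_instance =
  fixes k :: nat and x :: "nat \<Rightarrow> int"
  assumes odd_k: "odd k"
begin

definition disc :: "nat set \<Rightarrow> int" where
  "disc I = 2 * (\<Sum>i\<in>I. x i) - (\<Sum>i = 1..2 * k. x i)"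

text \<open>The part of the invariant that no extension may destroy: solutions of the partition
  problem stay undetected. Reduced residues keep the numbers of the program small, and the value 11
  modulo 15 preserves the behaviour at 3 and 5.\<close>

definition safe :: "int \<Rightarrow> (nat \<Rightarrow> int) \<Rightarrow> bool" where
  "safe M a \<longleftrightarrow> M > 0 \<and> 15 dvd M \<and>
     (\<forall>i\<in>{1..2 * k}. 0 \<le> a i \<and> a i < M \<and> coprime (a i) M \<and> [a i = 11] (mod 15)) \<and>
     (\<forall>I \<subseteq> {1..2 * k}. card I = k \<and> disc I = 0 \<longrightarrow> \<not> hits M a I)"

text \<open>
  The conditions attached to \<open>r\<close> are numbered by \<open>j\<close>: below \<open>k\<close> it is a size of subsets, and from \<open>k\<close> on
  the value \<open>j - k + 1\<close> is a residue class modulo \<open>r\<close>, nonzero as long as \<open>j < k + r - 1\<close>.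
\<close>

definition covers :: "int \<Rightarrow> (nat \<Rightarrow> int) \<Rightarrow> nat \<Rightarrow> nat \<Rightarrow> bool" where
  "covers M a r j \<longleftrightarrow> (\<forall>I \<subseteq> {1..2 * k}.
     (if j < k then odd j \<and> card I = j else card I = k \<and> int r dvd disc I - (int j - int k + 1)) \<longrightarrow>
     hits M a I)"

text \<open>Pairs of primes are processed in lexicographic order. A prime factor of \<open>M\<close>
  other than 3 and 5 is tied to a processed pair by the exponent \<open>r' * s'\<close>, which is
  what makes the next modulus coprime to \<open>M\<close>.\<close>

definition earlier :: "int \<Rightarrow> nat \<Rightarrow> nat \<Rightarrow> bool" where
  "earlier M r s \<longleftrightarrow> (\<forall>q. prime q \<and> q dvd M \<longrightarrow> q dvd 15 \<or>
     (\<exists>r' s'. prime_pair r' s' \<and> (r' < r \<or> r' = r \<and> s' < s) \<and> [2 ^ (r' * s') = 1] (mod q)))"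

lemma covers_mono:
  assumes "covers M a r j" and "\<And>i. i \<in> {1..2 * k} \<Longrightarrow> [a' i = a i] (mod M)"
  shows "covers (M * m) a' r j"
proof -
  have "hits (M * m) a' I" if "hits M a I" "I \<subseteq> {1..2 * k}" for I
    using that hits_cong[of I a' a M] assms(2) unfolding hits_mult by blast
  with assms(1) show ?thesis by (auto simp: covers_def)
qed

lemma earlier_mono:
  assumes "earlier M r s" and "r < r' \<or> r = r' \<and> s \<le> s'"
  shows "earlier M r' s'"
  unfolding earlier_def
proof (intro allI impI)
  fix q :: int assume "prime q \<and> q dvd M"
  then consider "q dvd 15"
    | u v where "prime_pair u v" "u < r \<or> u = r \<and> v < s" "[2 ^ (u * v) = 1] (mod q)"
    using assms(1) unfolding earlier_def by blast
  then show "q dvd 15 \<or> (\<exists>u v. prime_pair u v \<and> (u < r' \<or> u = r' \<and> v < s') \<and> [2 ^ (u * v) = 1] (mod q))"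
  proof cases
    case 2
    moreover have "u < r' \<or> u = r' \<and> v < s'"
      using 2(2) assms(2) by linarith
    ultimately show ?thesis by blast
  qed blast
qed

lemma earlier_cyclo:
  assumes "earlier M r s" and "prime_pair r s"
  shows "earlier (M * cyclo r s) r (s + 1)"
  unfolding earlier_def
proof (intro allI impI)
  interpret prime_pair r s by fact
  fix q :: int assume q: "prime q \<and> q dvd M * cyclo r s"
  show "q dvd 15 \<or> (\<exists>r' s'. prime_pair r' s' \<and> (r' < r \<or> r' = r \<and> s' < s + 1) \<and>
      [2 ^ (r' * s') = 1] (mod q))"
  proof (cases "q dvd M")
    case True
    moreover have "earlier M r (s + 1)"
      using assms(1) by (rule earlier_mono) simp
    ultimately show ?thesis using q unfolding earlier_def by blast
  next
    case False
    then have "q dvd cyclo r s" using q prime_dvd_multD by blast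
    then show ?thesis using cong_two_power_cyclo assms(2) by auto
  qed
qed

text \<open>A common prime factor \<open>q\<close> satisfies \<open>2 ^ g = 1\<close> for
  \<open>g\<close> the gcd of \<open>r * s\<close> with the exponent of an earlier pair. Neither
  \<open>r\<close> nor \<open>s\<close> is an exponent for \<open>q\<close>, so both divide
  \<open>g\<close>; this identifies the two pairs and contradicts the order.\<close>

lemma coprime_cyclo:
  assumes "earlier M r s" and "prime_pair r s" and "\<not> [2 ^ r = 1] (mod int s)"
  shows "coprime (cyclo r s) M"
proof (rule ccontr)
  interpret prime_pair r s by fact
  assume "\<not> coprime (cyclo r s) M"
  then obtain q where q: "prime q" "q dvd cyclo r s" "q dvd M"
    using cyclo_gt_1 prime_divisor_exists[of "gcd (cyclo r s) M"] by auto
  have neq: "\<not> [2 ^ r = 1] (mod q)" "\<not> [2 ^ s = 1] (mod q)"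
    using not_cong_two_power_r not_cong_two_power_s q assms(3) by auto
  have odd: "odd r" "odd s"
    using prime_odd_nat prime_r prime_s r_gt r_less by auto
  from assms(1) q consider "q dvd 15"
    | r' s' where "prime_pair r' s'" "r' < r \<or> r' = r \<and> s' < s" "[2 ^ (r' * s') = 1] (mod q)"
    unfolding earlier_def by blast
  then show False
  proof cases
    case 1
    \<comment> \<open>The factors of 15 belong to the exponent 4, since
      \<open>15 = 2 ^ 4 - 1\<close>, and \<open>r * s\<close> is odd.\<close>
    then have "[2 ^ 4 = 1] (mod q)" by (simp add: cong_iff_dvd_diff)
    then have "[2 ^ gcd (r * s) (2 ^ 2) = 1] (mod q)"
      using cong_two_power_cyclo[OF q(2)] by (intro cong_two_power_gcd) auto
    moreover have "coprime (r * s) (2 ^ 2)"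
      unfolding coprime_power_right_iff using odd by simp
    ultimately show False
      using not_cong_two_power_one[OF q(1)] by simp
  next
    case 2
    interpret p': prime_pair r' s' by fact
    define g where "g = gcd (r * s) (r' * s')"
    have g: "[2 ^ g = 1] (mod q)"
      unfolding g_def using cong_two_power_cyclo[OF q(2)] 2(3) by (rule cong_two_power_gcd)
    have "g dvd r * s" "g dvd r' * s'" by (simp_all add: g_def)
    have "\<not> g dvd r" "\<not> g dvd s"
      using neq cong_two_power_dvd[OF g] by auto
    have "r dvd g"
      using \<open>\<not> g dvd s\<close> \<open>g dvd r * s\<close> prime_r
      by (metis coprime_commute coprime_dvd_mult_right_iff prime_imp_coprime)
    moreover have "s dvd g"
      using \<open>\<not> g dvd r\<close> \<open>g dvd r * s\<close> prime_s
      by (metis coprime_commute coprime_dvd_mult_left_iff prime_imp_coprime)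
    ultimately have "r dvd r' * s'" "s dvd r' * s'"
      using \<open>g dvd r' * s'\<close> dvd_trans by blast+
    then have "r = r' \<or> r = s'" "s = r' \<or> s = s'"
      using prime_r prime_s p'.prime_r p'.prime_s by (auto simp: prime_dvd_mult_iff primes_dvd_imp_eq)
    then show False
      using 2(2) r_less p'.r_less by auto
  qed
qed

text \<open>One step of the construction. Below \<open>k\<close> all weights are congruent to
  \<open>c\<close>, where \<open>j * c + 1 = 0\<close> modulo \<open>r * s\<close>. From
  \<open>k\<close> on, the coefficient \<open>e = s\<close> lets the inputs enter only through
  multiples of \<open>s\<close>, so that for a set of size \<open>k\<close> divisibility of the
  exponent by \<open>r * s\<close> becomes a condition on its discrepancy modulo
  \<open>r\<close>.\<close>

lemma
  assumes safe: "safe M a" and pp: "prime_pair r s" and r: "k + 1 < r"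
    and j: "1 \<le> j" "j < k + r - 1"
    and le: "(l, e) = (if j < k then (int j, 0) else (int k, int s))"
    and c: "int (r * s) dvd l * c + 1 + e * ((\<Sum>i = 1..2 * k. x i) + int j - int k + 1)"
    and range: "\<And>i. i \<in> {1..2 * k} \<Longrightarrow> 0 \<le> a' i \<and> a' i < M * cyclo r s"
    and a': "\<And>i. i \<in> {1..2 * k} \<Longrightarrow> [a' i = a i] (mod M)"
    and a'': "\<And>i. i \<in> {1..2 * k} \<Longrightarrow>
      [a' i = - (2 ^ nat ((c + 2 * e * x i) mod int (r * s)))] (mod cyclo r s)"
  shows safe_step: "safe (M * cyclo r s) a'"
    and covers_step: "covers (M * cyclo r s) a' r j"
proof -
  interpret prime_pair r s by fact
  define m where "m = cyclo r s"
  define S where "S = (\<Sum>i = 1..2 * k. x i)"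
  define w where "w i = nat ((c + 2 * e * x i) mod int (r * s))" for i
  have rs: "r * s > 0" using r_gt r_less by simp
  have w: "[int (\<Sum>i\<in>I. w i) + 1 = int (card I) * c + e * (2 * (\<Sum>i\<in>I. x i)) + 1] (mod int (r * s))" for I
  proof -
    have "[(\<Sum>i\<in>I. int (w i)) = (\<Sum>i\<in>I. c + 2 * e * x i)] (mod int (r * s))"
      unfolding w_def using rs by (intro cong_sum) (auto simp: cong_def)
    also have "(\<Sum>i\<in>I. c + 2 * e * x i) = int (card I) * c + e * (2 * (\<Sum>i\<in>I. x i))"
      by (simp add: sum.distrib sum_distrib_left mult.assoc mult.left_commute[of _ 2])
    finally show ?thesis by (simp add: cong_add)
  qed
  have hits_iff: "hits m a' I \<longleftrightarrow> (\<exists>q. prime q \<and> q dvd m \<and> [2 ^ ((\<Sum>i\<in>I. w i) + 1) = 1] (mod q))"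
    if "odd (card I)" "I \<subseteq> {1..2 * k}" for I
    by (rule hits_neg_power_iff[OF _ that(1)]) (unfold m_def w_def, rule a'', use that(2) in blast)
  have hit: "hits m a' I" if "int (r * s) dvd int (card I) * c + e * (2 * (\<Sum>i\<in>I. x i)) + 1"
    "odd (card I)" "I \<subseteq> {1..2 * k}" for I
  proof -
    have "int (r * s) dvd int ((\<Sum>i\<in>I. w i) + 1)"
      using that(1) w[of I] by (simp add: cong_dvd_iff add_ac)
    then have "r * s dvd (\<Sum>i\<in>I. w i) + 1"
      by (simp only: int_dvd_int_iff)
    moreover obtain q where q: "prime q" "q dvd m"
      using prime_divisor_exists[of m] cyclo_gt_1 by (auto simp: m_def)
    ultimately have "[2 ^ ((\<Sum>i\<in>I. w i) + 1) = 1] (mod q)"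
      using cong_two_power_cyclo cong_two_power_dvd by (metis m_def)
    with q show ?thesis
      unfolding hits_iff[OF that(2,3)] by blast
  qed
  \<comment> \<open>If \<open>r\<close> does not divide the exponent, then the gcd of the exponent
    with \<open>r * s\<close> divides \<open>s\<close>, and \<open>2 ^ s = 1\<close> fails modulo
    every prime factor of \<open>m\<close>.\<close>
  have no_hit: "\<not> hits m a' I" if "\<not> int r dvd int (card I) * c + e * (2 * (\<Sum>i\<in>I. x i)) + 1"
    "odd (card I)" "I \<subseteq> {1..2 * k}" for I
  proof -
    have "\<not> [2 ^ ((\<Sum>i\<in>I. w i) + 1) = 1] (mod q)" if q: "prime q" "q dvd m" for q
    proof
      assume *: "[2 ^ ((\<Sum>i\<in>I. w i) + 1) = 1] (mod q)"
      have "[int (\<Sum>i\<in>I. w i) + 1 = int (card I) * c + e * (2 * (\<Sum>i\<in>I. x i)) + 1] (mod int r)"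
        by (rule cong_dvd_modulus[OF w]) simp
      then have "\<not> int r dvd int ((\<Sum>i\<in>I. w i) + 1)"
        using \<open>\<not> int r dvd _\<close> by (simp add: cong_dvd_iff add_ac)
      then have "\<not> r dvd (\<Sum>i\<in>I. w i) + 1"
        unfolding int_dvd_int_iff .
      then have "coprime ((\<Sum>i\<in>I. w i) + 1) r"
        using prime_imp_coprime[OF prime_r] coprime_commute by blast
      then have "coprime (gcd ((\<Sum>i\<in>I. w i) + 1) (r * s)) r"
        by (rule coprime_imp_coprime) auto
      then have "gcd ((\<Sum>i\<in>I. w i) + 1) (r * s) dvd s"
        by (metis coprime_dvd_mult_right_iff gcd_dvd2)
      moreover have "[2 ^ gcd ((\<Sum>i\<in>I. w i) + 1) (r * s) = 1] (mod q)"
        using * cong_two_power_cyclo q(2) by (intro cong_two_power_gcd) (auto simp: m_def)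
      ultimately have "[2 ^ s = 1] (mod q)"
        using cong_two_power_dvd by blast
      then show False
        using not_cong_two_power_s q by (auto simp: m_def)
    qed
    then show ?thesis
      unfolding hits_iff[OF that(2,3)] by blast
  qed
  \<comment> \<open>The first summand vanishes modulo \<open>r * s\<close> by the choice of
    \<open>c\<close>. The second one decides between detection and safety.\<close>
  have weight: "int (card I) * c + e * (2 * (\<Sum>i\<in>I. x i)) + 1 =
      (l * c + 1 + e * (S + int j - int k + 1)) + e * (disc I - (int j - int k + 1))"
    if "int (card I) = l" for I
    using that by (simp add: disc_def S_def algebra_simps)
  have "hits (M * m) a' I" if I: "I \<subseteq> {1..2 * k}"
    "if j < k then odd j \<and> card I = j else card I = k \<and> int r dvd disc I - (int j - int k + 1)" for I
  proof -
    have l: "int (card I) = l" "odd (card I)" using I(2) le odd_k by (auto split: if_splits)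
    have "int (r * s) dvd e * (disc I - (int j - int k + 1))"
      using I(2) le by (auto split: if_splits simp: mult.commute[of "int r"] intro: mult_dvd_mono)
    then have "int (r * s) dvd int (card I) * c + e * (2 * (\<Sum>i\<in>I. x i)) + 1"
      unfolding weight[OF l(1)] using c by (simp add: S_def del: of_nat_mult)
    then show ?thesis using hit l(2) I(1) by (simp add: hits_mult)
  qed
  then show "covers (M * cyclo r s) a' r j"
    by (simp add: covers_def m_def)
  have r_c: "int r dvd l * c + 1 + e * (S + int j - int k + 1)"
    unfolding S_def by (rule dvd_trans[OF _ c]) simp
  have "\<not> hits (M * m) a' I" if I: "I \<subseteq> {1..2 * k}" "card I = k" "disc I = 0" for I
  proof -
    have "hits M a' I \<longleftrightarrow> hits M a I"
      by (rule hits_cong, rule a') (use I in blast)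
    then have "\<not> hits M a' I"
      using safe I unfolding safe_def by blast
    \<comment> \<open>Sets of discrepancy 0 escape. Below \<open>k\<close>, subtracting
      \<open>j * c + 1\<close> from \<open>k * c + 1\<close> leaves \<open>(k - j) * c\<close>,
      where \<open>0 < k - j < r\<close> and \<open>c\<close> is invertible modulo \<open>r\<close>.
      From \<open>k\<close> on, the class \<open>j - k + 1\<close> lies strictly between 0 and
      \<open>r\<close>.\<close>
    moreover have "\<not> int r dvd int (card I) * c + e * (2 * (\<Sum>i\<in>I. x i)) + 1"
    proof
      assume *: "int r dvd int (card I) * c + e * (2 * (\<Sum>i\<in>I. x i)) + 1"
      show False
      proof (cases "j < k")
        case True
        then have 1: "int r dvd int j * c + 1" "int r dvd int k * c + 1"
          using r_c * le I(2) by auto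
        then have "int r dvd (int k - int j) * c"
          using dvd_diff[OF 1(2,1)] by (simp add: left_diff_distrib)
        then have "int r dvd int (k - j) \<or> int r dvd c"
          using prime_dvd_multD[of "int r"] prime_r True by (simp add: of_nat_diff)
        moreover have "\<not> int r dvd int (k - j)"
          unfolding int_dvd_int_iff using True j(1) r by (auto dest: dvd_imp_le)
        moreover have "\<not> int r dvd c"
        proof
          assume "int r dvd c"
          then have "int r dvd int j * c" by simp
          then have "int r dvd 1" using 1(1) by (simp add: dvd_add_right_iff)
          then show False using r by simp
        qed
        ultimately show False by blast
      next
        case False
        then have le': "l = int k" "e = int s" using le by auto
        have "int r dvd e * (disc I - (int j - int k + 1))"
          using * r_c weight[of I] I(2) le'(1) by (metis dvd_add_right_iff)
        then have "int r dvd int s * int (j - k + 1)"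
          using False I(3) le' by (simp add: of_nat_diff algebra_simps dvd_diff_commute)
        then have "r dvd s * (j - k + 1)"
          by (simp only: int_dvd_int_iff flip: of_nat_mult)
        then have "r dvd j - k + 1"
          using coprime_r_s by (simp only: coprime_dvd_mult_right_iff)
        then show False using False j r by (auto dest: dvd_imp_le)
      qed
    qed
    then have "\<not> hits m a' I" using no_hit I odd_k by simp
    ultimately show ?thesis by (simp add: hits_mult)
  qed
  moreover have "coprime (a' i) (M * m) \<and> [a' i = 11] (mod 15)" if i: "i \<in> {1..2 * k}" for i
  proof -
    have "coprime (a' i) M"
      using cong_imp_coprime[OF cong_sym[OF a'[OF i]]] safe i by (simp add: safe_def)
    moreover have "coprime (- (2 ^ w i)) m"
    proof -
      have "odd m"
        using dvd_trans[OF _ cyclo_dvd, of 2] rs by (auto simp: m_def)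
      then show ?thesis by simp
    qed
    then have "coprime (a' i) m"
      using cong_imp_coprime[OF cong_sym[OF a''[OF i]]] by (simp add: m_def w_def)
    moreover have "[a' i = 11] (mod 15)"
      using safe i cong_trans[OF cong_dvd_modulus[OF a'[OF i]]] by (simp add: safe_def)
    ultimately show ?thesis by simp
  qed
  moreover have "M * m > 0" "15 dvd M * m"
    using safe cyclo_gt_1 by (auto simp: safe_def m_def)
  ultimately show "safe (M * cyclo r s) a'"
    using range by (auto simp: safe_def m_def)
qed

end

section \<open>Supply of primes \<open>r\<close> and \<open>s\<close>, and correctness of the final
  modulus\<close>

lemma ex_prime_not_dvd:
  fixes d :: int
  assumes "d \<noteq> 0" and "\<bar>d\<bar> < 2 ^ (N - b)" and "b < N"
  obtains r :: nat where "prime r" and "b < r" and "r \<le> 4 * N\<^sup>2 + 1" and "\<not> int r dvd d"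
proof (rule ccontr)
  assume no: "\<not> thesis"
  define P where "P = {p :: nat. prime p \<and> p \<le> 4 * N\<^sup>2 + 1}"
  have "finite P" by (simp add: P_def)
  \<comment> \<open>If all primes between \<open>b\<close> and the bound divided \<open>d\<close>,
    then \<open>d\<close> would have at least \<open>N - b\<close> prime factors and thus absolute
    value at least \<open>2 ^ (N - b)\<close>.\<close>
  have "P \<subseteq> {1..b} \<union> prime_factors (nat \<bar>d\<bar>)"
  proof
    fix p assume p: "p \<in> P"
    show "p \<in> {1..b} \<union> prime_factors (nat \<bar>d\<bar>)"
    proof (cases "p \<le> b")
      case True
      then show ?thesis using p prime_ge_1_nat by (simp add: P_def)
    next
      case False
      have "int p dvd d"
      proof (rule ccontr)
        assume "\<not> int p dvd d"
        then have thesis using that[of p] p False by (simp add: P_def)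
        with no show False ..
      qed
      then have "p dvd nat \<bar>d\<bar>" by simp
      then show ?thesis using p assms(1) by (simp add: P_def in_prime_factors_iff)
    qed
  qed
  then have "card P \<le> card ({1..b} \<union> prime_factors (nat \<bar>d\<bar>))"
    by (rule card_mono[rotated]) simp
  also have "\<dots> \<le> b + card (prime_factors (nat \<bar>d\<bar>))"
    using card_Un_le[of "{1..b}"] by simp
  finally have "N - b \<le> card (prime_factors (nat \<bar>d\<bar>))"
    using primes_upto_ge[of N] by (simp add: P_def)
  then have "(2 :: nat) ^ (N - b) \<le> 2 ^ card (prime_factors (nat \<bar>d\<bar>))"
    by (rule power_increasing) simp
  also have "\<dots> \<le> nat \<bar>d\<bar>"
    by (rule two_power_card_prime_factors_le) (use assms(1) in simp)
  finally have "(2 :: int) ^ (N - b) \<le> \<bar>d\<bar>"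
    by (simp add: le_nat_iff)
  then show False using assms(2) by simp
qed

text \<open>The bound equals \<open>4 * (4 * L)\<^sup>2 + 1\<close>, so there are at least
  \<open>4 * L\<close> primes up to it. At most \<open>r\<close> of them do not exceed
  \<open>r\<close>, and at most \<open>r\<close> divide \<open>2 ^ r - 1\<close>. What remains
  suffices for all conditions attached to \<open>r\<close>.\<close>

lemma card_primes_not_dvd_ge:
  assumes "0 < r" and "r \<le> L"
  shows "2 * L \<le> card {s :: nat. prime s \<and> r < s \<and> s \<le> 64 * L\<^sup>2 + 1 \<and> \<not> [2 ^ r = 1] (mod int s)}"
    (is "_ \<le> card ?A")
proof -
  define D where "D = prime_factors (2 ^ r - 1 :: nat)"
  have pos: "(2 :: nat) ^ r - 1 > 0"
    using one_less_power[of "2 :: nat" r] assms(1) by simp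
  have "(2 :: nat) ^ card D \<le> 2 ^ r - 1"
    unfolding D_def by (rule two_power_card_prime_factors_le[OF pos])
  then have "(2 :: nat) ^ card D \<le> 2 ^ r" by linarith
  then have D: "card D \<le> r" by simp
  have "{p. prime p \<and> p \<le> 4 * (4 * L)\<^sup>2 + 1} \<subseteq> ?A \<union> {1..r} \<union> D"
  proof
    fix p assume p: "p \<in> {p :: nat. prime p \<and> p \<le> 4 * (4 * L)\<^sup>2 + 1}"
    have "p \<in> D" if "[2 ^ r = 1] (mod int p)"
    proof -
      have "[2 ^ r = 1] (mod p)"
        using that cong_int_iff[of "2 ^ r" 1 p] by simp
      then have "p dvd 2 ^ r - 1"
        by (simp add: cong_altdef_nat)
      then show ?thesis
        using p pos by (simp add: D_def in_prime_factors_iff)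
    qed
    then show "p \<in> ?A \<union> {1..r} \<union> D"
      using p prime_ge_1_nat[of p] by (auto simp: power_mult_distrib)
  qed
  then have "card {p :: nat. prime p \<and> p \<le> 4 * (4 * L)\<^sup>2 + 1} \<le> card (?A \<union> {1..r} \<union> D)"
    by (rule card_mono[rotated]) (simp add: D_def)
  also have "\<dots> \<le> card ?A + r + card D"
    using card_Un_le[of "?A \<union> {1..r}" D] card_Un_le[of ?A "{1..r}"] by simp
  finally show ?thesis
    using primes_upto_ge[of "4 * L"] D assms(2) by linarith
qed

text \<open>For integers \<open>\<bar>z\<bar> \<le> z\<^sup>2\<close>. The sum of the squares of the
  inputs serves as size bound because the program can compute it without testing signs.\<close>

lemma abs_sum_le_sum_squares: "\<bar>\<Sum>i\<in>J. f i\<bar> \<le> (\<Sum>i\<in>J. (f i)\<^sup>2 :: int)"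
proof (rule order_trans[OF sum_abs sum_mono])
  fix i
  show "\<bar>f i\<bar> \<le> (f i)\<^sup>2"
  proof (cases "f i = 0")
    case False
    then have "\<bar>f i\<bar> * 1 \<le> \<bar>f i\<bar> * \<bar>f i\<bar>" by (intro mult_left_mono) auto
    then show ?thesis by (simp add: power2_eq_square)
  qed simp
qed

context partition_instance
begin

lemma abs_disc_le:
  assumes "I \<subseteq> {1..2 * k}"
  shows "\<bar>disc I\<bar> \<le> (\<Sum>i = 1..2 * k. (x i)\<^sup>2)"
proof -
  have split: "(\<Sum>i = 1..2 * k. f i) = (\<Sum>i\<in>{1..2 * k} - I. f i) + (\<Sum>i\<in>I. f i)" for f :: "nat \<Rightarrow> int"
    by (rule sum.subset_diff) (use assms in auto)
  have "disc I = (\<Sum>i\<in>I. x i) - (\<Sum>i\<in>{1..2 * k} - I. x i)"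
    unfolding disc_def split[of x] by simp
  then show ?thesis
    using abs_sum_le_sum_squares[of x I] abs_sum_le_sum_squares[of x "{1..2 * k} - I"] split[of "\<lambda>i. (x i)\<^sup>2"] by linarith
qed

text \<open>As \<open>k\<close> is odd, for a set of size \<open>k\<close> twice the product plus
  one is -1 modulo 3 and 3 modulo 5.\<close>

lemma safe_initial: "safe 15 (\<lambda>i. 11)"
proof -
  have "\<not> q dvd 2 * 11 ^ k + 1" if q: "prime q" "q dvd 15" for q :: int
  proof -
    have "q dvd 3 * 5" using q(2) by simp
    then have "q dvd 3 \<or> q dvd 5" using q(1) prime_dvd_multD by blast
    then have "q = 3 \<or> q = 5"
      using primes_dvd_imp_eq[OF q(1), of 3] primes_dvd_imp_eq[OF q(1), of 5] by auto
    moreover have "[2 * 11 ^ k + 1 = 2 * (- 1) ^ k + (1 :: int)] (mod 3)"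
      by (intro cong_add cong_mult cong_pow cong_refl) (simp add: cong_def)
    moreover have "[2 * 11 ^ k + 1 = 2 * 1 ^ k + (1 :: int)] (mod 5)"
      by (intro cong_add cong_mult cong_pow cong_refl) (simp add: cong_def)
    ultimately show ?thesis
      using odd_k by (auto simp: cong_dvd_iff)
  qed
  moreover have "coprime (11 :: int) 15"
  proof (rule coprimeI)
    fix c :: int assume "c dvd 11" "c dvd 15"
    then have "c dvd 15 * 3 - 11 * 4" by (intro dvd_diff dvd_mult2)
    then show "is_unit c" by simp
  qed
  ultimately show ?thesis
    by (auto simp: safe_def hits_def)
qed

lemma construction_correct:
  assumes safe: "safe M a" and N: "k + 1 < N" "(\<Sum>i = 1..2 * k. (x i)\<^sup>2) < 2 ^ (N - (k + 1))"
    and k: "1 \<le> k"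
    and covers: "\<And>r j. prime r \<Longrightarrow> k + 1 < r \<Longrightarrow> r \<le> 4 * N\<^sup>2 + 1 \<Longrightarrow> 1 \<le> j \<Longrightarrow> j < k + r - 1 \<Longrightarrow>
      covers M a r j"
    and b: "\<And>i. i \<in> {1..2 * k} \<Longrightarrow> [b i = a i] (mod M)"
  shows "I \<subseteq> {1..2 * k} \<and> card I \<le> k \<Longrightarrow>
      gcd (2 * (\<Prod>i\<in>I. b i) + 1) M = 1 \<longleftrightarrow>
      card I = k \<and> real_of_int (\<Sum>i\<in>I. x i) = real_of_int (\<Sum>i = 1..2 * k. x i) / 2" (is "?A I \<Longrightarrow> ?B I")
    and "i \<in> {1..2 * k} \<Longrightarrow> \<not> (b i - 1) dvd (4 * (\<Prod>j = 1..2 * k. b j))" (is "?C i \<Longrightarrow> ?D i")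
    and "gcd (2 * (\<Prod>i = 1..2 * k. b i) + 1) M > 1"
    and "gcd (4 * (\<Prod>i = 1..2 * k. b i) + 1) M > 1"
proof -
  have M: "M > 0" "3 dvd M" "5 dvd M"
    using safe by (auto simp: safe_def intro: dvd_trans[of _ 15])
  have b3: "[b i = - 1] (mod 3)" and b5: "[b i = 1] (mod 5)" if "i \<in> {1..2 * k}" for i
  proof -
    have *: "[b i = 11] (mod q)" if "q dvd 15" for q
    proof -
      have "[a i = 11] (mod 15)" "15 dvd M"
        using safe \<open>i \<in> _\<close> by (auto simp: safe_def)
      then show ?thesis
        using cong_trans[OF cong_dvd_modulus[OF b] cong_dvd_modulus[of "a i" 11 15]] \<open>i \<in> _\<close> that
        by (meson dvd_trans)
    qed
    show "[b i = - 1] (mod 3)" using *[of 3] by (simp add: cong_def)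
    show "[b i = 1] (mod 5)" using *[of 5] by (simp add: cong_def)
  qed
  have hits_b: "hits M b I \<longleftrightarrow> hits M a I" if "I \<subseteq> {1..2 * k}" for I
    by (rule hits_cong, rule b) (use that in blast)
  have even: "hits M b I" if "I \<subseteq> {1..2 * k}" "even (card I)" for I
  proof -
    have "[2 * (\<Prod>i\<in>I. b i) + 1 = 2 * (\<Prod>i\<in>I. - 1) + 1] (mod 3)"
      by (intro cong_add cong_mult cong_prod cong_refl) (use that b3 in blast)
    then have "3 dvd 2 * (\<Prod>i\<in>I. b i) + 1"
      using that(2) by (simp add: cong_dvd_iff)
    then show ?thesis
      using M by (auto simp: hits_def intro!: exI[of _ 3])
  qed
  show "?B I" if I: "?A I" for I
  proof -
    have "\<not> hits M b I \<longleftrightarrow> card I = k \<and> disc I = 0"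
    proof (cases "even (card I)")
      case True
      then show ?thesis using even I odd_k by auto
    next
      case False
      show ?thesis
      proof (cases "card I = k")
        case True
        show ?thesis
        proof (cases "disc I = 0")
          case 0: True
          then show ?thesis using True I safe hits_b by (auto simp: safe_def)
        next
          case neq: False
          have "\<bar>disc I\<bar> < 2 ^ (N - (k + 1))"
            using abs_disc_le[of I] I N(2) by simp
          then obtain r where r: "prime r" "k + 1 < r" "r \<le> 4 * N\<^sup>2 + 1" "\<not> int r dvd disc I"
            using ex_prime_not_dvd[OF neq _ N(1)] by blast
          \<comment> \<open>The nonzero residue class of the discrepancy modulo \<open>r\<close> is
            condition number \<open>k - 1 + \<rho>\<close>.\<close>
          define \<rho> where "\<rho> = nat (disc I mod int r)"
          have \<rho>: "int \<rho> = disc I mod int r" using r(2) by (simp add: \<rho>_def)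
          then have "\<rho> < r" using r(2) by (metis of_nat_less_iff pos_mod_bound of_nat_0_less_iff gr_zeroI not_less_zero)
          moreover have "\<rho> \<noteq> 0" using r(4) \<rho> by (auto simp: dvd_eq_mod_eq_0)
          ultimately have "covers M a r (k - 1 + \<rho>)"
            using r k by (intro covers) auto
          moreover have "int r dvd disc I - (int (k - 1 + \<rho>) - int k + 1)"
            using k \<rho> by (simp add: of_nat_diff)
          moreover have "\<not> k - 1 + \<rho> < k" using \<open>\<rho> \<noteq> 0\<close> by simp
          ultimately have "hits M a I"
            using True I by (simp add: covers_def)
          then show ?thesis using neq hits_b I by simp
        qed
      next
        case lt: False
        \<comment> \<open>For sets smaller than \<open>k\<close> any admissible prime
          \<open>r\<close> will do; the counting argument applied to the number 1 provides
          one.\<close>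
        have "(1 :: int) < 2 ^ (N - (k + 1))" using N(1) by simp
        then obtain r where r: "prime r" "k + 1 < r" "r \<le> 4 * N\<^sup>2 + 1"
          using ex_prime_not_dvd[of 1, OF _ _ N(1)] by auto
        have "covers M a r (card I)"
          using r I lt False by (intro covers) (auto elim: oddE)
        then have "hits M a I"
          using I lt False by (auto simp: covers_def)
        then show ?thesis using lt hits_b I by simp
      qed
    qed
    moreover have "disc I = 0 \<longleftrightarrow> real_of_int (\<Sum>i\<in>I. x i) = real_of_int (\<Sum>i = 1..2 * k. x i) / 2"
    proof -
      have "disc I = 0 \<longleftrightarrow> real_of_int (2 * (\<Sum>i\<in>I. x i)) = real_of_int (\<Sum>i = 1..2 * k. x i)"
        unfolding disc_def of_int_eq_iff by simp
      then show ?thesis by (simp add: field_simps del: of_int_sum)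
    qed
    ultimately show ?thesis
      using gcd_eq_1_iff_not_hits[of M b I] M by simp
  qed
  have prod5: "[(\<Prod>i = 1..2 * k. b i) = (\<Prod>i = 1..2 * k. 1)] (mod 5)"
    by (rule cong_prod) (rule b5)
  show "?D i" if "?C i" for i
  proof
    have "5 dvd b i - 1" using b5[OF that] by (simp add: cong_iff_dvd_diff)
    also assume "b i - 1 dvd 4 * (\<Prod>j = 1..2 * k. b j)"
    finally have "5 dvd 4 * (\<Prod>j = 1..2 * k. b j)" .
    moreover have "[4 * (\<Prod>j = 1..2 * k. b j) = 4 * 1] (mod 5)"
      using prod5 by (intro cong_mult) auto
    ultimately show False by (simp add: cong_dvd_iff)
  qed
  show "gcd (2 * (\<Prod>i = 1..2 * k. b i) + 1) M > 1"
  proof -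
    have "gcd (2 * (\<Prod>i = 1..2 * k. b i) + 1) M \<noteq> 1"
      using gcd_eq_1_iff_not_hits[of M b "{1..2 * k}"] M even[of "{1..2 * k}"] by simp
    moreover have "gcd (2 * (\<Prod>i = 1..2 * k. b i) + 1) M > 0" using M by simp
    ultimately show ?thesis by linarith
  qed
  have "[4 * (\<Prod>i = 1..2 * k. b i) + 1 = 4 * 1 + 1] (mod 5)"
    using prod5 by (intro cong_mult cong_add) auto
  then have "5 dvd 4 * (\<Prod>i = 1..2 * k. b i) + 1"
    by (simp add: cong_dvd_iff)
  then have "5 dvd gcd (4 * (\<Prod>i = 1..2 * k. b i) + 1) M"
    using M by simp
  then have "5 \<le> gcd (4 * (\<Prod>i = 1..2 * k. b i) + 1) M"
    by (rule zdvd_imp_le) (use M in simp)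
  then show "gcd (4 * (\<Prod>i = 1..2 * k. b i) + 1) M > 1" by simp
qed

end

subsection \<open>Total correctness with bounds\<close>

text \<open>
  The weakest precondition includes that all stored values are at most \<open>V\<close> in absolute value and that every
  execution of a loop has at most \<open>G\<close> iterations. These two bounds turn the running time into a quantity that
  is computed by recursion on the program text.
\<close>

fun wp :: "int \<Rightarrow> nat \<Rightarrow> com \<Rightarrow> (mem \<Rightarrow> bool) \<Rightarrow> mem \<Rightarrow> bool" where
  "wp V G Skip Q s = Q s"
| "wp V G (Store e1 e2) Q s = (\<bar>val e2 s\<bar> \<le> V \<and> Q (s(val e1 s := val e2 s)))"
| "wp V G (Seq c1 c2) Q s = wp V G c1 (wp V G c2 Q) s"
| "wp V G (Cond e c1 c2) Q s = (if val e s > 0 then wp V G c1 Q s else wp V G c2 Q s)"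
| "wp V G (While e c) Q s = (\<exists>I. I G s \<and>
     (\<forall>i s. I i s \<longrightarrow> (if val e s > 0 then i > 0 \<and> wp V G c (I (i - 1)) s else Q s)))"

lemma wp_mono: "wp V G c P s \<Longrightarrow> (\<And>s. P s \<Longrightarrow> Q s) \<Longrightarrow> wp V G c Q s"
proof (induction c arbitrary: P Q s)
  case (Seq c1 c2)
  have "wp V G c1 (wp V G c2 Q) s"
    by (rule Seq.IH(1)[of "wp V G c2 P"]) (use Seq.prems Seq.IH(2) in auto)
  then show ?case by simp
next
  case (Cond e c1 c2)
  then show ?case by (metis wp.simps(4))
next
  case (While e c)
  from While.prems(1) obtain I where "I G s"
    and "\<And>i s. I i s \<Longrightarrow> if val e s > 0 then i > 0 \<and> wp V G c (I (i - 1)) s else P s"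
    by auto
  then show ?case
    unfolding wp.simps using While.prems(2) by (intro exI[of _ I] conjI allI impI) metis+
qed auto

lemma wp_While:
  assumes "I G s"
    and "\<And>i s. I i s \<Longrightarrow> val e s > 0 \<Longrightarrow> i > 0 \<and> wp V G c (I (i - 1)) s"
    and "\<And>i s. I i s \<Longrightarrow> \<not> val e s > 0 \<Longrightarrow> Q s"
  shows "wp V G (While e c) Q s"
  using assms by (auto intro!: exI[of _ I])

text \<open>If every cell is at most \<open>2 ^ b\<close> in absolute value, then the value of
  \<open>e\<close> is at most \<open>2 ^ (b * expr_size e)\<close>. All operators are treated like
  multiplication, so that sizes add.\<close>

fun expr_size :: "expr \<Rightarrow> nat" where
  "expr_size (Const z) = nat \<bar>z\<bar> + 1"
| "expr_size (Cell e) = expr_size e + 1"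
| "expr_size (Bin f e1 e2) = expr_size e1 + expr_size e2"

text \<open>The terms \<open>b * expr_size e + 2\<close> bound bit lengths: one extra bit is the
  sign, the other one comes from the power of two itself.\<close>

fun expr_bound :: "nat \<Rightarrow> expr \<Rightarrow> nat" where
  "expr_bound b (Const z) = b * expr_size (Const z) + 2"
| "expr_bound b (Cell e) = expr_bound b e + (b * expr_size e + 2) + (b + 2)"
| "expr_bound b (Bin f e1 e2) =
     expr_bound b e1 + expr_bound b e2 + (b * expr_size e1 + 2) * (b * expr_size e2 + 2)"

text \<open>Adding both branches of a conditional keeps the bound polynomial in \<open>b\<close> and
  \<open>G\<close>. A loop evaluates its guard once more than its body, hence the factor
  \<open>G + 1\<close>.\<close>

fun com_bound :: "nat \<Rightarrow> nat \<Rightarrow> com \<Rightarrow> nat" where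
  "com_bound b G Skip = 1"
| "com_bound b G (Store e1 e2) = expr_bound b e1 + expr_bound b e2 +
     (b * expr_size e1 + 2) + (b * expr_size e2 + 2) + 1"
| "com_bound b G (Seq c1 c2) = com_bound b G c1 + com_bound b G c2 + 1"
| "com_bound b G (Cond e c1 c2) = expr_bound b e + com_bound b G c1 + com_bound b G c2 + 1"
| "com_bound b G (While e c) = (G + 1) * (expr_bound b e + com_bound b G c + 1)"

lemma bits_le: "\<bar>z\<bar> \<le> 2 ^ m \<Longrightarrow> bits z \<le> m + 2"
proof -
  assume "\<bar>z\<bar> \<le> 2 ^ m"
  then have "nat \<bar>z\<bar> \<le> 2 ^ m"
    by (simp add: nat_le_iff)
  then have "floorlog 2 (nat \<bar>z\<bar>) \<le> floorlog 2 (2 ^ m)"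
    by (rule floorlog_mono)
  also have "\<dots> = m + 1"
    using floorlog_power[of 2 1 m] by (simp add: floorlog_def)
  finally show ?thesis by (simp add: bits_def)
qed

text \<open>Division rounds down, so a negative dividend and a positive divisor give a quotient
  between the dividend and 0. Division by 0 yields 0.\<close>

lemma abs_div_le: "\<bar>x div y\<bar> \<le> \<bar>x :: int\<bar>"
proof -
  have pos: "\<bar>u div v\<bar> \<le> \<bar>u\<bar>" if "v > 0" for u v :: int
  proof (cases "u \<ge> 0")
    case True
    then show ?thesis using that by (simp add: pos_imp_zdiv_nonneg_iff zdiv_mono2[of u 1 v, simplified])
  next
    case False
    have "u div 1 \<le> u div v" using False that by (intro zdiv_mono2_neg) auto
    moreover have "u div v < 0" using False that by (intro div_neg_pos_less0) auto
    ultimately show ?thesis by simp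
  qed
  show ?thesis
    using pos[of y x] pos[of "- y" "- x"] by (cases y "0 :: int" rule: linorder_cases) auto
qed

lemma abs_apply_op_le:
  assumes "\<bar>x\<bar> \<le> 2 ^ m" and "\<bar>y\<bar> \<le> 2 ^ n" and "m > 0" and "n > 0"
  shows "\<bar>apply_op f x y\<bar> \<le> 2 ^ (m + n)"
proof -
  have 2: "(2 :: int) \<le> 2 ^ m" "(2 :: int) \<le> 2 ^ n"
    using assms(3,4) by (simp_all add: self_le_power)
  \<comment> \<open>Expanding this product shows that the bound for products also covers sums, and
    thereby remainders.\<close>
  have "((2 :: int) ^ m - 1) * (2 ^ n - 1) \<ge> 1 * 1"
    using 2 by (intro mult_mono) auto
  then have sum: "(2 :: int) ^ m + 2 ^ n \<le> 2 ^ (m + n)"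
    by (simp add: algebra_simps power_add)
  have prod: "\<bar>x * y\<bar> \<le> 2 ^ (m + n)"
    using assms(1,2) by (auto simp: abs_mult power_add intro!: mult_mono)
  have rm: "\<bar>x mod y\<bar> \<le> \<bar>x\<bar> + \<bar>y\<bar>"
    using abs_mod_less[of y x] by (cases "y = 0") auto
  show ?thesis
    using sum prod abs_div_le[of x y] rm assms(1,2) 2 by (cases f) auto
qed

lemma
  assumes b: "b > 0" and s: "\<And>a. \<bar>s a\<bar> \<le> 2 ^ b"
  shows abs_val_le: "\<bar>val e s\<bar> \<le> 2 ^ (b * expr_size e)"
    and cost_le: "cost e s \<le> expr_bound b e"
proof -
  have pos: "expr_size e > 0" for e by (induction e) auto
  show val: "\<bar>val e s\<bar> \<le> 2 ^ (b * expr_size e)" for e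
  proof (induction e)
    case (Const z)
    have "\<bar>z\<bar> < 2 ^ nat \<bar>z\<bar>"
      using of_nat_less_two_power[of "nat \<bar>z\<bar>", where 'a = int] by simp
    also have "\<dots> \<le> (2 :: int) ^ (b * expr_size (Const z))"
      using b by (intro power_increasing) (auto intro: trans_le_add2)
    finally show ?case by simp
  next
    case (Cell e)
    have "\<bar>s (val e s)\<bar> \<le> 2 ^ b" by (rule s)
    also have "\<dots> \<le> (2 :: int) ^ (b * expr_size (Cell e))"
      by (intro power_increasing) auto
    finally show ?case by simp
  next
    case (Bin f e1 e2)
    then show ?case
      using abs_apply_op_le[of "val e1 s" "b * expr_size e1" "val e2 s" "b * expr_size e2" f]
        pos b by (simp add: distrib_left)
  qed
  have bits: "bits (val e s) \<le> b * expr_size e + 2" for e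
    by (rule bits_le[OF val])
  show "cost e s \<le> expr_bound b e"
  proof (induction e)
    case (Const z)
    then show ?case using bits[of "Const z"] by simp
  next
    case (Cell e)
    then show ?case using bits[of e] bits_le[OF s, of "val e s"] by simp
  next
    case (Bin f e1 e2)
    let ?x = "b * expr_size e1 + 2" and ?y = "b * expr_size e2 + 2"
    \<comment> \<open>Both factors are at least 2, so the charge for a multiplication dominates the
      cost of an addition or subtraction.\<close>
    have "?x + ?y \<le> ?x * ?y" by (simp add: algebra_simps)
    moreover have "bits (val e1 s) * bits (val e2 s) \<le> ?x * ?y"
      by (intro mult_mono bits) auto
    ultimately have "op_cost f (val e1 s) (val e2 s) \<le> ?x * ?y"
      using bits[of e1] bits[of e2] by (cases f) auto
    with Bin show ?case by simp
  qed
qed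

text \<open>Soundness of \<open>wp\<close>. The memory bound reappears in the conclusion because the
  commands that follow rely on it. Loops are handled by an inner induction on the counter of the
  invariant.\<close>

lemma wp_exec:
  assumes "b > 0" and "wp (2 ^ b) G c Q s" and "\<And>a. \<bar>s a\<bar> \<le> 2 ^ b"
  shows "\<exists>t s'. exec c s t s' \<and> t \<le> com_bound b G c \<and> Q s' \<and> (\<forall>a. \<bar>s' a\<bar> \<le> 2 ^ b)"
  using assms(2,3)
proof (induction c arbitrary: Q s)
  case Skip
  then show ?case by (intro exI[of _ 1] exI[of _ s]) (auto intro: exec.Skip[simplified])
next
  case (Store e1 e2)
  have "bits (val e s) \<le> b * expr_size e + 2" for e
    by (rule bits_le[OF abs_val_le[OF \<open>b > 0\<close> Store.prems(2)]])
  then have "cost e1 s + cost e2 s + bits (val e1 s) + bits (val e2 s) + 1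
      \<le> com_bound b G (Store e1 e2)"
    using cost_le[OF \<open>b > 0\<close> Store.prems(2)] by (simp only: com_bound.simps add_mono order_refl)
  moreover have "exec (Store e1 e2) s
      (cost e1 s + cost e2 s + bits (val e1 s) + bits (val e2 s) + 1) (s(val e1 s := val e2 s))"
    by (rule exec.Store)
  moreover have "Q (s(val e1 s := val e2 s))" "\<bar>(s(val e1 s := val e2 s)) a\<bar> \<le> 2 ^ b" for a
    using Store.prems by simp_all
  ultimately show ?case by blast
next
  case (Seq c1 c2)
  then obtain t1 s1 where 1: "exec c1 s t1 s1" "t1 \<le> com_bound b G c1" "wp (2 ^ b) G c2 Q s1"
    "\<And>a. \<bar>s1 a\<bar> \<le> 2 ^ b"
    by (metis wp.simps(3))
  with Seq.IH(2) obtain t2 s2 where "exec c2 s1 t2 s2" "t2 \<le> com_bound b G c2" "Q s2"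
    "\<And>a. \<bar>s2 a\<bar> \<le> 2 ^ b"
    by metis
  with 1 have "exec (Seq c1 c2) s (t1 + t2 + 1) s2" "t1 + t2 + 1 \<le> com_bound b G (Seq c1 c2)"
    by (auto intro: exec.Seq[simplified])
  with \<open>Q s2\<close> \<open>\<And>a. \<bar>s2 a\<bar> \<le> 2 ^ b\<close> show ?case by blast
next
  case (Cond e c1 c2)
  have e: "cost e s \<le> expr_bound b e"
    using cost_le[OF \<open>b > 0\<close> Cond.prems(2)] .
  show ?case
  proof (cases "val e s > 0")
    case True
    with Cond.prems Cond.IH(1)[of Q s] obtain t s' where "exec c1 s t s'"
      "t \<le> com_bound b G c1" "Q s'" "\<And>a. \<bar>s' a\<bar> \<le> 2 ^ b"
      by auto
    moreover from this e True have "exec (Cond e c1 c2) s (cost e s + t + 1) s'"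
      "cost e s + t + 1 \<le> com_bound b G (Cond e c1 c2)"
      by (auto intro: exec.CondTrue[simplified])
    ultimately show ?thesis by blast
  next
    case False
    with Cond.prems Cond.IH(2)[of Q s] obtain t s' where "exec c2 s t s'"
      "t \<le> com_bound b G c2" "Q s'" "\<And>a. \<bar>s' a\<bar> \<le> 2 ^ b"
      by auto
    moreover from this e False have "exec (Cond e c1 c2) s (cost e s + t + 1) s'"
      "cost e s + t + 1 \<le> com_bound b G (Cond e c1 c2)"
      by (auto intro: exec.CondFalse[simplified])
    ultimately show ?thesis by blast
  qed
next
  case (While e c)
  from While.prems(1) obtain I where "I G s" and
    I: "\<And>i s. I i s \<Longrightarrow> if val e s > 0 then i > 0 \<and> wp (2 ^ b) G c (I (i - 1)) s else Q s"
    by auto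
  have "\<exists>t s'. exec (While e c) s t s' \<and> t \<le> (i + 1) * (expr_bound b e + com_bound b G c + 1)
    \<and> Q s' \<and> (\<forall>a. \<bar>s' a\<bar> \<le> 2 ^ b)" if "I i s" "\<And>a. \<bar>s a\<bar> \<le> 2 ^ b" for i s
    using that
  proof (induction i arbitrary: s rule: less_induct)
    case (less i)
    have e: "cost e s \<le> expr_bound b e"
      using cost_le[OF \<open>b > 0\<close> less.prems(2)] .
    show ?case
    proof (cases "val e s > 0")
      case True
      with I[OF less.prems(1)] have "i > 0" "wp (2 ^ b) G c (I (i - 1)) s" by auto
      with While.IH[of "I (i - 1)" s] less.prems(2) obtain t1 s1 where
        1: "exec c s t1 s1" "t1 \<le> com_bound b G c" "I (i - 1) s1" "\<And>a. \<bar>s1 a\<bar> \<le> 2 ^ b"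
        by blast
      with less.IH[of "i - 1" s1] \<open>i > 0\<close> obtain t2 s2 where
        2: "exec (While e c) s1 t2 s2" "t2 \<le> i * (expr_bound b e + com_bound b G c + 1)"
          "Q s2" "\<And>a. \<bar>s2 a\<bar> \<le> 2 ^ b"
        by auto
      have "exec (While e c) s (cost e s + t1 + t2 + 1) s2"
        using True 1(1) 2(1) by (rule exec.WhileTrue)
      moreover have "cost e s + t1 + t2 + 1 \<le> (i + 1) * (expr_bound b e + com_bound b G c + 1)"
        using e 1(2) 2(2) by (simp add: distrib_right)
      ultimately show ?thesis using 2 by blast
    next
      case False
      then have "exec (While e c) s (cost e s + 1) s" by (rule exec.WhileFalse)
      moreover have "cost e s + 1 \<le> (i + 1) * (expr_bound b e + com_bound b G c + 1)"
        using e by simp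
      moreover have "Q s" using I[OF less.prems(1)] False by simp
      ultimately show ?thesis using less.prems by blast
    qed
  qed
  from this[OF \<open>I G s\<close> While.prems(2)] show ?case by simp
qed

text \<open>The program is fixed while the input varies, so recursion over its text builds the
  polynomial from the ones for value sizes and iteration counts.\<close>

lemma com_bound_poly: "\<exists>p :: nat poly. \<forall>n. com_bound (poly B n) (poly G n) c = poly p n"
proof -
  have e: "\<exists>p :: nat poly. \<forall>n. expr_bound (poly B n) e = poly p n" for e
  proof (induction e)
    case (Const z)
    show ?case by (rule exI[of _ "B * [:expr_size (Const z):] + [:2:]"]) simp
  next
    case (Cell e)
    then obtain p where "\<forall>n. expr_bound (poly B n) e = poly p n" ..
    then show ?case
      by (intro exI[of _ "p + (B * [:expr_size e:] + [:2:]) + (B + [:2:])"]) simp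
  next
    case (Bin f e1 e2)
    then obtain p q where "\<forall>n. expr_bound (poly B n) e1 = poly p n"
      "\<forall>n. expr_bound (poly B n) e2 = poly q n" by auto
    then show ?case
      by (intro exI[of _ "p + q + (B * [:expr_size e1:] + [:2:]) * (B * [:expr_size e2:] + [:2:])"]) simp
  qed
  show ?thesis
  proof (induction c)
    case Skip
    show ?case by (rule exI[of _ 1]) simp
  next
    case (Store e1 e2)
    from e obtain p q where "\<forall>n. expr_bound (poly B n) e1 = poly p n"
      "\<forall>n. expr_bound (poly B n) e2 = poly q n" by metis
    then show ?case
      by (intro exI[of _ "p + q + (B * [:expr_size e1:] + [:2:]) + (B * [:expr_size e2:] + [:2:]) + 1"]) simp
  next
    case (Seq c1 c2)
    then obtain p q where "\<forall>n. com_bound (poly B n) (poly G n) c1 = poly p n"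
      "\<forall>n. com_bound (poly B n) (poly G n) c2 = poly q n" by auto
    then show ?case by (intro exI[of _ "p + q + 1"]) simp
  next
    case (Cond x c1 c2)
    moreover from e obtain r where "\<forall>n. expr_bound (poly B n) x = poly r n" by metis
    ultimately obtain p q where "\<forall>n. com_bound (poly B n) (poly G n) c1 = poly p n"
      "\<forall>n. com_bound (poly B n) (poly G n) c2 = poly q n" by auto
    with \<open>\<forall>n. expr_bound (poly B n) x = poly r n\<close> show ?case by (intro exI[of _ "r + p + q + 1"]) simp
  next
    case (While x c)
    moreover from e obtain r where "\<forall>n. expr_bound (poly B n) x = poly r n" by metis
    ultimately obtain p where "\<forall>n. com_bound (poly B n) (poly G n) c = poly p n" by auto
    with \<open>\<forall>n. expr_bound (poly B n) x = poly r n\<close> show ?case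
      by (intro exI[of _ "(G + 1) * (r + p + 1)"]) simp
  qed
qed

subsection \<open>The program\<close>

text \<open>
  The scalar variables have negative addresses. The residue for index \<open>i\<close> is kept at address \<open>2 * k + i\<close>
  until the end, because the inputs are needed throughout.
\<close>

abbreviation (input) vI :: int where "vI \<equiv> - 1"
abbreviation (input) vS :: int where "vS \<equiv> - 2"
abbreviation (input) vA :: int where "vA \<equiv> - 3"
abbreviation (input) vN :: int where "vN \<equiv> - 4"
abbreviation (input) vL :: int where "vL \<equiv> - 5"
abbreviation (input) vB :: int where "vB \<equiv> - 6"
abbreviation (input) vM :: int where "vM \<equiv> - 7"
abbreviation (input) vR :: int where "vR \<equiv> - 8"
abbreviation (input) vT :: int where "vT \<equiv> - 9"
abbreviation (input) vJ :: int where "vJ \<equiv> - 10"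
abbreviation (input) vF :: int where "vF \<equiv> - 11"
abbreviation (input) vD :: int where "vD \<equiv> - 12"
abbreviation (input) vm :: int where "vm \<equiv> - 13"
abbreviation (input) va :: int where "va \<equiv> - 14"
abbreviation (input) vb :: int where "vb \<equiv> - 15"
abbreviation (input) vu :: int where "vu \<equiv> - 16"
abbreviation (input) vv :: int where "vv \<equiv> - 17"
abbreviation (input) vq :: int where "vq \<equiv> - 18"
abbreviation (input) vh :: int where "vh \<equiv> - 19"
abbreviation (input) vc :: int where "vc \<equiv> - 20"
abbreviation (input) ve :: int where "ve \<equiv> - 21"
abbreviation (input) vl :: int where "vl \<equiv> - 22"
abbreviation (input) vP :: int where "vP \<equiv> - 23"
abbreviation (input) vw :: int where "vw \<equiv> - 24"

abbreviation (input) rd :: "int \<Rightarrow> expr" where "rd z \<equiv> Cell (Const z)"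
abbreviation (input) plus_expr (infixl "+." 65) where "e +. e' \<equiv> Bin Plus e e'"
abbreviation (input) minus_expr (infixl "-." 65) where "e -. e' \<equiv> Bin Minus e e'"
abbreviation (input) times_expr (infixl "*." 70) where "e *. e' \<equiv> Bin Times e e'"
abbreviation (input) quot_expr (infixl "'/." 70) where "e /. e' \<equiv> Bin Quot e e'"
abbreviation (input) rem_expr (infixl "%." 70) where "e %. e' \<equiv> Bin Rem e e'"
abbreviation (input) assign :: "int \<Rightarrow> expr \<Rightarrow> com" (infix "<~" 58) where "z <~ e \<equiv> Store (Const z) e"
abbreviation (input) seq (infixr ";;" 56) where "c ;; d \<equiv> Seq c d"

definition input_cell :: expr where "input_cell = Cell (rd vI)"
definition residue_addr :: expr where "residue_addr = Const 2 *. rd 0 +. rd vI"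

definition power_com :: com where
  "power_com =
     vP <~ Const 1 ;;
     While (rd vw) (vP <~ Const 2 *. rd vP ;; vw <~ rd vw -. Const 1)"

text \<open>Trial division of \<open>r\<close> and \<open>t\<close> at once. The tested product is
  positive iff \<open>d\<close> does not divide \<open>t\<close> and, as long as
  \<open>d < r\<close>, does not divide \<open>r\<close> either; for \<open>d \<ge> r\<close> the
  summand \<open>d div r\<close> is positive.\<close>

definition primes_com :: com where
  "primes_com =
     vD <~ Const 2 ;;
     While (rd vT -. rd vD)
       (Cond ((rd vT %. rd vD) *. (rd vR %. rd vD +. rd vD /. rd vR)) Skip (vF <~ Const 0) ;;
        vD <~ rd vD +. Const 1)"

definition cyclo_com :: com where
  "cyclo_com =
     vw <~ rd vR *. rd vT ;; power_com ;; vm <~ rd vP -. Const 1 ;;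
     vw <~ rd vR ;; power_com ;; vm <~ rd vm /. (rd vP -. Const 1) ;;
     vw <~ rd vT ;; power_com ;; vm <~ rd vm /. (rd vP -. Const 1)"

text \<open>Only the cofactors of \<open>M\<close> are tracked, reduced modulo \<open>m\<close>. If
  the gcd is 1, then \<open>vu\<close> ends as the inverse of \<open>M\<close> modulo
  \<open>m\<close>.\<close>

definition euclid_com :: com where
  "euclid_com =
     va <~ rd vm ;; vb <~ rd vM %. rd vm ;; vu <~ Const 0 ;; vv <~ Const 1 ;;
     While (rd vb)
       (vq <~ rd va /. rd vb ;;
        vh <~ rd va %. rd vb ;; va <~ rd vb ;; vb <~ rd vh ;;
        vh <~ (rd vu -. rd vq *. rd vv) %. rd vm ;; vu <~ rd vv ;; vv <~ rd vh)"

text \<open>Exhaustive search for \<open>c\<close> is affordable, since \<open>r * t\<close> is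
  polynomially bounded.\<close>

definition search_com :: com where
  "search_com =
     Cond (rd 0 -. rd vJ)
       (vl <~ rd vJ ;; ve <~ Const 0)
       (vl <~ rd 0 ;; ve <~ rd vT) ;;
     vc <~ Const 0 ;;
     While ((rd vl *. rd vc +. Const 1 +. rd ve *. (rd vS +. rd vJ -. rd 0 +. Const 1)) %. (rd vR *. rd vT))
       (vc <~ rd vc +. Const 1)"

definition crt_com :: com where
  "crt_com =
     vI <~ Const 2 *. rd 0 ;;
     While (rd vI)
       (vw <~ (rd vc +. Const 2 *. rd ve *. input_cell) %. (rd vR *. rd vT) ;;
        power_com ;;
        Store residue_addr (Cell residue_addr +.
          rd vM *. (((Const 0 -. rd vP -. Cell residue_addr) *. rd vu) %. rd vm)) ;;
        vI <~ rd vI -. Const 1)"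

text \<open>The test asks whether the new modulus is coprime to the old one. By
  \<open>coprime_cyclo\<close> this fails only if \<open>t\<close> divides \<open>2 ^ r - 1\<close>,
  so the gcd replaces a test of that divisibility.\<close>

definition extend_com :: com where
  "extend_com =
     cyclo_com ;; euclid_com ;;
     Cond (Const 2 -. rd va)
       (search_com ;; crt_com ;; vM <~ rd vM *. rd vm ;; vJ <~ rd vJ +. Const 1)
       Skip"

text \<open>\<open>vF\<close> starts out positive iff some condition for \<open>r\<close> is still
  open, and \<open>primes_com\<close> clears it unless \<open>r\<close> and \<open>t\<close> are
  both prime.\<close>

definition inner_com :: com where
  "inner_com =
     While (rd vB -. rd vT)
       (vT <~ rd vT +. Const 1 ;;
        vF <~ rd 0 +. rd vR -. Const 1 -. rd vJ ;;
        primes_com ;;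
        Cond (rd vF) extend_com Skip)"

definition outer_com :: com where
  "outer_com =
     While (rd vL -. rd vR)
       (vR <~ rd vR +. Const 1 ;; vJ <~ Const 1 ;; vT <~ rd vR ;; inner_com)"

text \<open>Halving the sum of squares until it vanishes yields \<open>N\<close> such that the sum
  is below \<open>2 ^ (N - (k + 2))\<close>. The limits \<open>vL\<close> and \<open>vB\<close> for
  \<open>r\<close> and \<open>t\<close> are those of \<open>ex_prime_not_dvd\<close> and
  \<open>card_primes_not_dvd_ge\<close>.\<close>

definition init_com :: com where
  "init_com =
     vI <~ Const 2 *. rd 0 ;;
     While (rd vI)
       (vS <~ rd vS +. input_cell ;;
        vA <~ rd vA +. input_cell *. input_cell ;;
        Store residue_addr (Const 11) ;;
        vI <~ rd vI -. Const 1) ;;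
     vN <~ rd 0 +. Const 2 ;;
     While (rd vA) (vA <~ rd vA /. Const 2 ;; vN <~ rd vN +. Const 1) ;;
     vL <~ Const 4 *. rd vN *. rd vN +. Const 1 ;;
     vB <~ Const 64 *. rd vL *. rd vL +. Const 1 ;;
     vM <~ Const 15 ;;
     vR <~ rd 0 +. Const 1"

text \<open>Cell 0 is overwritten last, since the addresses of the residues are computed from the
  \<open>k\<close> stored there.\<close>

definition output_com :: com where
  "output_com =
     vI <~ Const 2 *. rd 0 ;;
     While (rd vI)
       (Store (rd vI) (Cell residue_addr) ;;
        vI <~ rd vI -. Const 1) ;;
     Store (Const 0) (rd vM)"

definition construction_com :: com where
  "construction_com = init_com ;; outer_com ;; output_com"

section \<open>Rules for the pieces of the program\<close>

lemma wp_assign: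
  "\<bar>val e s\<bar> \<le> V \<Longrightarrow> Q (s(z := val e s)) \<Longrightarrow> wp V G (z <~ e) Q s"
  by simp

lemma abs_mod_le: "0 < m \<Longrightarrow> m \<le> V \<Longrightarrow> \<bar>z mod m\<bar> \<le> (V :: int)"
  using pos_mod_bound[of m z] pos_mod_sign[of m z] by linarith

lemma wp_power:
  assumes "0 \<le> s vw" and "nat (s vw) \<le> G" and "2 ^ nat (s vw) \<le> V"
    and Q: "Q (s(vP := 2 ^ nat (s vw), vw := 0))"
  shows "wp V G power_com Q s"
proof -
  define n where "n = nat (s vw)"
  have n: "s vw = int n" using assms(1) by (simp add: n_def)
  have V: "2 ^ n \<le> V" using assms(3) by (simp add: n_def)
  define I where "I i s' \<longleftrightarrow> (\<exists>w. w \<le> n \<and> w \<le> i \<and> s' = s(vP := 2 ^ (n - w), vw := int w))" for i s'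
  have pow_le: "(2 :: int) ^ w \<le> V" if "w \<le> n" for w
  proof -
    have "(2 :: int) ^ w \<le> 2 ^ n" using that by simp
    then show ?thesis using V by linarith
  qed
  have "wp V G (While (rd vw) (vP <~ Const 2 *. rd vP ;; vw <~ rd vw -. Const 1)) Q (s(vP := 1))"
  proof (rule wp_While[of I])
    show "I G (s(vP := 1))"
      unfolding I_def using n assms(2) by (intro exI[of _ n]) (auto simp: n_def fun_eq_iff)
  next
    fix i s' assume "I i s'" "0 < val (rd vw) s'"
    then obtain w where w: "w < n" "w < i" "s' = s(vP := 2 ^ (n - Suc w), vw := int (Suc w))"
      unfolding I_def by (auto simp: gr0_conv_Suc Suc_le_eq dest!: gr0_implies_Suc)
    have "2 * 2 ^ (n - Suc w) = (2 :: int) ^ (n - w)"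
      using w(1) by (metis Suc_diff_Suc power_Suc)
    moreover have "int w \<le> V"
      using pow_le[of w] w(1) of_nat_less_two_power[of w, where 'a = int] by linarith
    ultimately show "0 < i \<and> wp V G (vP <~ Const 2 *. rd vP ;; vw <~ rd vw -. Const 1) (I (i - 1)) s'"
      using w pow_le[of "n - w"] by (auto simp: I_def intro!: exI[of _ w])
  next
    fix i s' assume "I i s'" "\<not> 0 < val (rd vw) s'"
    then have "s' = s(vP := 2 ^ nat (s vw), vw := 0)"
      unfolding I_def n_def by auto
    with Q show "Q s'" by simp
  qed
  then show ?thesis
    using pow_le[of 0] by (simp add: power_com_def)
qed

lemma primes_iff:
  assumes "2 < r" and "r < t"
  shows "(\<forall>d\<in>{2..<t}. \<not> d dvd t \<and> (d < r \<longrightarrow> \<not> d dvd r)) \<longleftrightarrow> prime r \<and> prime (t :: nat)"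
  using assms by (auto simp: prime_nat_iff')

lemma wp_primes:
  assumes r: "s vR = int r" and t: "s vT = int t" and "2 < r" and "r < t" and "t \<le> G" and "int t \<le> V"
    and Q: "Q (s(vF := if prime r \<and> prime t then s vF else 0, vD := int t))"
  shows "wp V G primes_com Q s"
proof -
  define P where "P d \<longleftrightarrow> (\<forall>d'\<in>{2..<d}. \<not> d' dvd t \<and> (d' < r \<longrightarrow> \<not> d' dvd r))" for d
  define I where "I i s' \<longleftrightarrow> (\<exists>d. 2 \<le> d \<and> d \<le> t \<and> t - d \<le> i \<and>
    s' = s(vF := if P d then s vF else 0, vD := int d))" for i s'
  have step: "P (Suc d) \<longleftrightarrow> P d \<and> \<not> d dvd t \<and> (d < r \<longrightarrow> \<not> d dvd r)" if "2 \<le> d" for d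
    using that by (auto simp: P_def less_Suc_eq)
  have pos: "int t mod int d * (int r mod int d + int d div int r) > 0 \<longleftrightarrow>
      \<not> d dvd t \<and> (d < r \<longrightarrow> \<not> d dvd r)" if "2 \<le> d" for d
  proof -
    have "int t mod int d * (int r mod int d + int d div int r) =
        int (t mod d * (r mod d + d div r))"
      by (simp add: zmod_int zdiv_int)
    moreover have "d div r > 0 \<longleftrightarrow> \<not> d < r"
      using \<open>2 < r\<close> by (simp add: div_greater_zero_iff not_less)
    ultimately show ?thesis
      by (auto simp: dvd_eq_mod_eq_0 simp del: of_nat_mult of_nat_add)
  qed
  have "wp V G (While (rd vT -. rd vD)
       (Cond ((rd vT %. rd vD) *. (rd vR %. rd vD +. rd vD /. rd vR)) Skip (vF <~ Const 0) ;;
        vD <~ rd vD +. Const 1)) Q (s(vD := 2))"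
  proof (rule wp_While[of I])
    show "I G (s(vD := 2))"
      unfolding I_def using assms by (intro exI[of _ 2]) (auto simp: P_def fun_eq_iff)
  next
    fix i s' assume "I i s'" "0 < val (rd vT -. rd vD) s'"
    then obtain d where d: "2 \<le> d" "d < t" "t - d \<le> i" "s' = s(vF := if P d then s vF else 0, vD := int d)"
      unfolding I_def using t by auto
    have "I (i - 1) (s'(vF := if P (Suc d) then s vF else 0, vD := int d + 1))"
      unfolding I_def using d by (intro exI[of _ "Suc d"]) (auto simp: fun_eq_iff)
    then show "0 < i \<and> wp V G (Cond ((rd vT %. rd vD) *. (rd vR %. rd vD +. rd vD /. rd vR)) Skip (vF <~ Const 0) ;;
        vD <~ rd vD +. Const 1) (I (i - 1)) s'"
      using d r t assms(6) pos[OF d(1)] step[OF d(1)] by (auto simp: fun_upd_twist)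
  next
    fix i s' assume "I i s'" "\<not> 0 < val (rd vT -. rd vD) s'"
    then have "s' = s(vF := if P t then s vF else 0, vD := int t)"
      unfolding I_def using t by auto
    with Q show "Q s'" using primes_iff[of r t] assms(3,4) by (simp add: P_def)
  qed
  then show ?thesis
    using assms(3-6) by (simp add: primes_com_def)
qed

text \<open>The product of the two current remainders at least halves in every round, because
  \<open>2 * (a mod b) \<le> a\<close>. Hence \<open>m * m < 2 ^ G\<close> limits the number of
  rounds to \<open>G\<close>.\<close>

lemma wp_euclid:
  assumes m: "s vm = m" and M: "s vM = M" and "1 < m" and "m \<le> V" and mm: "m * m < 2 ^ G"
    and Q: "\<And>u v q h. 0 \<le> u \<Longrightarrow> u < m \<Longrightarrow> [u * M = gcd m M] (mod m) \<Longrightarrow>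
      Q (s(va := gcd m M, vb := 0, vu := u, vv := v, vq := q, vh := h))"
  shows "wp V G euclid_com Q s"
proof -
  define I where "I i s' \<longleftrightarrow> (\<exists>a b u v q h. 0 \<le> b \<and> b < a \<and> a \<le> m \<and> gcd a b = gcd m M \<and>
    0 \<le> u \<and> u < m \<and> 0 \<le> v \<and> v < m \<and> [u * M = a] (mod m) \<and> [v * M = b] (mod m) \<and> a * b < 2 ^ i \<and>
    s' = s(va := a, vb := b, vu := u, vv := v, vq := q, vh := h))" for i s'
  have I_intro: "I i (s(va := a, vb := b, vu := u, vv := v, vq := q, vh := h))"
    if "0 \<le> b" "b < a" "a \<le> m" "gcd a b = gcd m M" "0 \<le> u" "u < m" "0 \<le> v" "v < m"
      "[u * M = a] (mod m)" "[v * M = b] (mod m)" "a * b < 2 ^ i" for i a b u v q h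
    unfolding I_def using that by blast
  have "wp V G (While (rd vb)
       (vq <~ rd va /. rd vb ;;
        vh <~ rd va %. rd vb ;; va <~ rd vb ;; vb <~ rd vh ;;
        vh <~ (rd vu -. rd vq *. rd vv) %. rd vm ;; vu <~ rd vv ;; vv <~ rd vh)) Q
        (s(va := m, vb := M mod m, vu := 0, vv := 1))"
  proof (rule wp_While[of I])
    have "m * (M mod m) \<le> m * m"
      using assms(3) less_imp_le[OF pos_mod_bound[of m M]] by (intro mult_left_mono) auto
    then have "m * (M mod m) < 2 ^ G" using mm by linarith
    moreover have "gcd m (M mod m) = gcd m M"
      using gcd_red_int[of M m] by (simp add: gcd.commute)
    moreover have "[0 * M = m] (mod m)" "[1 * M = M mod m] (mod m)"
      by (simp_all add: cong_def)
    ultimately have "I G (s(va := m, vb := M mod m, vu := 0, vv := 1, vq := s vq, vh := s vh))"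
      using assms(3) by (intro I_intro) simp_all
    moreover have "s(va := m, vb := M mod m, vu := 0, vv := 1, vq := s vq, vh := s vh) =
        s(va := m, vb := M mod m, vu := 0, vv := 1)"
      by (simp add: fun_eq_iff)
    ultimately show "I G (s(va := m, vb := M mod m, vu := 0, vv := 1))"
      by simp
  next
    fix i s' assume "I i s'" "0 < val (rd vb) s'"
    then obtain a b u v q h where I: "0 < b" "b < a" "a \<le> m" "gcd a b = gcd m M" "0 \<le> u" "u < m"
      "0 \<le> v" "v < m" "[u * M = a] (mod m)" "[v * M = b] (mod m)" "a * b < 2 ^ i"
      "s' = s(va := a, vb := b, vu := u, vv := v, vq := q, vh := h)"
      unfolding I_def by auto
    have "a * b \<ge> 1 * 1" using I by (intro mult_mono) auto
    with I(11) have "0 < i" by (cases i) auto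
    have ab: "a = b * (a div b) + a mod b" by simp
    have mod: "0 \<le> a mod b" "a mod b < b" using I by auto
    have d1: "1 \<le> a div b" using I pos_imp_zdiv_pos_iff[of b a] by linarith
    have "b * 1 \<le> b * (a div b)" using I d1 by (intro mult_left_mono) auto
    then have "2 * (a mod b) \<le> a" using ab mod by linarith
    then have "b * (2 * (a mod b)) \<le> b * a" using I by (intro mult_left_mono) auto
    also have "\<dots> < 2 * 2 ^ (i - 1)" using I(11) \<open>0 < i\<close> by (cases i) (auto simp: mult.commute)
    finally have "b * (a mod b) < 2 ^ (i - 1)" by simp
    have quot: "\<bar>a div b\<bar> \<le> V"
    proof -
      have "1 * (a div b) \<le> b * (a div b)" using I d1 by (intro mult_right_mono) auto
      then show ?thesis using d1 ab mod I \<open>m \<le> V\<close> by linarith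
    qed
    have gcd: "gcd b (a mod b) = gcd m M"
      using I(4) gcd_red_int[of a b] by simp
    have cong: "[(u - a div b * v) mod m * M = a mod b] (mod m)"
    proof -
      have "[(u - a div b * v) mod m * M = (u - a div b * v) * M] (mod m)"
        by (intro cong_mult cong_refl) (simp add: cong_def)
      also have "(u - a div b * v) * M = u * M - a div b * (v * M)"
        by (simp add: algebra_simps)
      also have "[\<dots> = a - a div b * b] (mod m)"
        by (intro cong_diff cong_mult cong_refl I)
      also have "a - a div b * b = a mod b" by (simp add: minus_div_mult_eq_mod)
      finally show ?thesis .
    qed
    have "I (i - 1) (s(va := b, vb := a mod b, vu := v, vv := (u - a div b * v) mod m,
        vq := a div b, vh := (u - a div b * v) mod m))"
    proof (rule I_intro)
      show "0 \<le> (u - a div b * v) mod m" "(u - a div b * v) mod m < m"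
        using \<open>1 < m\<close> by simp_all
      show "b \<le> m" using I by linarith
    qed (fact | rule I)+
    moreover have "s'(vq := a div b, vh := a mod b, va := b, vb := a mod b, vh := (u - a div b * v) mod m,
        vu := v, vv := (u - a div b * v) mod m) =
        s(va := b, vb := a mod b, vu := v, vv := (u - a div b * v) mod m,
        vq := a div b, vh := (u - a div b * v) mod m)"
      unfolding I(12) by (simp add: fun_eq_iff)
    moreover have "\<bar>(u - a div b * v) mod m\<bar> \<le> V"
      using \<open>1 < m\<close> \<open>m \<le> V\<close> by (intro abs_mod_le) auto
    ultimately show "0 < i \<and> wp V G (vq <~ rd va /. rd vb ;;
        vh <~ rd va %. rd vb ;; va <~ rd vb ;; vb <~ rd vh ;;
        vh <~ (rd vu -. rd vq *. rd vv) %. rd vm ;; vu <~ rd vv ;; vv <~ rd vh) (I (i - 1)) s'"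
      using \<open>0 < i\<close> quot mod I m \<open>m \<le> V\<close> by simp (use mod I \<open>m \<le> V\<close> in linarith)
  next
    fix i s' assume "I i s'" "\<not> 0 < val (rd vb) s'"
    then obtain a b u v q h where I: "0 \<le> b" "b < a" "gcd a b = gcd m M" "0 \<le> u" "u < m"
      "[u * M = a] (mod m)" "s' = s(va := a, vb := b, vu := u, vv := v, vq := q, vh := h)" "\<not> 0 < b"
      unfolding I_def by auto
    then have "b = 0" by simp
    then have "a = gcd m M" using I(2,3) by simp
    then have "Q (s(va := a, vb := 0, vu := u, vv := v, vq := q, vh := h))"
      using Q[of u v q h] I(4-6) by simp
    then show "Q s'" using I(7) \<open>b = 0\<close> by simp
  qed
  moreover have "\<bar>M mod m\<bar> \<le> V"
    using assms(3,4) by (intro abs_mod_le) auto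
  ultimately show ?thesis
    using assms(3,4) m M by (simp add: euclid_com_def)
qed

lemma wp_assign_power:
  assumes "val e s = int n" and "n \<le> G" and "2 ^ n \<le> V" and "Q (s(vP := 2 ^ n, vw := 0))"
  shows "wp V G (vw <~ e) (wp V G power_com Q) s"
proof (rule wp_assign)
  show "\<bar>val e s\<bar> \<le> V"
    using assms(1,3) of_nat_less_two_power[of n, where 'a = int] by linarith
  have "s(vw := int n, vP := 2 ^ n, vw := 0) = s(vP := 2 ^ n, vw := 0)"
    by (simp add: fun_eq_iff)
  then show "wp V G power_com Q (s(vw := val e s))"
    using assms by (intro wp_power) simp_all
qed

lemma wp_cyclo:
  assumes r: "s vR = int r" and t: "s vT = int t" and "prime_pair r t" and G: "r * t \<le> G"
    and V: "2 ^ (r * t) \<le> V"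
    and Q: "\<And>s'. s' vm = cyclo r t \<Longrightarrow> (\<And>z. z \<notin> {vm, vP, vw} \<Longrightarrow> s' z = s z) \<Longrightarrow> Q s'"
  shows "wp V G cyclo_com Q s"
proof -
  interpret prime_pair r t by fact
  have G': "a \<le> G" and V': "2 ^ a \<le> V" if "a \<le> r * t" for a
    using G V that power_increasing[OF that, of "2 :: int"] by linarith+
  have "r \<le> r * t" "t \<le> r * t" using r_gt r_less by auto
  note rt = G'[OF this(1)] V'[OF this(1)] G'[OF this(2)] V'[OF this(2)]
  define n where "n = (2 :: int) ^ (r * t) - 1"
  have n: "\<bar>n\<bar> \<le> V" using V by (simp add: n_def)
  have n': "\<bar>n div z\<bar> \<le> V" for z using order_trans[OF abs_div_le n] .
  have n'': "\<bar>n div z div z'\<bar> \<le> V" for z z' using order_trans[OF abs_div_le n'] .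
  show ?thesis
    unfolding cyclo_com_def wp.simps(3)
    apply (rule wp_assign_power[where n = "r * t"])
       apply (use r t G V in simp_all)[3]
    apply (rule wp_assign)
     apply (use n in \<open>simp add: n_def\<close>)
    apply (rule wp_assign_power[where n = r])
       apply (use r rt in simp_all)[3]
    apply (rule wp_assign)
     apply (use n' in \<open>simp add: n_def\<close>)
    apply (rule wp_assign_power[where n = t])
       apply (use t rt in simp_all)[3]
    apply (rule wp_assign)
     apply (use n'' in \<open>simp add: n_def\<close>)
    apply (rule Q)
     apply (simp_all add: cyclo_def)
    done
qed

text \<open>A solution \<open>c0\<close> known to exist below \<open>r * t\<close> bounds the number
  of rounds; the search stops there at the latest.\<close>

lemma wp_search:
  assumes s: "s 0 = int k" "s vJ = int j" "s vR = int r" "s vT = int t" "s vS = S"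
    and le: "(l, e) = (if j < k then (int j, 0) else (int k, int t))"
    and V: "int (r * t) \<le> V" "int j \<le> V" "int k \<le> V" "int t \<le> V" and G: "r * t \<le> G"
    and c0: "c0 < r * t" "int (r * t) dvd l * int c0 + 1 + e * (S + int j - int k + 1)"
    and Q: "\<And>s' c. int (r * t) dvd l * c + 1 + e * (S + int j - int k + 1) \<Longrightarrow>
      s' vc = c \<Longrightarrow> s' ve = e \<Longrightarrow> 0 \<le> c \<Longrightarrow> (\<And>z. z \<notin> {vl, ve, vc} \<Longrightarrow> s' z = s z) \<Longrightarrow> Q s'"
  shows "wp V G search_com Q s"
proof -
  define s1 where "s1 = s(vl := l, ve := e)"
  define I where "I i s' \<longleftrightarrow> (\<exists>c. c \<le> c0 \<and> c0 - c \<le> i \<and> s' = s1(vc := int c))" for i s'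
  let ?g = "(rd vl *. rd vc +. Const 1 +. rd ve *. (rd vS +. rd vJ -. rd 0 +. Const 1)) %. (rd vR *. rd vT)"
  have g: "val ?g (s1(vc := c)) = (l * c + 1 + e * (S + int j - int k + 1)) mod int (r * t)" for c
    using s by (simp add: s1_def)
  have pos: "0 < int (r * t)" using c0(1) by linarith
  have g': "0 < val ?g (s1(vc := c)) \<longleftrightarrow> \<not> int (r * t) dvd l * c + 1 + e * (S + int j - int k + 1)" for c
    unfolding g dvd_eq_mod_eq_0
    using pos_mod_sign[OF pos, of "l * c + 1 + e * (S + int j - int k + 1)"] by (intro iffI) linarith+
  have loop: "wp V G (While ?g (vc <~ rd vc +. Const 1)) Q (s1(vc := 0))"
  proof (rule wp_While[of I])
    show "I G (s1(vc := 0))"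
      unfolding I_def using c0(1) G by (intro exI[of _ 0]) simp
  next
    fix i s' assume "I i s'" and guard: "0 < val ?g s'"
    then obtain c where c: "c \<le> c0" "c0 - c \<le> i" "s' = s1(vc := int c)"
      unfolding I_def by auto
    have "c \<noteq> c0" using guard c0(2) unfolding c(3) g' by auto
    moreover have "int c + 1 \<le> V" using c(1) c0(1) V(1) by linarith
    ultimately show "0 < i \<and> wp V G (vc <~ rd vc +. Const 1) (I (i - 1)) s'"
      using c by (auto simp: I_def intro!: exI[of _ "Suc c"])
  next
    fix i s' assume "I i s'" and guard: "\<not> 0 < val ?g s'"
    then obtain c where c: "s' = s1(vc := int c)"
      unfolding I_def by auto
    have "int (r * t) dvd l * int c + 1 + e * (S + int j - int k + 1)"
      using guard unfolding c g' by simp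
    then show "Q s'"
      by (rule Q) (simp_all add: c s1_def)
  qed
  have V0: "\<bar>0 :: int\<bar> \<le> V" using V(2) by simp
  have cond: "wp V G (Cond (rd 0 -. rd vJ) (vl <~ rd vJ ;; ve <~ Const 0) (vl <~ rd 0 ;; ve <~ rd vT)) R s"
    if "R s1" for R
    using that le s V by (auto simp: s1_def split: if_splits)
  show ?thesis
    unfolding search_com_def wp.simps(3)
  proof (rule cond, rule wp_assign)
    show "\<bar>val (Const 0) s1\<bar> \<le> V" using V0 by simp
    show "wp V G (While ?g (vc <~ rd vc +. Const 1)) Q (s1(vc := val (Const 0) s1))"
      using loop by (simp only: val.simps(1))
  qed
qed

text \<open>Garner's form of the Chinese remainder theorem, with \<open>u\<close> an inverse of
  \<open>M\<close> modulo \<open>m\<close>. For a reduced \<open>a\<close> the result is already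
  reduced modulo \<open>M * m\<close>.\<close>

definition crt_val :: "int \<Rightarrow> int \<Rightarrow> int \<Rightarrow> int \<Rightarrow> int \<Rightarrow> int" where
  "crt_val a M m u b = a + M * (((b - a) * u) mod m)"

lemma crt_val_bounds:
  assumes "0 \<le> a" and "a < M" and "0 < m"
  shows "0 \<le> crt_val a M m u b" and "crt_val a M m u b < M * m"
proof -
  define z where "z = ((b - a) * u) mod m"
  have z: "0 \<le> z" "z \<le> m - 1" using assms(3) by (simp_all add: z_def)
  have "0 \<le> M * z" "M * z \<le> M * (m - 1)" using z assms by (auto intro!: mult_left_mono)
  then show "0 \<le> crt_val a M m u b" "crt_val a M m u b < M * m"
    using assms unfolding crt_val_def z_def[symmetric] by (auto simp: algebra_simps)
qed

lemma crt_val_cong: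
  assumes "[u * M = 1] (mod m)"
  shows "[crt_val a M m u b = a] (mod M)" and "[crt_val a M m u b = b] (mod m)"
proof -
  show "[crt_val a M m u b = a] (mod M)"
    by (simp add: crt_val_def cong_iff_dvd_diff)
  have "[a + M * (((b - a) * u) mod m) = a + M * ((b - a) * u)] (mod m)"
    by (intro cong_add cong_mult cong_refl) (simp add: cong_def)
  also have "a + M * ((b - a) * u) = a + (b - a) * (u * M)" by simp
  also have "[\<dots> = a + (b - a) * 1] (mod m)"
    by (intro cong_add cong_mult cong_refl assms)
  finally show "[crt_val a M m u b = b] (mod m)" by (simp add: crt_val_def)
qed

lemma wp_crt:
  assumes s: "s 0 = int k" "s vR = int r" "s vT = int t" "s vc = c" "s ve = e"
    "s vM = M" "s vm = m" "s vu = u" "\<And>i. i \<in> {1..2 * k} \<Longrightarrow> s (int i) = x i"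
    and a: "\<And>i. i \<in> {1..2 * k} \<Longrightarrow> 0 \<le> s (2 * int k + int i) \<and> s (2 * int k + int i) < M"
    and V: "M * m \<le> V" "2 * int k \<le> V" "2 ^ (r * t) \<le> V" and G: "r * t \<le> G" "2 * k \<le> G"
    and m: "0 < m" and rt: "0 < r * t"
    and Q: "\<And>s'. (\<And>z. z \<notin> {vI, vP, vw} \<Longrightarrow> z \<le> 2 * int k \<Longrightarrow> s' z = s z) \<Longrightarrow>
      (\<And>i. i \<in> {1..2 * k} \<Longrightarrow> s' (2 * int k + int i) =
        crt_val (s (2 * int k + int i)) M m u (- (2 ^ nat ((c + 2 * e * x i) mod int (r * t))))) \<Longrightarrow> Q s'"
  shows "wp V G crt_com Q s"
proof -
  define new where "new i = crt_val (s (2 * int k + int i)) M m u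
    (- (2 ^ nat ((c + 2 * e * x i) mod int (r * t))))" for i
  have new: "\<bar>new i\<bar> \<le> V" if "i \<in> {1..2 * k}" for i
    using crt_val_bounds[of "s (2 * int k + int i)" M m] a[OF that] m V(1) unfolding new_def
    by (smt (verit))
  \<comment> \<open>\<open>w\<close> is the index to be treated next. Residues are updated from the
    top, so the cells up to \<open>2 * k + w\<close> still hold their old contents, scratch
    variables excepted.\<close>
  define I where "I i s' \<longleftrightarrow> (\<exists>w. w \<le> 2 * k \<and> w \<le> i \<and> s' vI = int w \<and>
    (\<forall>z. z \<notin> {vI, vP, vw} \<and> z \<le> 2 * int k + int w \<longrightarrow> s' z = s z) \<and>
    (\<forall>p. w < p \<and> p \<le> 2 * k \<longrightarrow> s' (2 * int k + int p) = new p))" for i s'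
  let ?body = "vw <~ (rd vc +. Const 2 *. rd ve *. input_cell) %. (rd vR *. rd vT) ;;
        power_com ;;
        Store residue_addr (Cell residue_addr +.
          rd vM *. (((Const 0 -. rd vP -. Cell residue_addr) *. rd vu) %. rd vm)) ;;
        vI <~ rd vI -. Const 1"
  have "wp V G (While (rd vI) ?body) Q (s(vI := 2 * int k))"
  proof (rule wp_While[of I])
    show "I G (s(vI := 2 * int k))"
      unfolding I_def using G by (intro exI[of _ "2 * k"]) auto
  next
    fix i s' assume "I i s'" "0 < val (rd vI) s'"
    then obtain w where w: "0 < w" "w \<le> 2 * k" "w \<le> i" "s' vI = int w"
      and s': "\<And>z. z \<notin> {vI, vP, vw} \<Longrightarrow> z \<le> 2 * int k + int w \<Longrightarrow> s' z = s z"
      and upd: "\<And>p. w < p \<Longrightarrow> p \<le> 2 * k \<Longrightarrow> s' (2 * int k + int p) = new p"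
      unfolding I_def by auto
    have w': "w \<in> {1..2 * k}" using w by simp
    define n where "n = nat ((c + 2 * e * x w) mod int (r * t))"
    have n: "int n = (c + 2 * e * x w) mod int (r * t)" using rt by (simp add: n_def)
    have "int n < int (r * t)" unfolding n using rt by (intro pos_mod_bound) simp
    then have nG: "n \<le> G" and "n \<le> r * t" using G by linarith+
    then have nV: "2 ^ n \<le> V" using V(3) power_increasing[of n "r * t" "2 :: int"] by linarith
    have vals: "s' 0 = int k" "s' vR = int r" "s' vT = int t" "s' vc = c" "s' ve = e"
      "s' vM = M" "s' vm = m" "s' vu = u" "s' (int w) = x w"
      using s' s w w' by auto
    have a_w: "s' (2 * int k + int w) = s (2 * int k + int w)"
      using w by (intro s') auto
    have "I (i - 1) (s'(vP := 2 ^ n, vw := 0, 2 * int k + int w := new w, vI := int w - 1))"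
      unfolding I_def using w s' upd
      by (intro exI[of _ "w - 1"]) (auto simp: of_nat_diff Suc_le_eq dest: le_neq_implies_less)
    moreover have "crt_val (s (2 * int k + int w)) M m u (- (2 ^ n)) = new w"
      by (simp add: new_def n_def)
    moreover have "int w - 1 \<le> V" using w(2) V(2) by linarith
    ultimately show "0 < i \<and> wp V G ?body (I (i - 1)) s'"
      unfolding wp.simps(3) using w new[OF w'] vals a_w n nG nV
      by (intro conjI wp_assign_power[where n = n])
        (simp_all add: input_cell_def residue_addr_def crt_val_def)
  next
    fix i s' assume "I i s'" "\<not> 0 < val (rd vI) s'"
    then show "Q s'"
      unfolding I_def by (intro Q) (auto simp: new_def)
  qed
  then show ?thesis
    using s V by (simp add: crt_com_def)
qed

subsection \<open>Correctness of the program\<close>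

lemma ex_linear_solution:
  assumes "coprime l n" and "0 < n"
  obtains c :: nat where "c < n" and "int n dvd int l * int c + d"
proof -
  obtain y where y: "[int l * y = 1] (mod int n)"
    using cong_solve_coprime_int[of "int l" "int n"] assms(1) by auto
  define c where "c = nat ((- d * y) mod int n)"
  have c: "int c = (- d * y) mod int n" using assms(2) by (simp add: c_def)
  have "int c < int n" unfolding c using assms(2) by (intro pos_mod_bound) simp
  moreover have "[int l * int c + d = int l * (- d * y) + d] (mod int n)"
    unfolding c by (intro cong_add cong_mult cong_refl) (simp add: cong_def)
  moreover have "int l * (- d * y) + d = - d * (int l * y) + d" by simp
  moreover have "[- d * (int l * y) + d = - d * 1 + d] (mod int n)"
    by (intro cong_add cong_mult cong_refl y)
  ultimately have "[int l * int c + d = - d * 1 + d] (mod int n)"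
    by (metis cong_trans)
  then have "int n dvd int l * int c + d"
    by (simp add: cong_0_iff)
  with \<open>int c < int n\<close> that show ?thesis by auto
qed

context partition_instance
begin

definition frame :: "nat \<Rightarrow> nat \<Rightarrow> mem \<Rightarrow> bool" where
  "frame L B s \<longleftrightarrow> s 0 = int k \<and> (\<forall>i\<in>{1..2 * k}. s (int i) = x i) \<and>
     s vS = (\<Sum>i = 1..2 * k. x i) \<and> s vL = int L \<and> s vB = int B"

definition residues_of :: "mem \<Rightarrow> nat \<Rightarrow> int" where
  "residues_of s i = s (2 * int k + int i)"

lemma frame_cong:
  assumes "frame L B s" and "\<And>z. 0 \<le> z \<and> z \<le> 2 * int k \<or> z \<in> {vS, vL, vB} \<Longrightarrow> s' z = s z"
  shows "frame L B s'"
  using assms by (auto simp: frame_def)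

lemma residues_of_cong:
  assumes "\<And>z. 0 \<le> z \<Longrightarrow> s' z = s z"
  shows "residues_of s' = residues_of s"
  using assms by (auto simp: residues_of_def fun_eq_iff)

text \<open>The two continuations correspond to the outcome of the gcd test: either \<open>t\<close>
  divides \<open>2 ^ r - 1\<close> and nothing relevant changes, or condition \<open>j\<close>
  becomes covered.\<close>

lemma wp_extend:
  assumes fr: "frame L B s" and s: "s vR = int r" "s vT = int t" "s vJ = int j"
    and pp: "prime_pair r t" and r: "k + 1 < r" and k: "1 \<le> k" and j: "1 \<le> j" "j < k + r - 1"
    and safe: "safe (s vM) (residues_of s)" and earlier: "earlier (s vM) r t"
    and G: "2 * (r * t) < G" "2 * k \<le> G" and V: "s vM * 2 ^ (r * t) \<le> 2 ^ G"
    and skip: "\<And>s'. frame L B s' \<Longrightarrow> s' vR = int r \<Longrightarrow> s' vT = int t \<Longrightarrow> s' vM = s vM \<Longrightarrow>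
      residues_of s' = residues_of s \<Longrightarrow> s' vJ = int j \<Longrightarrow> [2 ^ r = 1] (mod int t) \<Longrightarrow> Q s'"
    and add: "\<And>s'. frame L B s' \<Longrightarrow> s' vR = int r \<Longrightarrow> s' vT = int t \<Longrightarrow> s' vM = s vM * cyclo r t \<Longrightarrow>
      safe (s' vM) (residues_of s') \<Longrightarrow> covers (s' vM) (residues_of s') r j \<Longrightarrow>
      (\<And>i. i \<in> {1..2 * k} \<Longrightarrow> [residues_of s' i = residues_of s i] (mod s vM)) \<Longrightarrow>
      s' vJ = int (j + 1) \<Longrightarrow> Q s'"
  shows "wp (2 ^ G) G extend_com Q s"
proof -
  interpret prime_pair r t by fact
  define M where "M = s vM"
  define m where "m = cyclo r t"
  have M: "M > 0" using safe by (simp add: safe_def M_def)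
  have m: "1 < m" "m \<le> 2 ^ (r * t)" using cyclo_gt_1 cyclo_le by (simp_all add: m_def)
  have le_V: "int a \<le> 2 ^ G" if "a \<le> G" for a
    using that of_nat_less_two_power[of G, where 'a = int] by linarith
  have rt: "r \<le> r * t" "t \<le> r * t" "0 < r * t" using r_gt r_less by auto
  have rt_V: "2 ^ (r * t) \<le> (2 :: int) ^ G"
    using G by (intro power_increasing) auto
  have "m * m \<le> 2 ^ (r * t) * 2 ^ (r * t)" using m by (intro mult_mono) auto
  also have "\<dots> = 2 ^ (2 * (r * t))" by (simp add: mult_2 power_add)
  also have "\<dots> < (2 :: int) ^ G" using G by (intro power_strict_increasing) auto
  finally have mm: "m * m < 2 ^ G" .
  have Mm: "M * m \<le> 2 ^ G"
  proof -
    have "M * m \<le> M * 2 ^ (r * t)" using m M by (intro mult_left_mono) auto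
    then show ?thesis using V unfolding M_def by linarith
  qed
  have j_V: "int j \<le> 2 ^ G" "int j + 1 \<le> 2 ^ G"
  proof -
    have "j + 1 \<le> G" using j r G(1) rt(1) by linarith
    then have "int (j + 1) \<le> 2 ^ G" by (rule le_V)
    then show "int j \<le> 2 ^ G" "int j + 1 \<le> 2 ^ G" by linarith+
  qed
  define S where "S = (\<Sum>i = 1..2 * k. x i)"
  obtain l e where le: "(l, e) = (if j < k then (int j, 0) else (int k, int t))"
    by (metis surj_pair)
  \<comment> \<open>The coefficient \<open>l\<close> is positive and smaller than both primes, so it
    is invertible modulo \<open>r * t\<close>.\<close>
  have "\<exists>c0 < r * t. int (r * t) dvd l * int c0 + 1 + e * (S + int j - int k + 1)"
  proof -
    define l' where "l' = (if j < k then j else k)"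
    have l': "0 < l'" "l' < r" "l = int l'" using j k r le by (auto simp: l'_def split: if_splits)
    have "coprime l' r" "coprime l' t"
      using prime_imp_coprime[OF prime_r, of l'] prime_imp_coprime[OF prime_s, of l']
        nat_dvd_not_less[of l' r] nat_dvd_not_less[of l' t] l'(1,2) r_less
      by (simp_all add: coprime_commute)
    then have "coprime l' (r * t)" by simp
    then obtain c where "c < r * t" "int (r * t) dvd int l' * int c + (1 + e * (S + int j - int k + 1))"
      by (rule ex_linear_solution[OF _ rt(3)])
    then show ?thesis unfolding l'(3) add.assoc by blast
  qed
  then obtain c0 where c0: "c0 < r * t" "int (r * t) dvd l * int c0 + 1 + e * (S + int j - int k + 1)"
    by blast
  show ?thesis
    unfolding extend_com_def wp.simps(3)
  proof (rule wp_cyclo[OF s(1,2) pp _ rt_V])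
    show "r * t \<le> G" using G by simp
    fix s1 assume s1m: "s1 vm = cyclo r t" and s1: "\<And>z. z \<notin> {vm, vP, vw} \<Longrightarrow> s1 z = s z"
    show "wp (2 ^ G) G euclid_com (wp (2 ^ G) G (Cond (Const 2 -. rd va)
       (search_com ;; crt_com ;; vM <~ rd vM *. rd vm ;; vJ <~ rd vJ +. Const 1) Skip) Q) s1"
    proof (rule wp_euclid[where s = s1 and m = m and M = M])
      show "s1 vm = m" "1 < m" "m * m < 2 ^ G" using s1m m mm by (simp_all add: m_def)
      show "s1 vM = M" using s1 by (simp add: M_def)
      show "m \<le> 2 ^ G" using m rt_V by linarith
      fix u v q h assume u: "0 \<le> u" "u < m" "[u * M = gcd m M] (mod m)"
      define s2 where "s2 = s1(va := gcd m M, vb := 0, vu := u, vv := v, vq := q, vh := h)"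
      have s2: "s2 z = s z" if "z \<notin> {vm, vP, vw, va, vb, vu, vv, vq, vh}" for z
        using that s1[of z] by (simp add: s2_def)
      have s2': "s2 va = gcd m M" "s2 vu = u" "s2 vm = m"
        using s1m by (simp_all add: s2_def m_def)
      have gcd_pos: "gcd m M > 0" using m by simp
      have fr2: "frame L B s2"
        using fr by (rule frame_cong) (auto intro!: s2)
      show "wp (2 ^ G) G (Cond (Const 2 -. rd va)
         (search_com ;; crt_com ;; vM <~ rd vM *. rd vm ;; vJ <~ rd vJ +. Const 1) Skip) Q
         (s1(va := gcd m M, vb := 0, vu := u, vv := v, vq := q, vh := h))"
        unfolding s2_def[symmetric]
      proof (cases "coprime m M")
        case False
        then have "[2 ^ r = 1] (mod int t)"
          using coprime_cyclo[OF earlier pp] by (auto simp: m_def M_def)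
        moreover have "gcd m M \<noteq> 1" using False by (simp add: coprime_iff_gcd_eq_1)
        then have g2: "\<not> gcd m M < 2" using gcd_pos by linarith
        moreover have "residues_of s2 = residues_of s"
          by (rule residues_of_cong) (auto intro!: s2)
        ultimately have "Q s2"
          using s fr2 by (intro skip) (simp_all add: s2)
        then show "wp (2 ^ G) G (Cond (Const 2 -. rd va)
         (search_com ;; crt_com ;; vM <~ rd vM *. rd vm ;; vJ <~ rd vJ +. Const 1) Skip) Q s2"
          using g2 s2' by simp
      next
        case True
        then have g1: "gcd m M = 1" by simp
        have "wp (2 ^ G) G search_com (wp (2 ^ G) G crt_com
          (wp (2 ^ G) G (vM <~ rd vM *. rd vm) (wp (2 ^ G) G (vJ <~ rd vJ +. Const 1) Q))) s2"
        proof (rule wp_search[where k = k and j = j and r = r and t = t and S = S and l = l and e = e and ?c0.0 = c0])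
          show "(l, e) = (if j < k then (int j, 0) else (int k, int t))" by (rule le)
          show "c0 < r * t" "int (r * t) dvd l * int c0 + 1 + e * (S + int j - int k + 1)" by (rule c0)+
          show "s2 0 = int k" "s2 vJ = int j" "s2 vR = int r" "s2 vT = int t" "s2 vS = S"
            using s fr by (simp_all add: s2 frame_def S_def)
          show "r * t \<le> G" using G by simp
          then show "int (r * t) \<le> 2 ^ G" "int t \<le> 2 ^ G" using rt(2) by (blast intro: le_V le_trans)+
          show "int j \<le> 2 ^ G" by (rule j_V)
          show "int k \<le> 2 ^ G" using G by (intro le_V) simp
          fix s3 c assume c: "int (r * t) dvd l * c + 1 + e * (S + int j - int k + 1)"
            and s3': "s3 vc = c" "s3 ve = e" "0 \<le> c" and s3: "\<And>z. z \<notin> {vl, ve, vc} \<Longrightarrow> s3 z = s2 z"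
          have s3_s: "s3 z = s z" if "z \<notin> {vm, vP, vw, va, vb, vu, vv, vq, vh, vl, ve, vc}" for z
            using that s2[of z] s3[of z] by simp
          have s3_res: "s3 (2 * int k + int i) = residues_of s i" for i
            by (simp add: residues_of_def s3_s)
          show "wp (2 ^ G) G crt_com
            (wp (2 ^ G) G (vM <~ rd vM *. rd vm) (wp (2 ^ G) G (vJ <~ rd vJ +. Const 1) Q)) s3"
          proof (rule wp_crt[where k = k and r = r and t = t and c = c and e = e and M = M and m = m and u = u and x = x])
            show "s3 0 = int k" "s3 vR = int r" "s3 vT = int t" "s3 vc = c" "s3 ve = e" "s3 vM = M" "s3 vm = m" "s3 vu = u"
              using s fr s3' s2' by (simp_all add: s3_s frame_def M_def s3)
            show "s3 (int i) = x i" if "i \<in> {1..2 * k}" for i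
              using that fr by (simp add: s3_s frame_def)
            show "0 \<le> s3 (2 * int k + int i) \<and> s3 (2 * int k + int i) < M" if "i \<in> {1..2 * k}" for i
              using that safe by (simp add: s3_res safe_def M_def)
            show "M * m \<le> 2 ^ G" "2 ^ (r * t) \<le> (2 :: int) ^ G" "r * t \<le> G" "2 * k \<le> G" "0 < m" "0 < r * t"
              using Mm rt_V G m rt by simp_all
            show "2 * int k \<le> 2 ^ G" using le_V[OF G(2)] by linarith
            fix s4 assume s4: "\<And>z. z \<notin> {vI, vP, vw} \<Longrightarrow> z \<le> 2 * int k \<Longrightarrow> s4 z = s3 z"
              and s4_res: "\<And>i. i \<in> {1..2 * k} \<Longrightarrow> s4 (2 * int k + int i) =
                crt_val (s3 (2 * int k + int i)) M m u (- (2 ^ nat ((c + 2 * e * x i) mod int (r * t))))"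
            define s5 where "s5 = s4(vM := M * m, vJ := int (j + 1))"
            have s5: "s5 z = s z"
              if "z \<notin> {vm, vP, vw, va, vb, vu, vv, vq, vh, vl, ve, vc, vI, vM, vJ}" "z \<le> 2 * int k" for z
              using that s4[of z] s3_s[of z] by (simp add: s5_def)
            have res: "residues_of s5 i = crt_val (residues_of s i) M m u (- (2 ^ nat ((c + 2 * e * x i) mod int (r * t))))"
              if "i \<in> {1..2 * k}" for i
              using s4_res[OF that] unfolding s3_res residues_of_def[of s5] by (simp add: s5_def)
            have uM: "[u * M = 1] (mod m)" using u g1 by simp
            have a: "[residues_of s5 i = residues_of s i] (mod M)"
              and a': "[residues_of s5 i = - (2 ^ nat ((c + 2 * e * x i) mod int (r * t)))] (mod m)"
              and a'': "0 \<le> residues_of s5 i \<and> residues_of s5 i < M * m" if i: "i \<in> {1..2 * k}" for i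
              unfolding res[OF i] using crt_val_cong[OF uM] crt_val_bounds[of "residues_of s i" M m] safe i m
              by (auto simp: safe_def M_def)
            have fr5: "frame L B s5"
              using fr by (rule frame_cong) (auto intro!: s5)
            have s5': "s5 vM = M * m" "s5 vJ = int (j + 1)" "s5 vR = int r" "s5 vT = int t"
              using s by (simp_all add: s5) (simp_all add: s5_def)
            note step = safe pp r j le c[unfolded S_def]
            have "safe (M * m) (residues_of s5)"
              unfolding M_def m_def
              by (rule safe_step[OF step]) (use a a' a'' in \<open>simp_all add: M_def m_def\<close>)
            moreover have "covers (M * m) (residues_of s5) r j"
              unfolding M_def m_def
              by (rule covers_step[OF step]) (use a a' a'' in \<open>simp_all add: M_def m_def\<close>)
            ultimately have "Q s5"
              using fr5 s5' a by (intro add) (simp_all add: M_def m_def)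
            moreover have "s4 vM = M" "s4 vm = m" "s4 vJ = int j"
              using s4 s s2' by (simp_all add: s3_s M_def s3)
            ultimately show "wp (2 ^ G) G (vM <~ rd vM *. rd vm) (wp (2 ^ G) G (vJ <~ rd vJ +. Const 1) Q) s4"
              using Mm M m j_V by (simp add: s5_def add.commute)
          qed
        qed
        then show "wp (2 ^ G) G (Cond (Const 2 -. rd va)
         (search_com ;; crt_com ;; vM <~ rd vM *. rd vm ;; vJ <~ rd vJ +. Const 1) Skip) Q s2"
          unfolding wp.simps(3,4) using g1 s2' by simp
      qed
    qed
  qed
qed

end

section \<open>Invariants of the two main loops\<close>

definition good_primes :: "nat \<Rightarrow> nat \<Rightarrow> nat set" where
  "good_primes r t = {s. prime s \<and> r < s \<and> s \<le> t \<and> \<not> [2 ^ r = 1] (mod int s)}"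

lemma finite_good_primes [simp]: "finite (good_primes r t)"
  by (rule finite_subset[of _ "{..t}"]) (auto simp: good_primes_def)

lemma good_primes_self [simp]: "good_primes r r = {}"
  by (auto simp: good_primes_def)

lemma good_primes_Suc:
  "good_primes r (Suc t) =
    (if prime (Suc t) \<and> r < Suc t \<and> \<not> [2 ^ r = 1] (mod int (Suc t))
     then insert (Suc t) (good_primes r t) else good_primes r t)"
  by (auto simp: good_primes_def le_Suc_eq)

context partition_instance
begin

text \<open>The exponent of a bound for \<open>M\<close>: initially \<open>15 \<le> 2 ^ 4\<close>,
  and each of the at most \<open>(L + 1) * (B + 1)\<close> pairs contributes a factor of at most
  \<open>2 ^ (L * B)\<close>.\<close>

definition total_bound :: "nat \<Rightarrow> nat \<Rightarrow> nat" where
  "total_bound L B = 4 + L * B * ((L + 1) * (B + 1))"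

definition covered_below :: "nat \<Rightarrow> mem \<Rightarrow> bool" where
  "covered_below r s \<longleftrightarrow> (\<forall>r' j. prime r' \<and> k + 1 < r' \<and> r' < r \<and> 1 \<le> j \<and> j < k + r' - 1 \<longrightarrow>
     covers (s vM) (residues_of s) r' j)"

text \<open>\<open>r * (B + 1) + t\<close> is the rank of the pair \<open>(r, t)\<close> in
  lexicographic order, so the bound on \<open>M\<close> grows by one factor per pair. The pair
  itself counts as processed, hence \<open>t + 1\<close>.\<close>

definition base_inv :: "nat \<Rightarrow> nat \<Rightarrow> nat \<Rightarrow> nat \<Rightarrow> mem \<Rightarrow> bool" where
  "base_inv L B r t s \<longleftrightarrow> frame L B s \<and> s vR = int r \<and> safe (s vM) (residues_of s) \<and>
     earlier (s vM) r (t + 1) \<and> s vM \<le> 2 ^ (4 + L * B * (r * (B + 1) + t))"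

text \<open>\<open>j\<close> is the first open condition for \<open>r\<close>; the value
  \<open>k + r - 1\<close> means that none is left. For the last conjunct, \<open>j\<close> starts
  at 1 and is advanced by every good prime while conditions are open.\<close>

definition inner_inv :: "nat \<Rightarrow> nat \<Rightarrow> nat \<Rightarrow> nat \<Rightarrow> nat \<Rightarrow> mem \<Rightarrow> bool" where
  "inner_inv L B r t j s \<longleftrightarrow> base_inv L B r t s \<and> covered_below r s \<and> s vT = int t \<and> s vJ = int j \<and>
     1 \<le> j \<and> j \<le> k + r - 1 \<and>
     (prime r \<longrightarrow> (\<forall>j'. 1 \<le> j' \<and> j' < j \<longrightarrow> covers (s vM) (residues_of s) r j')) \<and>
     (prime r \<longrightarrow> j = k + r - 1 \<or> card (good_primes r t) < j)"

lemma covered_below_mono: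
  assumes "covered_below r s" and "s' vM = s vM * m"
    and "\<And>i. i \<in> {1..2 * k} \<Longrightarrow> [residues_of s' i = residues_of s i] (mod s vM)"
  shows "covered_below r s'"
  using assms covers_mono[of "s vM" "residues_of s" _ _ "residues_of s'" m]
  unfolding covered_below_def by metis

lemma wp_inner_step:
  assumes inv: "inner_inv L B r t j s" and r: "k + 1 < r" "r \<le> L" "r \<le> t" "t < B"
    and k: "1 \<le> k" and G: "total_bound L B \<le> G"
  shows "wp (2 ^ G) G
       (vT <~ rd vT +. Const 1 ;;
        vF <~ rd 0 +. rd vR -. Const 1 -. rd vJ ;;
        primes_com ;;
        Cond (rd vF) extend_com Skip) (\<lambda>s'. \<exists>j'. inner_inv L B r (Suc t) j' s') s"
proof -
  have le_V: "int a \<le> 2 ^ G" if "a \<le> G" for a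
    using that of_nat_less_two_power[of G, where 'a = int] by linarith
  from inv have fr: "frame L B s" and s: "s vR = int r" "s vT = int t" "s vJ = int j"
    and safe: "safe (s vM) (residues_of s)" and earlier: "earlier (s vM) r (t + 1)"
    and M: "s vM \<le> 2 ^ (4 + L * B * (r * (B + 1) + t))" and below: "covered_below r s"
    and j: "1 \<le> j" "j \<le> k + r - 1"
    and cov: "\<And>j'. prime r \<Longrightarrow> 1 \<le> j' \<Longrightarrow> j' < j \<Longrightarrow> covers (s vM) (residues_of s) r j'"
    and good: "prime r \<Longrightarrow> j = k + r - 1 \<or> card (good_primes r t) < j"
    by (auto simp: inner_inv_def base_inv_def)
  have LB: "1 \<le> L" "1 \<le> B" using r by auto
  \<comment> \<open>The current bound on \<open>M\<close> leaves room for one more factor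
    \<open>2 ^ (L * B)\<close> within \<open>2 ^ G\<close>.\<close>
  have exp: "4 + L * B * (r * (B + 1) + t) + L * B \<le> G"
  proof -
    have "r * (B + 1) \<le> L * (B + 1)" using r(2) by (rule mult_le_mono1)
    moreover have "(L + 1) * (B + 1) = L * (B + 1) + (B + 1)" by simp
    ultimately have "r * (B + 1) + t + 1 \<le> (L + 1) * (B + 1)" using r(4) by linarith
    then have "L * B * (r * (B + 1) + t + 1) \<le> L * B * ((L + 1) * (B + 1))"
      by (rule mult_le_mono2)
    moreover have "L * B * (r * (B + 1) + t + 1) = L * B * (r * (B + 1) + t) + L * B" by simp
    ultimately show ?thesis using G unfolding total_bound_def by linarith
  qed
  have rt_le: "r * Suc t \<le> L * B" using r by (intro mult_mono) auto
  have "L * B * 2 \<le> L * B * (r * (B + 1) + t)"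
    by (intro mult_le_mono2 trans_le_add2) (use r in linarith)
  then have rt_G: "2 * (r * Suc t) < G" using exp rt_le by linarith
  have r_le: "r \<le> L * B" "t + 1 \<le> L * B"
    using r mult_le_mono[of r L 1 B] mult_le_mono[of 1 L "Suc t" B] LB by auto
  then have small: "t + 1 \<le> G" "2 * k \<le> G" "k + r \<le> G" using exp r \<open>L * B * 2 \<le> _\<close> by linarith+
  define P where "P \<longleftrightarrow> prime r \<and> prime (Suc t)"
  define f where "f = int k + int r - 1 - int j"
  define s1 where "s1 = s(vT := int (Suc t), vF := f)"
  define s2 where "s2 = s1(vF := if P then s1 vF else 0, vD := int (Suc t))"
  have s2: "s2 z = s z" if "z \<notin> {vT, vF, vD}" for z
    using that by (simp add: s1_def s2_def)
  have s2': "s2 vT = int (Suc t)" "s2 vF = (if P then f else 0)"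
    by (simp_all add: s1_def s2_def)
  have fr2: "frame L B s2" using fr by (rule frame_cong) (auto intro!: s2)
  have res2: "residues_of s2 = residues_of s" by (rule residues_of_cong) (auto intro!: s2)
  have exp_mono: "(2 :: int) ^ (4 + L * B * (r * (B + 1) + t)) \<le> 2 ^ (4 + L * B * (r * (B + 1) + Suc t))"
    by (intro power_increasing add_mono mult_mono) auto
  \<comment> \<open>If \<open>M\<close> and the residues stay as they are, either no condition is
    open, or \<open>r\<close> is not prime, or \<open>Suc t\<close> is not a good prime and the
    count does not grow.\<close>
  have keep: "\<exists>j'. inner_inv L B r (Suc t) j' s'"
    if "frame L B s'" "s' vR = int r" "s' vT = int (Suc t)" "s' vM = s vM" "residues_of s' = residues_of s"
      "s' vJ = int j" "j = k + r - 1 \<or> \<not> P \<or> [2 ^ r = 1] (mod int (Suc t))" for s'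
  proof -
    have "base_inv L B r (Suc t) s'"
      unfolding base_inv_def using that safe order_trans[OF M exp_mono] earlier_mono[OF earlier, of r "Suc t + 1"]
      by simp
    moreover have "covered_below r s'"
      using below that by (simp add: covered_below_def)
    moreover have "j = k + r - 1 \<or> card (good_primes r (Suc t)) < j" if "prime r"
      using good[OF that] \<open>j = k + r - 1 \<or> _\<close> that by (auto simp: good_primes_Suc P_def)
    ultimately show ?thesis
      using that j cov by (intro exI[of _ j]) (simp add: inner_inv_def)
  qed
  have cond: "wp (2 ^ G) G (Cond (rd vF) extend_com Skip) (\<lambda>s'. \<exists>j'. inner_inv L B r (Suc t) j' s') s2"
  proof (cases "P \<and> j < k + r - 1")
    case False
    then have "\<not> 0 < s2 vF" using j by (auto simp: s2' f_def)
    moreover have "\<exists>j'. inner_inv L B r (Suc t) j' s2"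
      using False fr2 s s2 s2' res2 j by (intro keep) auto
    ultimately show ?thesis by simp
  next
    case True
    then have pos: "0 < s2 vF" using j r by (auto simp: s2' f_def)
    have pp: "prime_pair r (Suc t)"
      using True r k by (unfold_locales) (auto simp: P_def)
    have "wp (2 ^ G) G extend_com (\<lambda>s'. \<exists>j'. inner_inv L B r (Suc t) j' s') s2"
    proof (rule wp_extend[OF fr2 _ _ _ pp r(1) k j(1)])
      show "s2 vR = int r" "s2 vT = int (Suc t)" "s2 vJ = int j"
        using s s2 s2' by auto
      show "j < k + r - 1" using True by simp
      show "safe (s2 vM) (residues_of s2)" "earlier (s2 vM) r (Suc t)"
        using safe earlier s2 res2 by auto
      show "2 * (r * Suc t) < G" "2 * k \<le> G" by fact+
      have "s2 vM * 2 ^ (r * Suc t) \<le> 2 ^ (4 + L * B * (r * (B + 1) + t)) * 2 ^ (L * B)"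
        using M s2 rt_le by (intro mult_mono) auto
      also have "\<dots> \<le> 2 ^ G"
        unfolding power_add[symmetric] using exp by (intro power_increasing) auto
      finally show "s2 vM * 2 ^ (r * Suc t) \<le> 2 ^ G" .
    next
      fix s' assume "frame L B s'" "s' vR = int r" "s' vT = int (Suc t)" "s' vM = s2 vM"
        "residues_of s' = residues_of s2" "s' vJ = int j" "[2 ^ r = 1] (mod int (Suc t))"
      then show "\<exists>j'. inner_inv L B r (Suc t) j' s'"
        using res2 s2 by (intro keep) auto
    next
      fix s' assume s': "frame L B s'" "s' vR = int r" "s' vT = int (Suc t)" "s' vM = s2 vM * cyclo r (Suc t)"
        "safe (s' vM) (residues_of s')" "covers (s' vM) (residues_of s') r j" "s' vJ = int (j + 1)"
        and res': "\<And>i. i \<in> {1..2 * k} \<Longrightarrow> [residues_of s' i = residues_of s2 i] (mod s2 vM)"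
      have M': "s' vM = s vM * cyclo r (Suc t)" using s'(4) s2 by simp
      have res'': "[residues_of s' i = residues_of s i] (mod s vM)" if "i \<in> {1..2 * k}" for i
        using res'[OF that] s2 res2 by simp
      interpret prime_pair r "Suc t" by fact
      have "s vM * cyclo r (Suc t) \<le> 2 ^ (4 + L * B * (r * (B + 1) + t)) * 2 ^ (L * B)"
        using M cyclo_gt_1 order_trans[OF cyclo_le power_increasing[OF rt_le]] by (intro mult_mono) auto
      also have "\<dots> = 2 ^ (4 + L * B * (r * (B + 1) + Suc t))"
        unfolding power_add[symmetric] by (simp add: algebra_simps)
      finally have "base_inv L B r (Suc t) s'"
        using s' M' earlier_cyclo[OF _ pp] earlier by (simp add: base_inv_def)
      moreover have "covered_below r s'"
        using below M' res'' by (rule covered_below_mono)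
      moreover have "covers (s' vM) (residues_of s') r j'" if "1 \<le> j'" "j' < j + 1" for j'
      proof (cases "j' = j")
        case False
        then have "covers (s vM) (residues_of s) r j'"
          using that prime_r by (intro cov) auto
        then show ?thesis unfolding M' using res'' by (rule covers_mono)
      qed (use s' in simp)
      moreover have "card (good_primes r (Suc t)) < j + 1"
        using good[OF prime_r] True by (auto simp: good_primes_Suc card_insert_if)
      ultimately have "inner_inv L B r (Suc t) (j + 1) s'"
        using s' True by (simp add: inner_inv_def)
      then show "\<exists>j'. inner_inv L B r (Suc t) j' s'" ..
    qed
    then show ?thesis using pos by simp
  qed
  have "wp (2 ^ G) G primes_com (wp (2 ^ G) G (Cond (rd vF) extend_com Skip)
      (\<lambda>s'. \<exists>j'. inner_inv L B r (Suc t) j' s')) s1"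
  proof (rule wp_primes[where r = r and t = "Suc t"])
    show "s1 vR = int r" "s1 vT = int (Suc t)" using s by (simp_all add: s1_def)
    show "2 < r" "r < Suc t" using r k by auto
    show "Suc t \<le> G" "int (Suc t) \<le> 2 ^ G" using small le_V[OF small(1)] by simp_all
    show "wp (2 ^ G) G (Cond (rd vF) extend_com Skip) (\<lambda>s'. \<exists>j'. inner_inv L B r (Suc t) j' s')
        (s1(vF := if prime r \<and> prime (Suc t) then s1 vF else 0, vD := int (Suc t)))"
      using cond unfolding s2_def P_def .
  qed
  moreover have "\<bar>f\<bar> \<le> 2 ^ G"
    using le_V[OF small(3)] j r by (simp add: f_def)
  moreover have "\<bar>int (Suc t)\<bar> \<le> 2 ^ G" using le_V[OF small(1)] by simp
  ultimately show ?thesis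
    using s fr by (simp add: s1_def f_def frame_def add.commute)
qed


lemma safe_cong:
  assumes "\<And>i. i \<in> {1..2 * k} \<Longrightarrow> a i = b i"
  shows "safe M a \<longleftrightarrow> safe M b"
proof -
  have "hits M a I \<longleftrightarrow> hits M b I" if "I \<subseteq> {1..2 * k}" for I
  proof (rule hits_cong)
    fix i assume "i \<in> I"
    with that have "i \<in> {1..2 * k}" by blast
    then show "[a i = b i] (mod M)" by (simp only: assms cong_refl)
  qed
  then show ?thesis
    using assms by (auto simp: safe_def)
qed

lemma wp_inner:
  assumes inv: "inner_inv L B r r 1 s" and r: "k + 1 < r" "r \<le> L" "r \<le> B"
    and k: "1 \<le> k" and G: "total_bound L B \<le> G" "B \<le> G"
    and Q: "\<And>s' j. inner_inv L B r B j s' \<Longrightarrow> Q s'"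
  shows "wp (2 ^ G) G inner_com Q s"
  unfolding inner_com_def
proof (rule wp_While[where I = "\<lambda>i s'. \<exists>t j. r \<le> t \<and> t \<le> B \<and> B - t \<le> i \<and> inner_inv L B r t j s'"])
  show "\<exists>t j. r \<le> t \<and> t \<le> B \<and> B - t \<le> G \<and> inner_inv L B r t j s"
    using inv r G(2) by (meson diff_le_self le_refl le_trans)
next
  fix i s'
  assume "\<exists>t j. r \<le> t \<and> t \<le> B \<and> B - t \<le> i \<and> inner_inv L B r t j s'" and guard: "0 < val (rd vB -. rd vT) s'"
  then obtain t j where t: "r \<le> t" "t \<le> B" "B - t \<le> i" and inv': "inner_inv L B r t j s'"
    by blast
  have "t < B"
    using guard inv' by (simp add: inner_inv_def base_inv_def frame_def)
  show "0 < i \<and> wp (2 ^ G) G (vT <~ rd vT +. Const 1 ;; vF <~ rd 0 +. rd vR -. Const 1 -. rd vJ ;;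
      primes_com ;; Cond (rd vF) extend_com Skip)
      (\<lambda>s'. \<exists>t j. r \<le> t \<and> t \<le> B \<and> B - t \<le> i - 1 \<and> inner_inv L B r t j s') s'"
  proof (rule conjI)
    show "0 < i" using \<open>t < B\<close> t by linarith
    show "wp (2 ^ G) G (vT <~ rd vT +. Const 1 ;; vF <~ rd 0 +. rd vR -. Const 1 -. rd vJ ;;
      primes_com ;; Cond (rd vF) extend_com Skip)
      (\<lambda>s'. \<exists>t j. r \<le> t \<and> t \<le> B \<and> B - t \<le> i - 1 \<and> inner_inv L B r t j s') s'"
    proof (rule wp_mono[OF wp_inner_step[OF inv' r(1,2) t(1) \<open>t < B\<close> k G(1)]])
      fix s'' assume "\<exists>j'. inner_inv L B r (Suc t) j' s''"
      moreover have "r \<le> Suc t \<and> Suc t \<le> B \<and> B - Suc t \<le> i - 1"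
        using t \<open>t < B\<close> by linarith
      ultimately show "\<exists>t j. r \<le> t \<and> t \<le> B \<and> B - t \<le> i - 1 \<and> inner_inv L B r t j s''"
        by blast
    qed
  qed
next
  fix i s'
  assume "\<exists>t j. r \<le> t \<and> t \<le> B \<and> B - t \<le> i \<and> inner_inv L B r t j s'" and guard: "\<not> 0 < val (rd vB -. rd vT) s'"
  then obtain t j where t: "r \<le> t" "t \<le> B" and inv': "inner_inv L B r t j s'"
    by blast
  have "t = B"
    using guard inv' t by (simp add: inner_inv_def base_inv_def frame_def)
  then show "Q s'" using inv' Q by simp
qed

text \<open>There are at least \<open>2 * L\<close> good primes, more than
  \<open>j \<le> k + r - 1 < 2 * L\<close>. So the invariant leaves only
  \<open>j = k + r - 1\<close>, which means that every condition for a prime \<open>r\<close> has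
  been met.\<close>

lemma covered_below_Suc:
  assumes "inner_inv L B r B j s" and "B = 64 * L\<^sup>2 + 1" and "k + 1 < r" and "r \<le> L"
  shows "covered_below (Suc r) s"
proof -
  have "j = k + r - 1" if "prime r"
  proof -
    have "2 * L \<le> card (good_primes r B)"
      using card_primes_not_dvd_ge[of r L] assms(2-4) by (simp add: good_primes_def)
    moreover have "j = k + r - 1 \<or> card (good_primes r B) < j" "j \<le> k + r - 1"
      using assms(1) that by (auto simp: inner_inv_def)
    ultimately show ?thesis using assms(3,4) by linarith
  qed
  with assms(1) show ?thesis
    unfolding inner_inv_def covered_below_def by (auto simp: less_Suc_eq)
qed

lemma wp_outer:
  assumes inv: "base_inv L B (k + 1) B s" and L: "k + 1 \<le> L" and B: "B = 64 * L\<^sup>2 + 1"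
    and k: "1 \<le> k" and G: "total_bound L B \<le> G"
    and Q: "\<And>s'. base_inv L B L B s' \<Longrightarrow> covered_below (Suc L) s' \<Longrightarrow> Q s'"
  shows "wp (2 ^ G) G outer_com Q s"
  unfolding outer_com_def
proof (rule wp_While[where I = "\<lambda>i s'. \<exists>r. k + 1 \<le> r \<and> r \<le> L \<and> L - r \<le> i \<and>
      base_inv L B r B s' \<and> covered_below (Suc r) s'"])
  have "1 \<le> L" using L by simp
  have "L * 1 \<le> L * L" using \<open>1 \<le> L\<close> by (intro mult_le_mono2)
  then have LB: "L \<le> B" unfolding B power2_eq_square by linarith
  have "1 * B \<le> L * B" using \<open>1 \<le> L\<close> by (intro mult_le_mono1)
  also have "\<dots> = L * B * 1" by simp
  also have "\<dots> \<le> L * B * ((L + 1) * (B + 1))" by (intro mult_le_mono2) simp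
  finally have B_G: "B \<le> G" using G by (simp add: total_bound_def)
  have le_V: "int a \<le> 2 ^ G" if "a \<le> G" for a
    using that of_nat_less_two_power[of G, where 'a = int] by linarith
  \<comment> \<open>The start \<open>r = k + 1\<close> is vacuous: only primes above
    \<open>k + 1\<close> carry conditions.\<close>
  show "\<exists>r. k + 1 \<le> r \<and> r \<le> L \<and> L - r \<le> G \<and> base_inv L B r B s \<and> covered_below (Suc r) s"
    using inv L LB B_G by (intro exI[of _ "k + 1"]) (auto simp: covered_below_def)
  let ?body = "vR <~ rd vR +. Const 1 ;; vJ <~ Const 1 ;; vT <~ rd vR ;; inner_com"
  fix i s'
  assume I: "\<exists>r. k + 1 \<le> r \<and> r \<le> L \<and> L - r \<le> i \<and> base_inv L B r B s' \<and> covered_below (Suc r) s'"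
  then obtain r where r: "k + 1 \<le> r" "r \<le> L" "L - r \<le> i" and base: "base_inv L B r B s'"
    and below: "covered_below (Suc r) s'"
    by blast
  {
    assume guard: "0 < val (rd vL -. rd vR) s'"
    have "r < L"
      using guard base by (simp add: base_inv_def frame_def)
    define s1 where "s1 = s'(vR := int (Suc r), vJ := 1, vT := int (Suc r))"
    have s1: "s1 z = s' z" if "z \<notin> {vR, vJ, vT}" for z
      using that by (simp add: s1_def)
    have res: "residues_of s1 = residues_of s'"
      by (rule residues_of_cong) (auto intro!: s1)
    \<comment> \<open>The rank does not drop from the last pair \<open>(r, B)\<close> to the start
      \<open>(Suc r, Suc r)\<close> of the next inner loop.\<close>
    have exp: "L * B * (r * (B + 1) + B) \<le> L * B * (Suc r * (B + 1) + Suc r)"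
      by (intro mult_le_mono2) simp
    have "base_inv L B (Suc r) (Suc r) s1"
      unfolding base_inv_def
    proof (intro conjI)
      show "frame L B s1"
        using base unfolding base_inv_def by (elim conjE) (erule frame_cong, auto intro!: s1)
      show "s1 vR = int (Suc r)" by (simp add: s1_def)
      show "safe (s1 vM) (residues_of s1)"
        using base res s1 by (simp add: base_inv_def)
      show "earlier (s1 vM) (Suc r) (Suc r + 1)"
        using base s1 earlier_mono[of "s' vM" r "B + 1" "Suc r" "Suc r + 1"] by (simp add: base_inv_def)
      have "s' vM \<le> 2 ^ (4 + L * B * (r * (B + 1) + B))"
        using base by (simp add: base_inv_def)
      also have "\<dots> \<le> (2 :: int) ^ (4 + L * B * (Suc r * (B + 1) + Suc r))"
        using exp by (intro power_increasing add_mono) auto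
      finally show "s1 vM \<le> 2 ^ (4 + L * B * (Suc r * (B + 1) + Suc r))"
        using s1 by simp
    qed
    moreover have "covered_below (Suc r) s1"
      using below res s1 by (simp add: covered_below_def)
    ultimately have inv1: "inner_inv L B (Suc r) (Suc r) 1 s1"
      using k by (simp add: inner_inv_def s1_def)
    have "wp (2 ^ G) G inner_com (\<lambda>s'. \<exists>r. k + 1 \<le> r \<and> r \<le> L \<and> L - r \<le> i - 1 \<and>
        base_inv L B r B s' \<and> covered_below (Suc r) s') s1"
    proof (rule wp_inner[OF inv1 _ _ _ k G B_G])
      show "k + 1 < Suc r" "Suc r \<le> L" "Suc r \<le> B" using r \<open>r < L\<close> LB by linarith+
      fix s2 j assume inv2: "inner_inv L B (Suc r) B j s2"
      have "covered_below (Suc (Suc r)) s2"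
        using inv2 B by (rule covered_below_Suc) (use r \<open>r < L\<close> in auto)
      then show "\<exists>r. k + 1 \<le> r \<and> r \<le> L \<and> L - r \<le> i - 1 \<and> base_inv L B r B s2 \<and> covered_below (Suc r) s2"
        using inv2 r \<open>r < L\<close> by (intro exI[of _ "Suc r"]) (auto simp: inner_inv_def)
    qed
    moreover have "s' vR = int r" using base by (simp add: base_inv_def)
    moreover have "int r + 1 \<le> 2 ^ G"
    proof -
      have "int (Suc r) \<le> 2 ^ G" using \<open>r < L\<close> LB B_G by (intro le_V) simp
      then show ?thesis by simp
    qed
    ultimately show "0 < i \<and> wp (2 ^ G) G ?body (\<lambda>s'. \<exists>r. k + 1 \<le> r \<and> r \<le> L \<and> L - r \<le> i - 1 \<and>
        base_inv L B r B s' \<and> covered_below (Suc r) s') s'"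
      using r \<open>r < L\<close> by (simp add: s1_def add.commute)
  }
  assume guard: "\<not> 0 < val (rd vL -. rd vR) s'"
  have "r = L"
    using guard base r by (simp add: base_inv_def frame_def)
  then show "Q s'" using base below Q by simp
qed

lemma wp_output:
  assumes s: "s 0 = int k" and res: "\<And>i. i \<in> {1..2 * k} \<Longrightarrow> \<bar>residues_of s i\<bar> \<le> V" and M: "\<bar>s vM\<bar> \<le> V"
    and G: "2 * k \<le> G" "2 * int k \<le> V"
    and Q: "\<And>s'. s' 0 = s vM \<Longrightarrow> (\<And>i. i \<in> {1..2 * k} \<Longrightarrow> s' (int i) = residues_of s i) \<Longrightarrow> Q s'"
  shows "wp V G output_com Q s"
proof -
  define I where "I i s' \<longleftrightarrow> (\<exists>w. w \<le> 2 * k \<and> w \<le> i \<and> s' vI = int w \<and>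
    (\<forall>z. z \<noteq> vI \<and> (z \<le> 0 \<or> 2 * int k < z) \<longrightarrow> s' z = s z) \<and>
    (\<forall>p. w < p \<and> p \<le> 2 * k \<longrightarrow> s' (int p) = residues_of s p))" for i s'
  let ?body = "Store (rd vI) (Cell residue_addr) ;; vI <~ rd vI -. Const 1"
  have "wp V G (While (rd vI) ?body) (wp V G (Store (Const 0) (rd vM)) Q) (s(vI := 2 * int k))"
  proof (rule wp_While[of I])
    show "I G (s(vI := 2 * int k))"
      unfolding I_def using G by (intro exI[of _ "2 * k"]) auto
  next
    fix i s' assume "I i s'" "0 < val (rd vI) s'"
    then obtain w where w: "0 < w" "w \<le> 2 * k" "w \<le> i" "s' vI = int w"
      and s': "\<And>z. z \<noteq> vI \<Longrightarrow> z \<le> 0 \<or> 2 * int k < z \<Longrightarrow> s' z = s z"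
      and upd: "\<And>p. w < p \<Longrightarrow> p \<le> 2 * k \<Longrightarrow> s' (int p) = residues_of s p"
      unfolding I_def by auto
    have "s' 0 = int k" "s' (2 * int k + int w) = residues_of s w"
      using s s' w by (auto simp: residues_of_def)
    moreover have "I (i - 1) (s'(int w := residues_of s w, vI := int w - 1))"
      unfolding I_def using w s' upd
      by (intro exI[of _ "w - 1"]) (auto simp: of_nat_diff Suc_le_eq dest: le_neq_implies_less)
    moreover have "int w - 1 \<le> V" using w(2) G(2) by linarith
    ultimately show "0 < i \<and> wp V G ?body (I (i - 1)) s'"
      using w res[of w] by (simp add: residue_addr_def)
  next
    fix i s' assume "I i s'" "\<not> 0 < val (rd vI) s'"
    then have "s' vM = s vM" "\<And>p. p \<in> {1..2 * k} \<Longrightarrow> s' (int p) = residues_of s p"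
      unfolding I_def by auto
    then show "wp V G (Store (Const 0) (rd vM)) Q s'"
      using M by (simp, intro Q) auto
  qed
  then show ?thesis
    using s G by (simp add: output_com_def)
qed

lemma wp_init:
  assumes s: "s 0 = int k" "\<And>i. i \<in> {1..2 * k} \<Longrightarrow> s (int i) = x i" "s vS = 0" "s vA = 0"
    and h: "(\<Sum>i = 1..2 * k. (x i)\<^sup>2) < 2 ^ h"
    and G: "64 * (4 * (k + 2 + h)\<^sup>2 + 1)\<^sup>2 + 1 \<le> G"
    and Q: "\<And>s' N. k + 2 \<le> N \<Longrightarrow> N \<le> k + 2 + h \<Longrightarrow> (\<Sum>i = 1..2 * k. (x i)\<^sup>2) < 2 ^ (N - (k + 2)) \<Longrightarrow>
      frame (4 * N\<^sup>2 + 1) (64 * (4 * N\<^sup>2 + 1)\<^sup>2 + 1) s' \<Longrightarrow> s' vM = 15 \<Longrightarrow> s' vR = int (k + 1) \<Longrightarrow>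
      (\<And>i. i \<in> {1..2 * k} \<Longrightarrow> residues_of s' i = 11) \<Longrightarrow> Q s'"
  shows "wp (2 ^ G) G init_com Q s"
proof -
  define A where "A = (\<Sum>i = 1..2 * k. (x i)\<^sup>2)"
  define Nm where "Nm = k + 2 + h"
  have le_V: "int a \<le> 2 ^ G" if "a \<le> G" for a
    using that of_nat_less_two_power[of G, where 'a = int] by linarith
  have sq: "a \<le> a\<^sup>2" for a :: nat by (simp add: power2_eq_square)
  have N_bounds: "N \<le> G" "4 * N\<^sup>2 + 1 \<le> G" "64 * (4 * N\<^sup>2 + 1)\<^sup>2 + 1 \<le> G" if "N \<le> Nm" for N
  proof -
    have "N\<^sup>2 \<le> Nm\<^sup>2" using that by (intro power_mono) auto
    then have "(4 * N\<^sup>2 + 1)\<^sup>2 \<le> (4 * Nm\<^sup>2 + 1)\<^sup>2" by (intro power_mono) auto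
    then show b3: "64 * (4 * N\<^sup>2 + 1)\<^sup>2 + 1 \<le> G" using G unfolding Nm_def by linarith
    show b2: "4 * N\<^sup>2 + 1 \<le> G" using b3 sq[of "4 * N\<^sup>2 + 1"] by linarith
    show "N \<le> G" using b2 sq[of N] by linarith
  qed
  have k_G: "2 * k \<le> G" using N_bounds(2)[of "k + 2"] sq[of "k + 2"] unfolding Nm_def by linarith
  have h_G: "h \<le> G" using N_bounds(1)[of Nm] unfolding Nm_def by linarith
  have A_nonneg: "0 \<le> A" unfolding A_def by (intro sum_nonneg) simp
  have "A < 2 ^ h" using h by (simp add: A_def)
  also have "\<dots> \<le> (2 :: int) ^ G" using h_G by (intro power_increasing) auto
  finally have A_V: "A \<le> 2 ^ G" by simp
  have squares: "(\<Sum>i\<in>J. (x i)\<^sup>2) \<le> A" if "J \<subseteq> {1..2 * k}" for J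
    unfolding A_def using that by (intro sum_mono2) auto
  have sums: "\<bar>\<Sum>i\<in>J. x i\<bar> \<le> A" if "J \<subseteq> {1..2 * k}" for J
    using abs_sum_le_sum_squares[of x J] squares[OF that] by linarith
  have numerals: "\<bar>11\<bar> \<le> (2 :: int) ^ G" "\<bar>15\<bar> \<le> (2 :: int) ^ G"
    using le_V[of 11] le_V[of 15] N_bounds(3)[of 0] by auto
  define I where "I i s' \<longleftrightarrow> (\<exists>w. w \<le> 2 * k \<and> w \<le> i \<and> s' vI = int w \<and>
    (\<forall>z. 0 \<le> z \<and> z \<le> 2 * int k \<longrightarrow> s' z = s z) \<and>
    s' vS = (\<Sum>p\<in>{w<..2 * k}. x p) \<and> s' vA = (\<Sum>p\<in>{w<..2 * k}. (x p)\<^sup>2) \<and>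
    (\<forall>p. w < p \<and> p \<le> 2 * k \<longrightarrow> s' (2 * int k + int p) = 11))" for i s'
  \<comment> \<open>Because \<open>A < 2 ^ h\<close>, the number \<open>q\<close> of halvings never
    exceeds \<open>h\<close>.\<close>
  define J where "J i s' \<longleftrightarrow> (\<exists>q. q \<le> h \<and> h - q \<le> i \<and> s' vA = A div 2 ^ q \<and> s' vN = int (k + 2 + q) \<and>
    (\<forall>z. 0 \<le> z \<and> z \<le> 2 * int k \<longrightarrow> s' z = s z) \<and> s' vS = (\<Sum>i = 1..2 * k. x i) \<and>
    (\<forall>p. p \<in> {1..2 * k} \<longrightarrow> s' (2 * int k + int p) = 11))" for i s'
  let ?body1 = "vS <~ rd vS +. input_cell ;; vA <~ rd vA +. input_cell *. input_cell ;;
    Store residue_addr (Const 11) ;; vI <~ rd vI -. Const 1"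
  let ?body2 = "vA <~ rd vA /. Const 2 ;; vN <~ rd vN +. Const 1"
  let ?tail = "vL <~ Const 4 *. rd vN *. rd vN +. Const 1 ;; vB <~ Const 64 *. rd vL *. rd vL +. Const 1 ;;
    vM <~ Const 15 ;; vR <~ rd 0 +. Const 1"
  have tail: "wp (2 ^ G) G ?tail Q s'" if inv: "J i s'" and guard: "\<not> 0 < s' vA" for i s'
  proof -
    obtain q where q: "q \<le> h" "s' vA = A div 2 ^ q" "s' vN = int (k + 2 + q)"
      and s': "\<And>z. 0 \<le> z \<Longrightarrow> z \<le> 2 * int k \<Longrightarrow> s' z = s z" "s' vS = (\<Sum>i = 1..2 * k. x i)"
        "\<And>p. p \<in> {1..2 * k} \<Longrightarrow> s' (2 * int k + int p) = 11"
      using inv unfolding J_def by auto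
    define N where "N = k + 2 + q"
    define L where "L = 4 * N\<^sup>2 + 1"
    define B where "B = 64 * L\<^sup>2 + 1"
    have N: "s' vN = int N" using q by (simp add: N_def)
    have "N \<le> Nm" using q by (simp add: N_def Nm_def)
    from N_bounds[OF this] have bounds: "L \<le> G" "B \<le> G" unfolding L_def B_def by simp_all
    have "A < 2 ^ q"
      using guard q(2) pos_imp_zdiv_pos_iff[of "2 ^ q" A] by simp
    have k': "k + 1 \<le> G" using k_G N_bounds(1)[of "k + 2"] by (simp add: Nm_def)
    define s2 where "s2 = s'(vL := int L, vB := int B, vM := 15, vR := int (k + 1))"
    have "frame L B s2"
      using s s' by (auto simp: frame_def s2_def)
    moreover have "residues_of s2 i = 11" if "i \<in> {1..2 * k}" for i
      using s'(3)[OF that] by (simp add: residues_of_def s2_def)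
    ultimately have "Q s2"
      using q(1) \<open>A < 2 ^ q\<close> unfolding L_def B_def
      by (intro Q[of N]) (auto simp: N_def A_def s2_def)
    moreover have "4 * int N * int N + 1 = int L"
      by (simp add: L_def power2_eq_square)
    moreover have "64 * int L * int L + 1 = int B"
      by (simp add: B_def power2_eq_square)
    moreover have "s' 0 = int k" using s'(1)[of 0] s by simp
    moreover have "\<bar>int L\<bar> \<le> 2 ^ G" "\<bar>int B\<bar> \<le> 2 ^ G" "\<bar>int (k + 1)\<bar> \<le> 2 ^ G"
      using le_V bounds k' by (simp_all only: abs_of_nat)
    moreover have "int k + 1 = int (k + 1)" by simp
    ultimately show ?thesis
      using N numerals unfolding s2_def by (simp add: add.commute)
  qed
  have loop2: "wp (2 ^ G) G (vN <~ rd 0 +. Const 2) (wp (2 ^ G) G (While (rd vA) ?body2) (wp (2 ^ G) G ?tail Q)) s'"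
    if s': "I i s'" "\<not> 0 < s' vI" for i s'
  proof (rule wp_assign)
    have s'': "\<And>z. 0 \<le> z \<Longrightarrow> z \<le> 2 * int k \<Longrightarrow> s' z = s z" "s' vS = (\<Sum>i = 1..2 * k. x i)" "s' vA = A"
      "\<And>p. p \<in> {1..2 * k} \<Longrightarrow> s' (2 * int k + int p) = 11"
    proof -
      have "{0<..2 * k} = {1..2 * k}" by auto
      then show "\<And>z. 0 \<le> z \<Longrightarrow> z \<le> 2 * int k \<Longrightarrow> s' z = s z" "s' vS = (\<Sum>i = 1..2 * k. x i)" "s' vA = A"
        "\<And>p. p \<in> {1..2 * k} \<Longrightarrow> s' (2 * int k + int p) = 11"
        using s' unfolding I_def A_def by auto
    qed
    have val: "val (rd 0 +. Const 2) s' = int (k + 2)" using s''(1)[of 0] s by simp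
    show "\<bar>val (rd 0 +. Const 2) s'\<bar> \<le> 2 ^ G"
      unfolding val abs_of_nat by (intro le_V N_bounds) (simp add: Nm_def)
    show "wp (2 ^ G) G (While (rd vA) ?body2) (wp (2 ^ G) G ?tail Q) (s'(vN := val (rd 0 +. Const 2) s'))"
      unfolding val
    proof (rule wp_While[of J])
      show "J G (s'(vN := int (k + 2)))"
        unfolding J_def using s'' h_G by (intro exI[of _ 0]) auto
    next
      fix i s1 assume "J i s1" "0 < val (rd vA) s1"
      then obtain q where q: "q \<le> h" "h - q \<le> i" "s1 vA = A div 2 ^ q" "s1 vN = int (k + 2 + q)"
        and s1: "\<And>z. 0 \<le> z \<Longrightarrow> z \<le> 2 * int k \<Longrightarrow> s1 z = s z" "s1 vS = (\<Sum>i = 1..2 * k. x i)"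
          "\<And>p. p \<in> {1..2 * k} \<Longrightarrow> s1 (2 * int k + int p) = 11" and pos: "0 < A div 2 ^ q"
        unfolding J_def by auto
      have "2 ^ q \<le> A" using pos pos_imp_zdiv_pos_iff[of "2 ^ q" A] by simp
      then have "(2 :: int) ^ q < 2 ^ h" using h unfolding A_def by linarith
      then have "q < h" by simp
      have div: "A div 2 ^ q div 2 = A div 2 ^ Suc q"
        unfolding power_Suc2 by (rule zdiv_zmult2_eq[symmetric]) simp
      have "J (i - 1) (s1(vA := A div 2 ^ Suc q, vN := int (k + 2 + Suc q)))"
        unfolding J_def using q \<open>q < h\<close> s1 by (intro exI[of _ "Suc q"]) auto
      moreover have "\<bar>A div 2 ^ Suc q\<bar> \<le> 2 ^ G"
        using order_trans[OF abs_div_le, of A] A_V A_nonneg by simp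
      moreover have "\<bar>int (k + 2 + Suc q)\<bar> \<le> 2 ^ G"
        unfolding abs_of_nat using \<open>q < h\<close> by (intro le_V N_bounds) (simp add: Nm_def)
      moreover have "int (k + 2 + q) + 1 = int (k + 2 + Suc q)" by simp
      ultimately show "0 < i \<and> wp (2 ^ G) G ?body2 (J (i - 1)) s1"
        using q \<open>q < h\<close> div
        by (simp only: wp.simps val.simps apply_op.simps fun_upd_apply if_True if_False simp_thms) simp
    next
      fix i s1 assume "J i s1" "\<not> 0 < val (rd vA) s1"
      then show "wp (2 ^ G) G ?tail Q s1" by (intro tail) simp_all
    qed
  qed
  have "wp (2 ^ G) G (While (rd vI) ?body1) (wp (2 ^ G) G (vN <~ rd 0 +. Const 2)
    (wp (2 ^ G) G (While (rd vA) ?body2) (wp (2 ^ G) G ?tail Q))) (s(vI := 2 * int k))"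
  proof (rule wp_While[of I])
    show "I G (s(vI := 2 * int k))"
      unfolding I_def using s k_G by (intro exI[of _ "2 * k"]) auto
  next
    fix i s' assume "I i s'" "0 < val (rd vI) s'"
    then obtain w where w: "0 < w" "w \<le> 2 * k" "w \<le> i" "s' vI = int w"
      and s': "\<And>z. 0 \<le> z \<Longrightarrow> z \<le> 2 * int k \<Longrightarrow> s' z = s z"
        "s' vS = (\<Sum>p\<in>{w<..2 * k}. x p)" "s' vA = (\<Sum>p\<in>{w<..2 * k}. (x p)\<^sup>2)"
      and upd: "\<And>p. w < p \<Longrightarrow> p \<le> 2 * k \<Longrightarrow> s' (2 * int k + int p) = 11"
      unfolding I_def by auto
    have ins: "{w - 1<..2 * k} = insert w {w<..2 * k}" using w by auto
    define S' where "S' = (\<Sum>p\<in>{w - 1<..2 * k}. x p)"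
    define A' where "A' = (\<Sum>p\<in>{w - 1<..2 * k}. (x p)\<^sup>2)"
    have S': "s' vS + x w = S'" and A': "s' vA + x w * x w = A'"
      unfolding S'_def A'_def ins using s' by (simp_all add: power2_eq_square)
    have sub: "{w - 1<..2 * k} \<subseteq> {1..2 * k}" using w by auto
    have "\<bar>S'\<bar> \<le> 2 ^ G" using sums[OF sub] A_V unfolding S'_def by linarith
    moreover have "\<bar>A'\<bar> \<le> 2 ^ G"
      using squares[OF sub] sum_nonneg[of "{w - 1<..2 * k}" "\<lambda>p. (x p)\<^sup>2"] A_V unfolding A'_def by simp
    moreover have "s' (int w) = x w" using s'(1)[of "int w"] s(2)[of w] w by simp
    moreover have "s' 0 = int k" using s'(1)[of 0] s by simp
    moreover have "I (i - 1) (s'(vS := S', vA := A', 2 * int k + int w := 11, vI := int w - 1))"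
      unfolding I_def S'_def A'_def using w s'(1) upd
      by (intro exI[of _ "w - 1"]) (auto simp: of_nat_diff Suc_le_eq dest: le_neq_implies_less)
    moreover have "int w - 1 \<le> 2 ^ G" using w(2) le_V[OF k_G] by linarith
    ultimately show "0 < i \<and> wp (2 ^ G) G ?body1 (I (i - 1)) s'"
      using w S' A' numerals by (simp add: input_cell_def residue_addr_def)
  next
    fix i s' assume "I i s'" "\<not> 0 < val (rd vI) s'"
    then show "wp (2 ^ G) G (vN <~ rd 0 +. Const 2)
      (wp (2 ^ G) G (While (rd vA) ?body2) (wp (2 ^ G) G ?tail Q)) s'"
      by (intro loop2) simp_all
  qed
  then show ?thesis
    unfolding init_com_def wp.simps(2,3) using s(1) le_V[OF k_G] by simp
qed


lemma total_bound_mono: "L \<le> L' \<Longrightarrow> B \<le> B' \<Longrightarrow> total_bound L B \<le> total_bound L' B'"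
  unfolding total_bound_def by (intro add_mono mult_le_mono) auto

lemma le_total_bound:
  assumes "1 \<le> L" and "1 \<le> B"
  shows "L \<le> total_bound L B" and "B \<le> total_bound L B"
proof -
  have "L * B * 1 \<le> L * B * ((L + 1) * (B + 1))" by (intro mult_le_mono2) simp
  then have "L * B \<le> total_bound L B" by (simp add: total_bound_def)
  moreover have "L * 1 \<le> L * B" "1 * B \<le> L * B" using assms by (auto intro: mult_le_mono)
  ultimately show "L \<le> total_bound L B" "B \<le> total_bound L B" by linarith+
qed

lemma wp_construction:
  assumes k: "1 \<le> k" and s: "s 0 = int k" "\<And>i. i \<in> {1..2 * k} \<Longrightarrow> s (int i) = x i" "s vS = 0" "s vA = 0"
    and h: "(\<Sum>i = 1..2 * k. (x i)\<^sup>2) < 2 ^ h"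
    and Nm: "k + 2 + h \<le> Nm" and G: "total_bound (4 * Nm\<^sup>2 + 1) (64 * (4 * Nm\<^sup>2 + 1)\<^sup>2 + 1) \<le> G"
  shows "wp (2 ^ G) G construction_com (\<lambda>s'. \<exists>N. k + 1 < N \<and>
    (\<Sum>i = 1..2 * k. (x i)\<^sup>2) < 2 ^ (N - (k + 1)) \<and> safe (s' 0) (\<lambda>i. s' (int i)) \<and>
    (\<forall>r j. prime r \<and> k + 1 < r \<and> r \<le> 4 * N\<^sup>2 + 1 \<and> 1 \<le> j \<and> j < k + r - 1 \<longrightarrow>
      covers (s' 0) (\<lambda>i. s' (int i)) r j)) s" (is "wp _ _ _ ?Q s")
  unfolding construction_com_def wp.simps(3)
proof (rule wp_init[OF s h])
  have mono: "4 * N\<^sup>2 + 1 \<le> 4 * Nm\<^sup>2 + 1" if "N \<le> Nm" for N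
    using power_mono[OF that, of 2] by simp
  have mono': "64 * (4 * N\<^sup>2 + 1)\<^sup>2 + 1 \<le> 64 * (4 * Nm\<^sup>2 + 1)\<^sup>2 + (1 :: nat)" if "N \<le> Nm" for N
    using power_mono[OF mono[OF that], of 2] by simp
  show "64 * (4 * (k + 2 + h)\<^sup>2 + 1)\<^sup>2 + 1 \<le> G"
    using mono'[OF Nm] le_total_bound(2)[of "4 * Nm\<^sup>2 + 1" "64 * (4 * Nm\<^sup>2 + 1)\<^sup>2 + 1"] G by linarith
  fix s1 N
  assume N: "k + 2 \<le> N" "N \<le> k + 2 + h" and A: "(\<Sum>i = 1..2 * k. (x i)\<^sup>2) < 2 ^ (N - (k + 2))"
    and s1: "frame (4 * N\<^sup>2 + 1) (64 * (4 * N\<^sup>2 + 1)\<^sup>2 + 1) s1" "s1 vM = 15" "s1 vR = int (k + 1)"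
      "\<And>i. i \<in> {1..2 * k} \<Longrightarrow> residues_of s1 i = 11"
  define L where "L = 4 * N\<^sup>2 + 1"
  define B where "B = 64 * L\<^sup>2 + 1"
  have N_Nm: "N \<le> Nm" using N(2) Nm by simp
  have G': "total_bound L B \<le> G"
    unfolding B_def L_def by (rule order_trans[OF total_bound_mono[OF mono[OF N_Nm] mono'[OF N_Nm]] G])
  have "N * 1 \<le> N\<^sup>2" unfolding power2_eq_square using N by (intro mult_le_mono2) simp
  then have kL: "2 * k \<le> L" "k + 1 \<le> L" unfolding L_def using N(1) by linarith+
  have LG: "L \<le> G" using le_total_bound(1)[of L B] G' by (simp add: L_def B_def)
  have exp: "4 + L * B * (L * (B + 1) + B) \<le> G"
  proof -
    have "L * B * (L * (B + 1) + B) \<le> L * B * ((L + 1) * (B + 1))"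
      by (rule mult_le_mono2) (simp add: algebra_simps)
    then show ?thesis using G' unfolding total_bound_def by linarith
  qed
  have "base_inv L B (k + 1) B s1"
    unfolding base_inv_def
  proof (intro conjI)
    show "frame L B s1" using s1(1) by (simp add: L_def B_def)
    show "s1 vR = int (k + 1)" by (rule s1)
    show "safe (s1 vM) (residues_of s1)"
      using safe_cong[of "residues_of s1" "\<lambda>i. 11" 15] s1(2,4) safe_initial by simp
    show "earlier (s1 vM) (k + 1) (B + 1)" by (simp add: earlier_def s1(2))
    have "s1 vM \<le> 2 ^ 4" using s1(2) by simp
    also have "\<dots> \<le> (2 :: int) ^ (4 + L * B * ((k + 1) * (B + 1) + B))"
      by (intro power_increasing) auto
    finally show "s1 vM \<le> 2 ^ (4 + L * B * ((k + 1) * (B + 1) + B))" .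
  qed
  then show "wp (2 ^ G) G outer_com (wp (2 ^ G) G output_com ?Q) s1"
  proof (rule wp_outer[OF _ kL(2) B_def k G'])
    fix s2 assume base: "base_inv L B L B s2" and below: "covered_below (Suc L) s2"
    have safe: "safe (s2 vM) (residues_of s2)" and fr: "frame L B s2"
      using base by (auto simp: base_inv_def)
    have "s2 vM \<le> 2 ^ (4 + L * B * (L * (B + 1) + B))"
      using base by (simp add: base_inv_def)
    also have "\<dots> \<le> 2 ^ G" using exp by (intro power_increasing) auto
    finally have M: "s2 vM \<le> 2 ^ G" .
    show "wp (2 ^ G) G output_com ?Q s2"
    proof (rule wp_output)
      show "s2 0 = int k" using fr by (simp add: frame_def)
      show "\<bar>s2 vM\<bar> \<le> 2 ^ G" using M safe by (simp add: safe_def)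
      show "\<bar>residues_of s2 i\<bar> \<le> 2 ^ G" if "i \<in> {1..2 * k}" for i
        using that M safe unfolding safe_def by (smt (verit))
      show *: "2 * k \<le> G" using kL LG by linarith
      show "2 * int k \<le> 2 ^ G"
        using * of_nat_less_two_power[of G, where 'a = int] by linarith
      fix s' assume s': "s' 0 = s2 vM" "\<And>i. i \<in> {1..2 * k} \<Longrightarrow> s' (int i) = residues_of s2 i"
      have "safe (s' 0) (\<lambda>i. s' (int i))"
        using safe safe_cong[of "\<lambda>i. s' (int i)" "residues_of s2"] s' by simp
      moreover have "covers (s' 0) (\<lambda>i. s' (int i)) r j"
        if "prime r \<and> k + 1 < r \<and> r \<le> 4 * N\<^sup>2 + 1 \<and> 1 \<le> j \<and> j < k + r - 1" for r j
      proof -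
        have "covers (s2 vM) (residues_of s2) r j"
          using below that unfolding covered_below_def L_def by auto
        \<comment> \<open>Monotonicity with the factor 1 replaces the residues by the equal values
          in the output cells.\<close>
        then have "covers (s2 vM * 1) (\<lambda>i. s' (int i)) r j"
          by (rule covers_mono) (simp only: s'(2) cong_refl)
        then show ?thesis by (simp add: s'(1))
      qed
      moreover have "(2 :: int) ^ (N - (k + 2)) \<le> 2 ^ (N - (k + 1))"
        by (intro power_increasing) auto
      then have "(\<Sum>i = 1..2 * k. (x i)\<^sup>2) < 2 ^ (N - (k + 1))"
        using A by linarith
      moreover have "k + 1 < N" using N(1) by simp
      ultimately show "?Q s'" by blast
    qed
  qed
qed

end

section \<open>Input size and the polynomial time bound\<close>

lemma length_le_input_size: "length inp \<le> input_size inp"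
  by (induction inp) (simp_all add: input_size_def bits_def)

lemma abs_less_input_size:
  assumes "z \<in> set inp"
  shows "\<bar>z\<bar> < 2 ^ input_size inp"
proof -
  have "bits z \<le> input_size inp"
    unfolding input_size_def using assms by (intro member_le_sum_list) auto
  then have "floorlog 2 (nat \<bar>z\<bar>) \<le> input_size inp"
    by (simp add: bits_def)
  then have "nat \<bar>z\<bar> < 2 ^ input_size inp"
    by (rule floorlog_leD) simp
  then have "int (nat \<bar>z\<bar>) < int (2 ^ input_size inp)"
    by (simp only: of_nat_less_iff)
  then show ?thesis by simp
qed

lemma init_mem_input:
  fixes k :: nat and x :: "nat \<Rightarrow> int"
  defines "inp \<equiv> int k # map x [1..<2 * k + 1]"
  shows "init_mem inp 0 = int k" and "i \<in> {1..2 * k} \<Longrightarrow> init_mem inp (int i) = x i"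
    and "z < 0 \<Longrightarrow> init_mem inp z = 0"
proof -
  show "init_mem inp 0 = int k" by (simp add: init_mem_def inp_def)
  show "init_mem inp (int i) = x i" if "i \<in> {1..2 * k}"
  proof -
    obtain i' where i': "i = Suc i'" "i' < 2 * k" using \<open>i \<in> _\<close> by (cases i) auto
    then have "map x [1..<2 * k + 1] ! i' = x i" by (simp del: upt_Suc)
    moreover have "nat (int i) = Suc i'" using i' by simp
    ultimately show ?thesis using i' by (simp add: init_mem_def inp_def del: upt_Suc nat_int)
  qed
  show "z < 0 \<Longrightarrow> init_mem inp z = 0" by (simp add: init_mem_def)
qed

theorem theorem5:
  "\<exists>(alg :: com) (p :: nat poly). \<forall>(k :: nat) (x :: nat \<Rightarrow> int). odd k \<and> k \<ge> 1 \<longrightarrow>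
     (let inp = int k # map x [1..<2 * k + 1];
          S = (\<Sum>i = 1..2 * k. x i)
      in \<exists>(M :: int) (a :: nat \<Rightarrow> int).
           outputs_within alg inp (poly p (input_size inp)) (M # map a [1..<2 * k + 1]) \<and>
           M > 0 \<and>
           (\<forall>i \<in> {1..2 * k}. gcd (a i) M = 1) \<and>
           (\<forall>N :: nat \<Rightarrow> int. (\<forall>i \<in> {1..2 * k}. [N i = a i] (mod M)) \<longrightarrow>
              (\<forall>I. I \<subseteq> {1..2 * k} \<and> card I \<le> k \<longrightarrow>
                 (gcd (2 * (\<Prod>i\<in>I. N i) + 1) M = 1 \<longleftrightarrow>
                    card I = k \<and> real_of_int (\<Sum>i\<in>I. x i) = real_of_int S / 2)) \<and>
              (\<forall>i \<in> {1..2 * k}. \<not> (N i - 1) dvd (4 * (\<Prod>j = 1..2 * k. N j))) \<and>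
              gcd (2 * (\<Prod>i = 1..2 * k. N i) + 1) M > 1 \<and>
              gcd (4 * (\<Prod>i = 1..2 * k. N i) + 1) M > 1))"
proof -
  \<comment> \<open>In terms of the input size \<open>n\<close>, \<open>NP\<close> bounds
    \<open>k + 2 + 3 * n\<close>. \<open>LP\<close> and \<open>BP\<close> are the resulting limits
    for \<open>r\<close> and \<open>t\<close>, and \<open>GP\<close> is \<open>total_bound\<close>
    of these.\<close>
  define NP where "NP = [:2, 4 :: nat:]"
  define LP where "LP = [:4:] * NP ^ 2 + 1"
  define BP where "BP = [:64:] * LP ^ 2 + 1"
  define GP where "GP = [:4:] + LP * BP * ((LP + 1) * (BP + 1))"
  \<comment> \<open>The same \<open>GP\<close> bounds the exponent of all stored values and the
    number of iterations of every loop.\<close>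
  obtain p where p: "\<And>n. com_bound (poly GP n) (poly GP n) construction_com = poly p n"
    using com_bound_poly[of GP GP construction_com] by blast
  show ?thesis
  proof (intro exI[of _ construction_com] exI[of _ p] allI impI, unfold Let_def)
    fix k :: nat and x :: "nat \<Rightarrow> int"
    assume "odd k \<and> k \<ge> 1"
    then interpret partition_instance k x by unfold_locales simp
    have k: "1 \<le> k" using \<open>odd k \<and> k \<ge> 1\<close> by simp
    define inp where "inp = int k # map x [1..<2 * k + 1]"
    define n where "n = input_size inp"
    define Nm where "Nm = k + 2 + 3 * n"
    define G where "G = poly GP n"
    have len: "2 * k + 1 \<le> n"
      using length_le_input_size[of inp] by (simp add: n_def inp_def del: upt_Suc)
    have "Nm \<le> poly NP n" using len by (simp add: Nm_def NP_def)
    have G: "total_bound (4 * (poly NP n)\<^sup>2 + 1) (64 * (4 * (poly NP n)\<^sup>2 + 1)\<^sup>2 + 1) \<le> G"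
      by (simp add: G_def GP_def BP_def LP_def total_bound_def)
    have small: "\<bar>z\<bar> < 2 ^ n" if "z \<in> set inp" for z
      using abs_less_input_size[OF that] by (simp add: n_def)
    note mem = init_mem_input[where k = k and x = x, folded inp_def]
    \<comment> \<open>There are fewer than \<open>2 ^ n\<close> summands, each at most
      \<open>(2 ^ n)\<^sup>2\<close>; this explains the exponent \<open>3 * n\<close>.\<close>
    have "(\<Sum>i = 1..2 * k. (x i)\<^sup>2) < 2 ^ (3 * n)"
    proof -
      have "(x i)\<^sup>2 \<le> (2 ^ n)\<^sup>2" if "i \<in> {1..2 * k}" for i
      proof -
        have "x i \<in> set inp" using that by (auto simp: inp_def simp del: upt_Suc)
        then have "\<bar>x i\<bar> \<le> \<bar>2 ^ n\<bar>" using small[of "x i"] by simp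
        then show ?thesis by (simp only: abs_le_square_iff)
      qed
      then have "(\<Sum>i = 1..2 * k. (x i)\<^sup>2) \<le> (\<Sum>i = 1..2 * k. (2 ^ n)\<^sup>2)"
        by (intro sum_mono) auto
      also have "\<dots> = int (2 * k) * (2 ^ n)\<^sup>2" by simp
      also have "\<dots> < 2 ^ n * (2 ^ n)\<^sup>2"
      proof (rule mult_strict_right_mono)
        show "int (2 * k) < 2 ^ n"
          using len of_nat_less_two_power[of n, where 'a = int] by linarith
      qed simp
      also have "\<dots> = 2 ^ (3 * n)" by (simp flip: power_mult power_add)
      finally show ?thesis .
    qed
    then have "wp (2 ^ G) G construction_com (\<lambda>s'. \<exists>N. k + 1 < N \<and>
        (\<Sum>i = 1..2 * k. (x i)\<^sup>2) < 2 ^ (N - (k + 1)) \<and> safe (s' 0) (\<lambda>i. s' (int i)) \<and>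
        (\<forall>r j. prime r \<and> k + 1 < r \<and> r \<le> 4 * N\<^sup>2 + 1 \<and> 1 \<le> j \<and> j < k + r - 1 \<longrightarrow>
          covers (s' 0) (\<lambda>i. s' (int i)) r j)) (init_mem inp)"
      using \<open>Nm \<le> poly NP n\<close>
      by (intro wp_construction[OF k _ _ _ _ _ _ G]) (simp_all add: Nm_def mem)
    moreover have "\<bar>init_mem inp z\<bar> \<le> 2 ^ G" for z
    proof -
      have "n \<le> poly NP n" by (simp add: NP_def)
      also have "poly NP n * 1 \<le> (poly NP n)\<^sup>2"
        unfolding power2_eq_square by (intro mult_le_mono2) (simp add: NP_def)
      then have "poly NP n \<le> 4 * (poly NP n)\<^sup>2 + 1" by simp
      also have "\<dots> \<le> G"
        by (rule order_trans[OF le_total_bound(1) G]) simp_all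
      finally have le: "(2 :: int) ^ n \<le> 2 ^ G" by (intro power_increasing) auto
      show ?thesis
      proof (cases "0 \<le> z \<and> z < int (length inp)")
        case True
        then have "inp ! nat z \<in> set inp" by (intro nth_mem) (simp add: nat_less_iff)
        then have "\<bar>inp ! nat z\<bar> \<le> 2 ^ G" using small le by (meson less_le_trans less_imp_le)
        with True show ?thesis by (simp add: init_mem_def)
      qed (auto simp: init_mem_def)
    qed
    moreover have "G > 0" by (simp add: G_def GP_def)
    ultimately obtain t s N where exec: "exec construction_com (init_mem inp) t s"
      and t: "t \<le> com_bound G G construction_com"
      and N: "k + 1 < N" "(\<Sum>i = 1..2 * k. (x i)\<^sup>2) < 2 ^ (N - (k + 1))"
      and safe: "safe (s 0) (\<lambda>i. s (int i))"
      and covers: "\<And>r j. prime r \<Longrightarrow> k + 1 < r \<Longrightarrow> r \<le> 4 * N\<^sup>2 + 1 \<Longrightarrow> 1 \<le> j \<Longrightarrow> j < k + r - 1 \<Longrightarrow>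
        covers (s 0) (\<lambda>i. s (int i)) r j"
      using wp_exec[of G G construction_com _ "init_mem inp"] by blast
    define M where "M = s 0"
    define a where "a i = s (int i)" for i
    have safe': "safe M a" using safe by (simp add: M_def a_def[abs_def])
    have covers': "covers M a r j"
      if "prime r" "k + 1 < r" "r \<le> 4 * N\<^sup>2 + 1" "1 \<le> j" "j < k + r - 1" for r j
      using covers[OF that] by (simp add: M_def a_def[abs_def])
    have "s (int i) = (M # map a [1..<2 * k + 1]) ! i" if "i < length (M # map a [1..<2 * k + 1])" for i
      using that by (cases i) (simp_all add: M_def a_def del: upt_Suc)
    moreover have "t \<le> poly p (input_size inp)"
      using t p[of n] by (simp add: G_def n_def)
    ultimately have "outputs_within construction_com inp (poly p (input_size inp)) (M # map a [1..<2 * k + 1])"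
      unfolding outputs_within_def using exec by blast
    moreover have "M > 0" "\<forall>i\<in>{1..2 * k}. gcd (a i) M = 1"
      using safe' by (auto simp: safe_def)
    moreover have "(\<forall>I. I \<subseteq> {1..2 * k} \<and> card I \<le> k \<longrightarrow>
              (gcd (2 * (\<Prod>i\<in>I. b i) + 1) M = 1 \<longleftrightarrow>
                 card I = k \<and> real_of_int (\<Sum>i\<in>I. x i) = real_of_int (\<Sum>i = 1..2 * k. x i) / 2)) \<and>
           (\<forall>i \<in> {1..2 * k}. \<not> (b i - 1) dvd (4 * (\<Prod>j = 1..2 * k. b j))) \<and>
           gcd (2 * (\<Prod>i = 1..2 * k. b i) + 1) M > 1 \<and>
           gcd (4 * (\<Prod>i = 1..2 * k. b i) + 1) M > 1"
      if b: "\<forall>i \<in> {1..2 * k}. [b i = a i] (mod M)" for b :: "nat \<Rightarrow> int"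
    proof -
      note correct = construction_correct[OF safe' N k, where b = b]
      show ?thesis
      proof (intro conjI allI impI ballI)
        fix I assume "I \<subseteq> {1..2 * k} \<and> card I \<le> k"
        then show "gcd (2 * (\<Prod>i\<in>I. b i) + 1) M = 1 \<longleftrightarrow>
            card I = k \<and> real_of_int (\<Sum>i\<in>I. x i) = real_of_int (\<Sum>i = 1..2 * k. x i) / 2"
          using covers' b by (intro correct(1)) blast+
      next
        fix i assume "i \<in> {1..2 * k}"
        then show "\<not> (b i - 1) dvd (4 * (\<Prod>j = 1..2 * k. b j))"
          using covers' b by (intro correct(2)) blast+
      next
        show "gcd (2 * (\<Prod>i = 1..2 * k. b i) + 1) M > 1" "gcd (4 * (\<Prod>i = 1..2 * k. b i) + 1) M > 1"
          using covers' b by (blast intro: correct(3,4))+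
      qed
    qed
    ultimately show "\<exists>(M :: int) (a :: nat \<Rightarrow> int).
        outputs_within construction_com (int k # map x [1..<2 * k + 1])
          (poly p (input_size (int k # map x [1..<2 * k + 1]))) (M # map a [1..<2 * k + 1]) \<and>
        M > 0 \<and>
        (\<forall>i \<in> {1..2 * k}. gcd (a i) M = 1) \<and>
        (\<forall>N :: nat \<Rightarrow> int. (\<forall>i \<in> {1..2 * k}. [N i = a i] (mod M)) \<longrightarrow>
           (\<forall>I. I \<subseteq> {1..2 * k} \<and> card I \<le> k \<longrightarrow>
              (gcd (2 * (\<Prod>i\<in>I. N i) + 1) M = 1 \<longleftrightarrow>
                 card I = k \<and> real_of_int (\<Sum>i\<in>I. x i) = real_of_int (\<Sum>i = 1..2 * k. x i) / 2)) \<and>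
           (\<forall>i \<in> {1..2 * k}. \<not> (N i - 1) dvd (4 * (\<Prod>j = 1..2 * k. N j))) \<and>
           gcd (2 * (\<Prod>i = 1..2 * k. N i) + 1) M > 1 \<and>
           gcd (4 * (\<Prod>i = 1..2 * k. N i) + 1) M > 1)"
      unfolding inp_def[symmetric]
      by blast
  qed
qed

end
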